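(* Let $n\ge1$ and let $p_t(r,\eta)$ be the subelliptic heat kernel on $\mathbb{S}^{4n+3}$ issued from the north pole, in cylindric coordinates. For $t>0$, $r\in[0,\pi/2)$, $\eta\in[0,\pi]$, $$p_t(r,\eta)=\frac{e^{-t}}{\sqrt{\pi t}}\int_0^{+\infty}\frac{\sinh y\,\sin\left(\frac{\eta y}{2t}\right)}{\sin\eta}\,e^{-\frac{y^2-\eta^2}{4t}}\,q_t(\cos r\cosh y)\,dy$$ (at $\eta\in\{0,\pi\}$ the right-hand side is understood by continuity), where $q_t$ is the Riemannian heat kernel of $\mathbb{S}^{4n+3}$.
   Context: $\mathbb{S}^{4n+3}=\{q\in\mathbb{H}^{n+1}:\|q\|=1\}$ ($\mathbb{H}$ the quaternions) with its round metric and Laplace–Beltrami operator $\Delta$. The unit quaternions $\mathbf{SU}(2)$ act isometrically by $g\cdot(q_1,\dots,q_{n+1})=(gq_1,\dots,gq_{n+1})$ with quotient $\mathbb{HP}^n$. The sub-Laplacian $L$ is the lift of the Laplace–Beltrami operator of $\mathbb{HP}^n$, i.e. $L=\Delta-T_1^2-T_2^2-T_3^2$ with $T_1,T_2,T_3$ the unit-length generators $f\mapsto\frac{d}{d\theta}|_{\theta=0}f(e^{S\theta}q)$, $S=I,J,K$. $p_t$ is the kernel of $e^{tL}$ from the north pole $(0,\dots,0,1)$ with respect to the Riemannian volume; it depends only on $(r,\eta)\in[0,\pi/2)\times[0,\pi]$ defined by $|q_{n+1}|=\cos r$, $\mathrm{Re}(q_{n+1})=\cos r\cos\eta$. $q_t(\cos\delta)$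 is the heat kernel of $e^{t\Delta}$ on $\mathbb{S}^{4n+3}$ from the north pole, with respect to the Riemannian volume, $\delta$ being the Riemannian distance from the north pole. As a function of its argument it is given by $$q_t(x)=\frac{\Gamma(2n+1)}{2\pi^{2n+2}}\sum_{m=0}^{+\infty}(m+2n+1)e^{-m(m+4n+2)t}C_m^{2n+1}(x),$$ with $C_m^{2n+1}$ the Gegenbauer polynomials, and this series is used to define $q_t(x)$ also for $x>1$. *)

theory Defs
  imports "HOL-Analysis.Analysis"
begin

section \<open>Calculus on the round unit sphere of a Euclidean space\<close>

fun Ck_on :: "nat \<Rightarrow> 'a::euclidean_space set \<Rightarrow> ('a \<Rightarrow> real) \<Rightarrow> bool" where
  "Ck_on 0 U F \<longleftrightarrow> continuous_on U F"
| "Ck_on (Suc k) U F \<longleftrightarrow>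
     (\<forall>x\<in>U. F differentiable (at x)) \<and> (\<forall>v. Ck_on k U (\<lambda>x. frechet_derivative F (at x) v))"

text \<open>
  Functions and vector fields on the sphere are represented by functions on the ambient
  space of which only the values on the sphere matter. Such an \<open>f\<close> is differentiated through
  its extension \<open>f \<circ> sgn\<close> to the complement of the origin, which is constant along rays
  (\<open>sgn x = x / \<parallel>x\<parallel>\<close>).
\<close>

definition smooth_on_sphere :: "('a::euclidean_space \<Rightarrow> real) \<Rightarrow> bool" where
  "smooth_on_sphere f \<longleftrightarrow> (\<forall>k. Ck_on k (- {0}) (f \<circ> sgn))"

text \<open>
  The differential of \<open>f\<close> at \<open>x\<close>, evaluated at the orthogonal projection of \<open>v\<close> to the tangent
  space at \<open>x\<close>.
\<close>

definition sphere_deriv :: "'a::euclidean_space \<Rightarrow> ('a \<Rightarrow> real) \<Rightarrow> 'a \<Rightarrow> real" where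
  "sphere_deriv v f x = deriv (\<lambda>s. f (sgn (x + s *\<^sub>R v))) 0"

text \<open>
  Gradient and divergence of the metric induced from the ambient space. The Levi-Civita
  connection is the tangential part of the ambient derivative, so the divergence of a tangent
  field \<open>X\<close> is the trace of its tangential derivative; the normal direction contributes nothing
  to the sum over the ambient basis, because \<open>X \<circ> sgn\<close> is constant along rays.
\<close>

definition sphere_grad :: "('a::euclidean_space \<Rightarrow> real) \<Rightarrow> 'a \<Rightarrow> 'a" where
  "sphere_grad f x = (\<Sum>b\<in>Basis. sphere_deriv b f x *\<^sub>R b)"

definition sphere_div :: "('a::euclidean_space \<Rightarrow> 'a) \<Rightarrow> 'a \<Rightarrow> real" where
  "sphere_div X x = (\<Sum>b\<in>Basis. sphere_deriv b (\<lambda>y. X y \<bullet> b) x)"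

definition laplace_beltrami :: "('a::euclidean_space \<Rightarrow> real) \<Rightarrow> 'a \<Rightarrow> real" where
  "laplace_beltrami f = sphere_div (sphere_grad f)"

text \<open>
  The (unnormalised) Riemannian volume: the volume of \<open>A\<close> is \<open>DIM('a)\<close> times the Lebesgue
  measure of the cone over \<open>A\<close> inside the unit ball.
\<close>

definition sphere_volume :: "'a::euclidean_space measure" where
  "sphere_volume =
     scale_measure (ennreal (real DIM('a)))
       (distr (restrict_space lborel (cball 0 1 - {0})) (restrict_space borel (sphere 0 1)) sgn)"

section \<open>Semigroups of operators on spaces of continuous functions\<close>

text \<open>Strongly continuous semigroups of bounded operators on \<open>C(S)\<close>, for compact \<open>S\<close>.\<close>

definition C0_semigroup_on ::
  "'a::topological_space set \<Rightarrow> (real \<Rightarrow> ('a \<Rightarrow> real) \<Rightarrow> 'a \<Rightarrow> real) \<Rightarrow> bool" where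
  "C0_semigroup_on S P \<longleftrightarrow>
     (\<forall>t\<ge>0. \<forall>f. continuous_on S f \<longrightarrow> continuous_on S (P t f)) \<and>
     (\<forall>t\<ge>0. \<forall>f g a b. continuous_on S f \<longrightarrow> continuous_on S g \<longrightarrow>
        (\<forall>x\<in>S. P t (\<lambda>y. a * f y + b * g y) x = a * P t f x + b * P t g x)) \<and>
     (\<forall>t\<ge>0. \<exists>M. \<forall>f B. continuous_on S f \<longrightarrow> (\<forall>x\<in>S. \<bar>f x\<bar> \<le> B) \<longrightarrow>
        (\<forall>x\<in>S. \<bar>P t f x\<bar> \<le> M * B)) \<and>
     (\<forall>f. continuous_on S f \<longrightarrow> (\<forall>x\<in>S. P 0 f x = f x)) \<and>
     (\<forall>s\<ge>0. \<forall>t\<ge>0. \<forall>f. continuous_on S f \<longrightarrow> (\<forall>x\<in>S. P (s + t) f x = P s (P t f) x)) \<and>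
     (\<forall>f. continuous_on S f \<longrightarrow> uniform_limit S (\<lambda>t. P t f) f (at_right 0))"

definition in_generator ::
  "'a::topological_space set \<Rightarrow> (real \<Rightarrow> ('a \<Rightarrow> real) \<Rightarrow> 'a \<Rightarrow> real) \<Rightarrow>
     ('a \<Rightarrow> real) \<Rightarrow> ('a \<Rightarrow> real) \<Rightarrow> bool" where
  "in_generator S P f g \<longleftrightarrow> uniform_limit S (\<lambda>t x. (P t f x - f x) / t) g (at_right 0)"

section \<open>Quaternions and the quaternionic Hopf fibration\<close>

text \<open>The quaternion \<open>a + bI + cJ + dK\<close> is the vector \<open>(a, b, c, d)\<close>.\<close>

type_synonym quat = "real^4"

definition quat_mult :: "quat \<Rightarrow> quat \<Rightarrow> quat" where
  "quat_mult p q = vector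
     [p$1 * q$1 - p$2 * q$2 - p$3 * q$3 - p$4 * q$4,
      p$1 * q$2 + p$2 * q$1 + p$3 * q$4 - p$4 * q$3,
      p$1 * q$3 - p$2 * q$4 + p$3 * q$1 + p$4 * q$2,
      p$1 * q$4 + p$2 * q$3 - p$3 * q$2 + p$4 * q$1]"

definition quat_one :: quat where "quat_one = axis 1 1"
definition quat_I :: quat where "quat_I = axis 2 1"
definition quat_J :: quat where "quat_J = axis 3 1"
definition quat_K :: quat where "quat_K = axis 4 1"

text \<open>The exponential of \<open>\<theta>S\<close> for an imaginary unit \<open>S\<close> (that is, \<open>S\<^sup>2 = -1\<close>).\<close>

definition quat_cis :: "quat \<Rightarrow> real \<Rightarrow> quat" where
  "quat_cis S \<theta> = cos \<theta> *\<^sub>R quat_one + sin \<theta> *\<^sub>R S"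

text \<open>
  With \<open>n = CARD('n)\<close>, the space \<open>quat^'n option\<close> is the \<open>(n + 1)\<close>-st power of the quaternions;
  the index \<open>None\<close> stands for the last coordinate.
\<close>

definition quat_act :: "quat \<Rightarrow> quat^'n::finite option \<Rightarrow> quat^'n option" where
  "quat_act g q = (\<chi> i. quat_mult g (q $ i))"

definition north :: "quat^'n::finite option" where
  "north = axis None quat_one"

definition fibre_deriv ::
  "quat \<Rightarrow> (quat^'n::finite option \<Rightarrow> real) \<Rightarrow> quat^'n option \<Rightarrow> real" where
  "fibre_deriv S f q = deriv (\<lambda>\<theta>. f (quat_act (quat_cis S \<theta>) q)) 0"

definition sub_laplacian ::
  "(quat^'n::finite option \<Rightarrow> real) \<Rightarrow> quat^'n option \<Rightarrow> real" where
  "sub_laplacian f q =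
     laplace_beltrami f q - (\<Sum>S\<in>{quat_I, quat_J, quat_K}. fibre_deriv S (fibre_deriv S f) q)"

text \<open>
  \<open>P t\<close> is the operator \<open>exp(tL)\<close> on \<open>C(\<S>)\<close>. The smooth functions are a core for the generator,
  so a semigroup whose generator extends the operator \<open>L\<close> on smooth functions is unique.
\<close>

definition subelliptic_semigroup ::
  "(real \<Rightarrow> (quat^'n::finite option \<Rightarrow> real) \<Rightarrow> quat^'n option \<Rightarrow> real) \<Rightarrow> bool" where
  "subelliptic_semigroup P \<longleftrightarrow>
     C0_semigroup_on (sphere 0 1) P \<and>
     (\<forall>f. smooth_on_sphere f \<longrightarrow> in_generator (sphere 0 1) P f (sub_laplacian f))"

text \<open>
  \<open>p t\<close> is the kernel of \<open>P t\<close> from \<open>x\<close> with respect to the Riemannian volume; continuity selects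
  the representative of the density.
\<close>

definition kernel_from ::
  "'a::euclidean_space \<Rightarrow> (real \<Rightarrow> ('a \<Rightarrow> real) \<Rightarrow> 'a \<Rightarrow> real) \<Rightarrow> (real \<Rightarrow> 'a \<Rightarrow> real) \<Rightarrow> bool" where
  "kernel_from x P p \<longleftrightarrow>
     (\<forall>t>0. continuous_on (sphere 0 1) (p t) \<and>
        (\<forall>f. continuous_on (sphere 0 1) f \<longrightarrow> P t f x = (LINT y|sphere_volume. p t y * f y)))"

section \<open>The Riemannian heat kernel\<close>

definition gegenbauer :: "real \<Rightarrow> nat \<Rightarrow> real \<Rightarrow> real" where
  "gegenbauer \<nu> m x =
     (\<Sum>k\<le>m div 2. (-1) ^ k * pochhammer \<nu> (m - k) / (fact k * fact (m - 2 * k))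
        * (2 * x) ^ (m - 2 * k))"

text \<open>
  At \<open>x = cos \<delta>\<close> this is the kernel of \<open>exp(t\<Delta>)\<close> on the unit sphere of dimension \<open>4n + 3\<close>, at
  distance \<open>\<delta>\<close> from the pole and with respect to the unnormalised volume; the series also defines
  it for \<open>x > 1\<close>.
\<close>

definition riemannian_heat_kernel :: "nat \<Rightarrow> real \<Rightarrow> real \<Rightarrow> real" where
  "riemannian_heat_kernel n t x =
     Gamma (real (2 * n + 1)) / (2 * pi ^ (2 * n + 2)) *
     (\<Sum>m. real (m + 2 * n + 1) * exp (- real (m * (m + 4 * n + 2)) * t)
        * gegenbauer (real (2 * n + 1)) m x)"

end

theory Submission
  imports Defs "HOL-Probability.Characteristic_Functions"
begin

text \<open>
  Polynomial functions on the sphere split into joint eigenspaces of the Laplace-Beltrami operator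
  (eigenvalue \<open>- m (m + 4 n + 2)\<close>) and of \<open>T\<^sub>1\<^sup>2 + T\<^sub>2\<^sup>2 + T\<^sub>3\<^sup>2\<close> (eigenvalue \<open>- k (k + 2)\<close>); the
  semigroup acts on them by the scalars \<open>exp (- (m (m + 4 n + 2) - k (k + 2)) t)\<close>. The zonal harmonic
  \<open>C\<^sub>m(x)\<close>, \<open>x = cos r cos \<eta>\<close>, is a sum of components \<open>a\<^sub>k(r) sin ((k + 1) \<eta>) / sin \<eta>\<close>, so by the
  reproducing property of \<open>C\<^sub>m\<close> the kernel \<open>p\<^sub>t\<close> is obtained from the series for \<open>q\<^sub>t\<close> by inserting
  \<open>exp (k (k + 2) t)\<close> in front of the \<open>k\<close>-th component; it is identified by testing against the
  translated zonal components, whose span is dense. Finally, \<open>sinh y C\<^sub>m(cos r cosh y)\<close> is the sum of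
  the \<open>a\<^sub>k(r) sinh ((k + 1) y)\<close>, and integrating this against
  \<open>sin (\<eta> y / 2t) exp (- (y\<^sup>2 - \<eta>\<^sup>2) / 4t)\<close> produces precisely these factors. The interchange of sum and
  integral uses \<open>m (m + 4 n + 2) - k (k + 2) \<ge> 4 n m\<close> for \<open>k \<le> m\<close>, where \<open>n \<ge> 1\<close> enters.
\<close>

section \<open>Directional derivatives of polynomial functions\<close>

text \<open>The hypotheses give only a strongly continuous semigroup whose generator is known on
  smooth functions, with no bound on \<open>P t\<close> uniform near \<open>t = 0\<close>; the
  uniform boundedness principle must supply one before an eigenfunction of
  \<open>sub_laplacian\<close> can be shown to evolve by a scalar. The sphere measure is an image of
  Lebesgue measure on the ball. For homogeneous polynomials, scaling relates sphere and ball
  integrals by an explicit factor, so integration by parts on the sphere comes from translation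
  invariance of the ambient space. The factors \<open>exp (k (k + 2) t)\<close> differ from one
  component of a zonal harmonic to the next, so a bound on the harmonic alone does not control the
  series. Each component is bounded separately, as a sine coefficient in \<open>\<eta>\<close>. The
  constants of the formula come from the Gaussian integral: apart from factors in
  \<open>\<eta>\<close> it yields \<open>sqrt (pi * t) * exp (t * (k + 1)^2)\<close> on the half
  line, and \<open>(k + 1)^2 = k (k + 2) + 1\<close> leaves the surplus \<open>exp t\<close> that
  the prefactor \<open>exp (- t)\<close> removes.\<close>

definition dird :: "'a::euclidean_space \<Rightarrow> ('a \<Rightarrow> real) \<Rightarrow> 'a \<Rightarrow> real" where
  "dird v f x = frechet_derivative f (at x) v"

definition lap :: "('a::euclidean_space \<Rightarrow> real) \<Rightarrow> 'a \<Rightarrow> real" where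
  "lap f x = (\<Sum>b\<in>Basis. dird b (dird b f) x)"

definition grad_inner :: "('a::euclidean_space \<Rightarrow> real) \<Rightarrow> ('a \<Rightarrow> real) \<Rightarrow> 'a \<Rightarrow> real" where
  "grad_inner f g x = (\<Sum>b\<in>Basis. dird b f x * dird b g x)"

definition homog :: "nat \<Rightarrow> ('a::real_vector \<Rightarrow> real) \<Rightarrow> bool" where
  "homog p f \<longleftrightarrow> (\<forall>c x. f (c *\<^sub>R x) = c ^ p * f x)"

abbreviation "rpoly \<equiv> real_polynomial_function"

lemmas rpoly_linear = real_polynomial_function.intros(1)

lemma rpoly_const [intro, simp]: "rpoly (\<lambda>x. c)"
  by (rule real_polynomial_function.intros)

lemma rpoly_mult [intro]: "rpoly f \<Longrightarrow> rpoly g \<Longrightarrow> rpoly (\<lambda>x. f x * g x)"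
  by (rule real_polynomial_function.intros)

lemma rpoly_add [intro]: "rpoly f \<Longrightarrow> rpoly g \<Longrightarrow> rpoly (\<lambda>x. f x + g x)"
  by (rule real_polynomial_function.intros)

lemma dird_eqI: "(f has_derivative f') (at x) \<Longrightarrow> dird v f x = f' v"
  using frechet_derivative_at[of f f' x] unfolding dird_def by simp

lemma rpoly_differentiable: "rpoly f \<Longrightarrow> f differentiable (at x)"
proof (induction rule: real_polynomial_function.induct)
  case (linear f)
  then show ?case by (meson bounded_linear_imp_has_derivative differentiableI)
qed auto

lemma rpoly_has_derivative: "rpoly f \<Longrightarrow> (f has_derivative (\<lambda>v. dird v f x)) (at x)"
  using rpoly_differentiable frechet_derivative_works[of f "at x"] unfolding dird_def by blast

lemma rpoly_continuous: "rpoly f \<Longrightarrow> continuous_on S f"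
  using rpoly_differentiable differentiable_imp_continuous_within
  by (meson continuous_at_imp_continuous_on)

lemma dird_const [simp]: "dird v (\<lambda>x. c) = (\<lambda>x. 0)"
  by (rule ext, rule trans[OF dird_eqI]) (auto intro!: derivative_eq_intros)

lemma dird_linear: "bounded_linear f \<Longrightarrow> dird v f = (\<lambda>x. f v)"
  by (rule ext, rule dird_eqI, rule bounded_linear_imp_has_derivative)

lemma dird_inner_left [simp]: "dird v (\<lambda>x. a \<bullet> x) = (\<lambda>x. a \<bullet> v)"
  by (rule dird_linear) (rule bounded_linear_inner_right)

lemma dird_add: "rpoly f \<Longrightarrow> rpoly g \<Longrightarrow> dird v (\<lambda>x. f x + g x) = (\<lambda>x. dird v f x + dird v g x)"
  by (rule ext, rule dird_eqI) (intro has_derivative_add rpoly_has_derivative)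

lemma dird_diff: "rpoly f \<Longrightarrow> rpoly g \<Longrightarrow> dird v (\<lambda>x. f x - g x) = (\<lambda>x. dird v f x - dird v g x)"
  by (rule ext, rule dird_eqI) (intro has_derivative_diff rpoly_has_derivative)

lemma dird_mult:
  "rpoly f \<Longrightarrow> rpoly g \<Longrightarrow> dird v (\<lambda>x. f x * g x) = (\<lambda>x. f x * dird v g x + dird v f x * g x)"
  by (rule ext, rule dird_eqI) (intro has_derivative_mult rpoly_has_derivative)

lemma dird_cmult: "rpoly f \<Longrightarrow> dird v (\<lambda>x. c * f x) = (\<lambda>x. c * dird v f x)"
  using dird_mult[of "\<lambda>x. c" f] by (auto intro: rpoly_const)

lemma rpoly_dird: "rpoly f \<Longrightarrow> rpoly (dird v f)"
proof (induction rule: real_polynomial_function.induct)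
  case (linear f)
  then show ?case by (simp add: dird_linear rpoly_const)
qed (simp_all add: dird_add dird_mult real_polynomial_function.intros)

lemma dird_sum:
  assumes "finite I" "\<And>i. i \<in> I \<Longrightarrow> rpoly (f i)"
  shows "dird v (\<lambda>x. \<Sum>i\<in>I. f i x) = (\<lambda>x. \<Sum>i\<in>I. dird v (f i) x)"
  by (rule ext, rule dird_eqI) (intro has_derivative_sum rpoly_has_derivative assms(2))

lemma dird_scaled_sum:
  assumes "rpoly f" shows "dird (\<Sum>i\<in>I. c i *\<^sub>R w i) f x = (\<Sum>i\<in>I. c i * dird (w i) f x)"
proof -
  interpret bounded_linear "\<lambda>v. dird v f x"
    using rpoly_has_derivative[OF assms] has_derivative_bounded_linear by blast
  show ?thesis by (simp add: sum scaleR)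
qed

lemma dird_scaleR: "rpoly f \<Longrightarrow> dird (c *\<^sub>R v) f x = c * dird v f x"
  using dird_scaled_sum[of f "\<lambda>_. c" "\<lambda>_. v" "{()}" x] by simp

lemma dird_euclidean: "rpoly f \<Longrightarrow> dird v f x = (\<Sum>b\<in>Basis. (v \<bullet> b) * dird b f x)"
  using dird_scaled_sum[of f "\<lambda>b. v \<bullet> b" "\<lambda>b. b" Basis x] by (simp add: euclidean_representation)

lemma rpoly_compose_derivative:
  assumes "rpoly f" "(g has_vector_derivative v) (at s)"
  shows "((\<lambda>s. f (g s)) has_real_derivative dird v f (g s)) (at s)"
  using has_derivative_compose[OF assms(2)[unfolded has_vector_derivative_def] rpoly_has_derivative[OF assms(1)]]
  by (simp add: has_field_derivative_def dird_scaleR[OF assms(1)] mult_commute_abs)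

lemma rpoly_line_derivative:
  "rpoly f \<Longrightarrow> ((\<lambda>s. f (x + s *\<^sub>R v)) has_real_derivative dird v f (x + s *\<^sub>R v)) (at s)"
  by (rule rpoly_compose_derivative) (auto intro!: derivative_eq_intros simp: has_vector_derivative_def)

lemma dird_commute: "rpoly f \<Longrightarrow> dird v (dird w f) = dird w (dird v f)"
proof (induction rule: real_polynomial_function.induct)
  case (linear f)
  then show ?case by (simp add: dird_linear)
next
  case (mult f g)
  then show ?case by (simp add: dird_add dird_mult rpoly_dird rpoly_mult)
     (auto simp: fun_eq_iff algebra_simps)
qed (simp_all add: dird_add rpoly_dird)

lemma rpoly_inner_left [intro, simp]: "rpoly (\<lambda>x. a \<bullet> x)"
  by (rule rpoly_linear) (rule bounded_linear_inner_right)

lemma rpoly_inner_right [intro, simp]: "rpoly (\<lambda>x. x \<bullet> a)"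
  by (rule rpoly_linear) (rule bounded_linear_inner_left)

lemma rpoly_cmult [intro]: "rpoly f \<Longrightarrow> rpoly (\<lambda>x. c * f x)"
  by (intro rpoly_mult rpoly_const)

lemma rpoly_sum [intro]: "finite I \<Longrightarrow> (\<And>i. i \<in> I \<Longrightarrow> rpoly (f i)) \<Longrightarrow> rpoly (\<lambda>x. \<Sum>i\<in>I. f i x)"
  by (rule real_polynomial_function_sum)

lemma lap_dird: assumes "rpoly f" shows "lap (dird v f) = dird v (lap f)"
proof -
  have "dird v (lap f) = (\<lambda>x. \<Sum>b\<in>Basis. dird v (dird b (dird b f)) x)"
    unfolding lap_def[abs_def] by (rule dird_sum) (auto intro!: rpoly_dird assms)
  also have "\<dots> = lap (dird v f)"
  proof -
    have "dird v (dird b (dird b f)) = dird b (dird b (dird v f))" for b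
      unfolding dird_commute[OF rpoly_dird[OF assms, of b], of v b] dird_commute[OF assms, of v b] ..
    then show ?thesis unfolding lap_def[abs_def] by simp
  qed
  finally show ?thesis ..
qed

lemma lap_add: "rpoly f \<Longrightarrow> rpoly g \<Longrightarrow> lap (\<lambda>x. f x + g x) = (\<lambda>x. lap f x + lap g x)"
  unfolding lap_def[abs_def] by (simp add: dird_add rpoly_dird sum.distrib)

lemma lap_diff: "rpoly f \<Longrightarrow> rpoly g \<Longrightarrow> lap (\<lambda>x. f x - g x) = (\<lambda>x. lap f x - lap g x)"
  unfolding lap_def[abs_def] by (simp add: dird_diff rpoly_dird sum_subtractf)

lemma lap_const [simp]: "lap (\<lambda>x. c) = (\<lambda>x. 0)"
  unfolding lap_def[abs_def] by simp

lemma lap_inner_left [simp]: "lap (\<lambda>x. a \<bullet> x) = (\<lambda>x. 0)"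
  unfolding lap_def[abs_def] by simp

lemma lap_cmult: "rpoly f \<Longrightarrow> lap (\<lambda>x. c * f x) = (\<lambda>x. c * lap f x)"
  unfolding lap_def[abs_def] by (simp add: dird_cmult rpoly_dird sum_distrib_left)

lemma lap_sum:
  assumes "finite I" "\<And>i. i \<in> I \<Longrightarrow> rpoly (f i)"
  shows "lap (\<lambda>x. \<Sum>i\<in>I. f i x) = (\<lambda>x. \<Sum>i\<in>I. lap (f i) x)"
  using assms by (induction I rule: finite_induct) (simp_all add: lap_add rpoly_sum)

lemma lap_mult:
  "rpoly f \<Longrightarrow> rpoly g \<Longrightarrow>
    lap (\<lambda>x. f x * g x) = (\<lambda>x. f x * lap g x + lap f x * g x + 2 * grad_inner f g x)"
  unfolding lap_def[abs_def] grad_inner_def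
  by (rule ext)
    (simp add: dird_mult dird_add rpoly_dird rpoly_mult
      sum_distrib_left sum_distrib_right sum.distrib[symmetric] algebra_simps)

lemma grad_inner_commute: "grad_inner f g = grad_inner g f"
  unfolding grad_inner_def[abs_def] by (simp add: mult.commute)

lemma grad_inner_add: "rpoly f \<Longrightarrow> rpoly g \<Longrightarrow>
    grad_inner u (\<lambda>x. f x + g x) = (\<lambda>x. grad_inner u f x + grad_inner u g x)"
  unfolding grad_inner_def[abs_def] by (simp add: dird_add distrib_left sum.distrib)

lemma grad_inner_diff: "rpoly f \<Longrightarrow> rpoly g \<Longrightarrow>
    grad_inner u (\<lambda>x. f x - g x) = (\<lambda>x. grad_inner u f x - grad_inner u g x)"
  unfolding grad_inner_def[abs_def] by (simp add: dird_diff right_diff_distrib sum_subtractf)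

lemma grad_inner_const [simp]: "grad_inner u (\<lambda>x. c) = (\<lambda>x. 0)"
  unfolding grad_inner_def[abs_def] by simp

lemma grad_inner_cmult: "rpoly f \<Longrightarrow>
    grad_inner u (\<lambda>x. c * f x) = (\<lambda>x. c * grad_inner u f x)"
  unfolding grad_inner_def[abs_def] by (simp add: dird_cmult sum_distrib_left mult_ac)

lemma grad_inner_mult: "rpoly f \<Longrightarrow> rpoly g \<Longrightarrow>
    grad_inner u (\<lambda>x. f x * g x) = (\<lambda>x. f x * grad_inner u g x + grad_inner u f x * g x)"
  unfolding grad_inner_def[abs_def]
  by (rule ext)
    (simp add: dird_mult sum_distrib_left sum_distrib_right sum.distrib[symmetric] algebra_simps)

lemma homogD: "homog p f \<Longrightarrow> f (c *\<^sub>R x) = c ^ p * f x"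
  by (simp add: homog_def)

lemma homog_mult: "homog p f \<Longrightarrow> homog q g \<Longrightarrow> homog (p + q) (\<lambda>x. f x * g x)"
  by (simp add: homog_def power_add)

lemma homog_diff: "homog p f \<Longrightarrow> homog p g \<Longrightarrow> homog p (\<lambda>x. f x - g x)"
  by (simp add: homog_def right_diff_distrib)

lemma homog_cmult: "homog p f \<Longrightarrow> homog p (\<lambda>x. c * f x)"
  by (simp add: homog_def)

lemma homog_sum: "(\<And>i. i \<in> I \<Longrightarrow> homog p (f i)) \<Longrightarrow> homog p (\<lambda>x. \<Sum>i\<in>I. f i x)"
  by (simp add: homog_def sum_distrib_left)

lemma homog_inner_left [simp]: "homog 1 (\<lambda>x. a \<bullet> x)" "homog (Suc 0) (\<lambda>x. a \<bullet> x)"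
  by (simp_all add: homog_def)

lemma homog_power: "homog p f \<Longrightarrow> homog (p * n) (\<lambda>x. f x ^ n)"
  by (simp add: homog_def power_mult_distrib power_mult)

lemma homog_const: "homog 0 (\<lambda>x. c)"
  by (simp add: homog_def)

lemma rpoly_norm2 [intro, simp]: "rpoly (\<lambda>x::'a::euclidean_space. x \<bullet> x)"
  by (subst euclidean_inner) (intro rpoly_sum rpoly_mult rpoly_inner_right; simp)

lemma homog_norm2: "homog 2 (\<lambda>x::'a::euclidean_space. x \<bullet> x)"
  by (simp add: homog_def power2_eq_square)

lemma homog_0_const: "homog 0 f \<Longrightarrow> f x = f 0"
  using homogD[of 0 f 0 x] by simp

lemma homog_dird:
  assumes "rpoly f" "homog (Suc p) f"
  shows "homog p (dird v f)"
  unfolding homog_def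
proof (intro allI)
  fix c x
  have nz: "dird v f (c *\<^sub>R x) = c ^ p * dird v f x" if c: "c \<noteq> 0" for c
  proof -
    have "((\<lambda>s. f (c *\<^sub>R x + s *\<^sub>R (c *\<^sub>R v))) has_real_derivative dird (c *\<^sub>R v) f (c *\<^sub>R x + 0 *\<^sub>R (c *\<^sub>R v))) (at 0)"
      by (rule rpoly_line_derivative[OF assms(1)])
    moreover have "(\<lambda>s. f (c *\<^sub>R x + s *\<^sub>R (c *\<^sub>R v))) = (\<lambda>s. c ^ Suc p * f (x + s *\<^sub>R v))"
      using homogD[OF assms(2), of c "x + _ *\<^sub>R v"] by (simp add: scaleR_right_distrib mult.commute)
    moreover have "((\<lambda>s. c ^ Suc p * f (x + s *\<^sub>R v)) has_real_derivative c ^ Suc p * dird v f (x + 0 *\<^sub>R v)) (at 0)"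
      by (intro DERIV_cmult rpoly_line_derivative assms(1))
    ultimately have "dird (c *\<^sub>R v) f (c *\<^sub>R x + 0 *\<^sub>R (c *\<^sub>R v)) = c ^ Suc p * dird v f (x + 0 *\<^sub>R v)"
      by (metis DERIV_unique)
    then show ?thesis using c by (simp add: dird_scaleR[OF assms(1)])
  qed
  show "dird v f (c *\<^sub>R x) = c ^ p * dird v f x"
  proof (cases "c = 0")
    \<comment> \<open>At \<open>c = 0\<close> the chain rule gives no information. Both sides are
      continuous in \<open>c\<close>, so the identity passes to the limit from
      \<open>c \<noteq> 0\<close>; this also covers \<open>0 ^ 0\<close>.\<close>
    case True
    let ?h = "\<lambda>c. dird v f (c *\<^sub>R x) - c ^ p * dird v f x"
    have "continuous_on UNIV ?h"
      by (intro continuous_intros continuous_on_compose2[OF rpoly_continuous[OF rpoly_dird[OF assms(1)], of UNIV]]) auto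
    then have "isCont ?h 0" by (simp add: continuous_on_eq_continuous_at)
    then have "(?h \<longlongrightarrow> ?h 0) (at 0)" by (simp only: isCont_def)
    moreover have "(?h \<longlongrightarrow> 0) (at 0)"
      by (rule Lim_transform_eventually[OF tendsto_const]) (simp add: eventually_at_filter nz)
    ultimately have "?h 0 = 0" by (rule LIM_unique)
    then show ?thesis using True by simp
  qed (rule nz)
qed

lemma dird_homog_0:
  assumes "homog 0 f" shows "dird v f = (\<lambda>x. 0)"
proof -
  have "f = (\<lambda>x. f 0)" using homog_0_const[OF assms] by blast
  then show ?thesis by (metis dird_const)
qed

lemma euler_homog:
  assumes "rpoly f" "homog p f"
  shows "dird x f x = real p * f x"
proof -
  have "((\<lambda>s. f (0 + s *\<^sub>R x)) has_real_derivative dird x f (0 + 1 *\<^sub>R x)) (at 1)"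
    by (rule rpoly_line_derivative[OF assms(1)])
  moreover have "((\<lambda>s. f (0 + s *\<^sub>R x)) has_real_derivative real p * f x) (at 1)"
    unfolding add_0_left homogD[OF assms(2)] by (auto intro!: derivative_eq_intros)
  ultimately show ?thesis using DERIV_unique by fastforce
qed


section \<open>Integration over the unit sphere\<close>

lemma sgn_measurable_sphere:
  "sgn \<in> restrict_space lborel (cball 0 1 - {0}) \<rightarrow>\<^sub>M restrict_space borel (sphere (0::'a::euclidean_space) 1)"
  by (rule measurable_restrict_space3) (auto simp: norm_sgn)

lemma scale_measure_eq_density: "scale_measure c M = density M (\<lambda>_. c)"
  by (rule measure_eqI) (auto simp: emeasure_density_const)

lemma sphere_volume_eq:
  "(sphere_volume :: 'a::euclidean_space measure) =
     density (distr (restrict_space lborel (cball 0 1 - {0})) (restrict_space borel (sphere 0 1)) sgn)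
       (\<lambda>_. ennreal (real DIM('a)))"
  unfolding sphere_volume_def scale_measure_eq_density ..

lemma sets_sphere_volume: "sets sphere_volume = sets (restrict_space borel (sphere (0::'a::euclidean_space) 1))"
  and space_sphere_volume: "space sphere_volume = sphere (0::'a::euclidean_space) 1"
  unfolding sphere_volume_eq by (auto simp: space_restrict_space)

lemma finite_measure_sphere_volume: "finite_measure (sphere_volume :: 'a::euclidean_space measure)"
proof
  let ?A = "cball 0 1 - {0} :: 'a set"
  have "emeasure (sphere_volume :: 'a measure) (space sphere_volume) = ennreal (real DIM('a)) *
     emeasure (distr (restrict_space lborel ?A) (restrict_space borel (sphere 0 1)) sgn) (sphere 0 1)"
    unfolding space_sphere_volume by (simp add: sphere_volume_def)
  also have "emeasure (distr (restrict_space lborel ?A) (restrict_space borel (sphere 0 1)) sgn) (sphere 0 1) =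
     emeasure (restrict_space lborel ?A) (sgn -` sphere 0 1 \<inter> space (restrict_space lborel ?A))"
    by (rule emeasure_distr[OF sgn_measurable_sphere]) (auto simp: sets_restrict_space)
  also have "sgn -` sphere 0 1 \<inter> space (restrict_space lborel ?A) = ?A"
    by (auto simp: space_restrict_space norm_sgn)
  also have "emeasure (restrict_space lborel ?A) ?A = emeasure lborel ?A"
    by (rule emeasure_restrict_space) auto
  finally have eq: "emeasure (sphere_volume :: 'a measure) (space sphere_volume) =
    ennreal (real DIM('a)) * emeasure lborel ?A" .
  have "emeasure lborel ?A < top"
    using emeasure_mono[of ?A "cball 0 1" lborel] emeasure_lborel_cball_finite[of "0::'a" 1] by auto
  then show "emeasure (sphere_volume :: 'a measure) (space sphere_volume) \<noteq> \<infinity>"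
    unfolding eq by (simp add: ennreal_mult_eq_top_iff less_top)
qed

lemma sphere_measurable:
  fixes f :: "'a::euclidean_space \<Rightarrow> real"
  assumes "continuous_on (sphere 0 1) f"
  shows "f \<in> borel_measurable sphere_volume"
  using borel_measurable_continuous_on_restrict[OF assms]
    measurable_cong_sets[OF sets_sphere_volume refl, of borel] by blast

lemma sphere_bounded:
  fixes f :: "'a::euclidean_space \<Rightarrow> real"
  assumes "continuous_on (sphere 0 1) f"
  obtains B where "B > 0" "\<And>x. x \<in> sphere 0 1 \<Longrightarrow> \<bar>f x\<bar> \<le> B"
proof -
  have "bounded (f ` sphere 0 1)"
    by (intro compact_imp_bounded compact_continuous_image assms compact_sphere)
  then show ?thesis using that unfolding bounded_pos by auto
qed

lemma sphere_integrable:
  fixes f :: "'a::euclidean_space \<Rightarrow> real"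
  assumes "continuous_on (sphere 0 1) f"
  shows "integrable sphere_volume f"
proof -
  interpret finite_measure "sphere_volume :: 'a measure" by (rule finite_measure_sphere_volume)
  obtain B where B: "B > 0" "\<And>x. x \<in> sphere 0 1 \<Longrightarrow> \<bar>f x\<bar> \<le> B" using sphere_bounded[OF assms] by blast
  show ?thesis
    by (rule integrable_const_bound[of _ B]) (use B sphere_measurable[OF assms] in \<open>auto simp: space_sphere_volume\<close>)
qed

lemma sphere_integral_eq:
  fixes f :: "'a::euclidean_space \<Rightarrow> real"
  assumes "continuous_on (sphere 0 1) f"
  shows "integral\<^sup>L sphere_volume f = real DIM('a) * (LINT x:cball 0 1 - {0}|lborel. f (sgn x))"
    and "set_integrable lborel (cball 0 1 - {0}) (\<lambda>x. f (sgn x))"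
proof -
  let ?A = "cball 0 1 - {0} :: 'a set" and ?S = "restrict_space borel (sphere (0::'a) 1)"
  have f: "f \<in> borel_measurable ?S" by (rule borel_measurable_continuous_on_restrict[OF assms])
  have A: "?A \<inter> space lborel \<in> sets lborel" by auto
  let ?D = "distr (restrict_space lborel ?A) ?S sgn"
  have f': "f \<in> borel_measurable ?D" using f by simp
  have "integral\<^sup>L sphere_volume f = (LINT x|?D. real DIM('a) *\<^sub>R f x)"
    unfolding sphere_volume_eq by (rule integral_density) (use f' in auto)
  also have "\<dots> = real DIM('a) * (LINT x|?D. f x)" by simp
  also have "(LINT x|?D. f x) = (LINT x|restrict_space lborel ?A. f (sgn x))"
    by (rule integral_distr[OF sgn_measurable_sphere f])
  also have "\<dots> = (LINT x:?A|lborel. f (sgn x))"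
    unfolding set_lebesgue_integral_def by (rule integral_restrict_space[OF A])
  finally show "integral\<^sup>L sphere_volume f = real DIM('a) * (LINT x:?A|lborel. f (sgn x))" .
  have "integrable (density ?D (\<lambda>_. ennreal (real DIM('a)))) f"
    using sphere_integrable[OF assms] unfolding sphere_volume_eq .
  then have "integrable ?D (\<lambda>x. real DIM('a) *\<^sub>R f x)"
    by (subst (asm) integrable_density) (use f' in auto)
  then have "integrable ?D f" by simp
  then have "integrable (restrict_space lborel ?A) (\<lambda>x. f (sgn x))"
    by (rule integrable_distr[OF sgn_measurable_sphere])
  then show "set_integrable lborel ?A (\<lambda>x. f (sgn x))"
    unfolding set_integrable_def by (subst (asm) integrable_restrict_space[OF A])
qed

lemma lborel_integral_affine:
  fixes f :: "'a::euclidean_space \<Rightarrow> real"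
  assumes "c \<noteq> 0" "f \<in> borel_measurable borel"
  shows "(LINT x|lborel. f x) = \<bar>c\<bar> ^ DIM('a) * (LINT x|lborel. f (t + c *\<^sub>R x))"
proof -
  have T: "(\<lambda>x. t + c *\<^sub>R x) \<in> lborel \<rightarrow>\<^sub>M (borel::'a measure)" by measurable
  have "(LINT x|lborel. f x) = (LINT x|density (distr lborel borel (\<lambda>x. t + c *\<^sub>R x)) (\<lambda>_. \<bar>c\<bar>^DIM('a)). f x)"
    using lborel_affine[OF assms(1), of t] by simp
  also have "\<dots> = (LINT x|distr lborel borel (\<lambda>x. t + c *\<^sub>R x). \<bar>c\<bar>^DIM('a) *\<^sub>R f x)"
    by (rule integral_density) (use assms in auto)
  also have "\<dots> = \<bar>c\<bar> ^ DIM('a) * (LINT x|distr lborel borel (\<lambda>x. t + c *\<^sub>R x). f x)" by simp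
  also have "(LINT x|distr lborel borel (\<lambda>x. t + c *\<^sub>R x). f x) = (LINT x|lborel. f (t + c *\<^sub>R x))"
    by (rule integral_distr[OF T assms(2)])
  finally show ?thesis .
qed

lemma one_minus_power_quotient:
  "((\<lambda>s::real. (1 - s ^ k) / (1 - s)) \<longlongrightarrow> real k) (at_left 1)"
proof -
  have "((\<lambda>s::real. s ^ k) has_field_derivative real k) (at 1)"
    by (auto intro!: derivative_eq_intros)
  then have "((\<lambda>s::real. (s ^ k - 1) / (s - 1)) \<longlongrightarrow> real k) (at 1)"
    by (simp add: has_field_derivative_iff)
  moreover have "(s ^ k - 1) / (s - 1) = (1 - s ^ k) / (1 - s)" for s :: real
    using minus_divide_divide[of "1 - s ^ k" "1 - s"] by simp
  ultimately show ?thesis by (simp add: filterlim_at_split)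
qed

text \<open>Comparing the two integrands on the thin shell \<open>s < \<parallel>x\<parallel> \<le> 1\<close> as \<open>s \<rightarrow> 1\<close> replaces
  integration in polar coordinates.\<close>

lemma radial_integral:
  fixes f :: "'a::euclidean_space \<Rightarrow> real"
  assumes "continuous_on (sphere 0 1) f"
  shows "real (p + DIM('a)) * (LINT x:cball 0 1 - {0}|lborel. norm x ^ p * f (sgn x)) =
     real DIM('a) * (LINT x:cball 0 1 - {0}|lborel. f (sgn x))"
proof -
  let ?A = "cball 0 1 - {0} :: 'a set" and ?d = "DIM('a)"
  let ?As = "\<lambda>s. cball 0 s - {0} :: 'a set"
  define I where "I q = (LINT x:?A|lborel. norm x ^ q * f (sgn x))" for q :: nat
  obtain B where B: "B > 0" "\<And>x. x \<in> sphere 0 1 \<Longrightarrow> \<bar>f x\<bar> \<le> B" using sphere_bounded[OF assms] by blast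
  have B': "\<bar>f (sgn x)\<bar> \<le> B" if "x \<noteq> 0" for x using that by (intro B(2)) (simp add: norm_sgn)
  have int: "set_integrable lborel ?A (\<lambda>x. norm x ^ q * f (sgn x))" for q
    unfolding set_integrable_def
  proof (rule Bochner_Integration.integrable_bound)
    show "integrable lborel (\<lambda>x. indicator ?A x *\<^sub>R f (sgn x))"
      using sphere_integral_eq(2)[OF assms] unfolding set_integrable_def .
    then have "(\<lambda>x. indicator ?A x *\<^sub>R f (sgn x)) \<in> borel_measurable lborel" by auto
    then have "(\<lambda>x. norm x ^ q * (indicator ?A x *\<^sub>R f (sgn x))) \<in> borel_measurable lborel" by auto
    then show "(\<lambda>x. indicator ?A x *\<^sub>R (norm x ^ q * f (sgn x))) \<in> borel_measurable lborel"
      by (simp add: mult_ac)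
    show "AE x in lborel. norm (indicator ?A x *\<^sub>R (norm x ^ q * f (sgn x))) \<le> norm (indicator ?A x *\<^sub>R f (sgn x))"
      by (auto simp: indicator_def abs_mult power_le_one mult_left_le_one_le)
  qed
  have ints: "set_integrable lborel (?As s) (\<lambda>x. norm x ^ q * f (sgn x))" if "s \<le> 1" for q s
    by (rule set_integrable_subset[OF int]) (use that in auto)
  \<comment> \<open>Dilation by \<open>s\<close> leaves \<open>sgn\<close> unchanged; the weight
    contributes \<open>s ^ q\<close> and Lebesgue measure \<open>s ^ DIM('a)\<close>.\<close>
  have scale: "(LINT x:?As s|lborel. norm x ^ q * f (sgn x)) = s ^ (q + ?d) * I q" if s: "0 < s" "s \<le> 1" for s q
  proof -
    have "(\<lambda>x. indicator (?As s) x *\<^sub>R (norm x ^ q * f (sgn x))) \<in> borel_measurable borel"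
      using ints[OF s(2), of q] unfolding set_integrable_def by auto
    from lborel_integral_affine[OF _ this, of s 0]
    have "(LINT x:?As s|lborel. norm x ^ q * f (sgn x)) =
       s ^ ?d * (LINT x|lborel. indicator (?As s) (s *\<^sub>R x) *\<^sub>R (norm (s *\<^sub>R x) ^ q * f (sgn (s *\<^sub>R x))))"
      using s unfolding set_lebesgue_integral_def by simp
    also have "(\<lambda>x. indicator (?As s) (s *\<^sub>R x) *\<^sub>R (norm (s *\<^sub>R x) ^ q * f (sgn (s *\<^sub>R x)))) =
      (\<lambda>x. s ^ q * (indicator ?A x *\<^sub>R (norm x ^ q * f (sgn x))))"
      using s by (auto simp: fun_eq_iff indicator_def sgn_scaleR power_mult_distrib)
    finally show ?thesis unfolding I_def set_lebesgue_integral_def by (simp add: power_add)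
  qed
  \<comment> \<open>On the shell \<open>norm x ^ p\<close> differs from 1 by at most
    \<open>1 - s ^ p\<close>, and the volume of the shell is proportional to
    \<open>1 - s ^ DIM('a)\<close>. The product of the two small factors still tends to 0 after
    division by \<open>1 - s\<close>.\<close>
  have key: "\<bar>(1 - s ^ (p + ?d)) * I p - (1 - s ^ ?d) * I 0\<bar> \<le>
      (1 - s ^ p) * ((1 - s ^ ?d) * (B * measure lborel ?A))" if s: "0 < s" "s < 1" for s
  proof -
    let ?R = "?A - ?As s"
    have diff: "(LINT x:?R|lborel. norm x ^ q * f (sgn x)) = (1 - s ^ (q + ?d)) * I q" for q
    proof -
      have "?A = ?R \<union> ?As s" using s by auto
      then have "I q = (LINT x:?R \<union> ?As s|lborel. norm x ^ q * f (sgn x))" unfolding I_def by simp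
      also have "\<dots> = (LINT x:?R|lborel. norm x ^ q * f (sgn x)) + (LINT x:?As s|lborel. norm x ^ q * f (sgn x))"
        by (rule set_integral_Un) (use ints s in \<open>auto intro: set_integrable_subset[OF int]\<close>)
      finally show ?thesis using scale s by (simp add: algebra_simps)
    qed
    have mono: "measure lborel ?R = (1 - s ^ ?d) * measure lborel ?A"
    proof -
      have cb: "measure lborel (cball (0::'a) u - {0}) = u ^ ?d * unit_ball_vol ?d" if "u \<ge> 0" for u
      proof -
        have "emeasure lborel (cball (0::'a) u - {0}) = emeasure lborel (cball (0::'a) u)"
          by (subst emeasure_Diff) (use that in auto)
        then show ?thesis using content_cball[OF that, of "0::'a"]
          by (simp add: measure_def mult.commute)
      qed
      have "emeasure lborel ?A \<noteq> \<infinity>"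
        using emeasure_mono[of ?A "cball 0 1" lborel] emeasure_lborel_cball_finite[of "0::'a" 1]
        by (auto simp: less_top top_unique)
      then have "measure lborel ?R = measure lborel ?A - measure lborel (?As s)"
        by (intro measure_Diff) (use s in auto)
      then show ?thesis using cb[of 1] cb[of s] s by (simp add: algebra_simps)
    qed
    have fin: "emeasure lborel ?R < \<infinity>"
      using emeasure_mono[of ?R "cball 0 1" lborel] emeasure_lborel_cball_finite[of "0::'a" 1]
      by (auto intro: le_less_trans)
    have sub: "set_integrable lborel ?R (\<lambda>x. norm x ^ q * f (sgn x))" for q
      by (rule set_integrable_subset[OF int]) auto
    have cst: "set_integrable lborel ?R (\<lambda>x. (1 - s ^ p) * B)"
      unfolding set_integrable_def using fin by (intro integrable_real_indicator integrable_scaleR_left) auto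
    have "(1 - s ^ (p + ?d)) * I p - (1 - s ^ ?d) * I 0 =
      (LINT x:?R|lborel. norm x ^ p * f (sgn x) - norm x ^ 0 * f (sgn x))"
      by (simp only: set_integral_diff(2)[OF sub[of p] sub[of 0]] diff add_0_left)
    also have "\<bar>\<dots>\<bar> \<le> (LINT x:?R|lborel. \<bar>norm x ^ p * f (sgn x) - norm x ^ 0 * f (sgn x)\<bar>)"
      using set_integral_norm_bound[OF set_integral_diff(1)[OF sub[of p] sub[of 0]]] by simp
    also have "\<dots> \<le> (LINT x:?R|lborel. (1 - s ^ p) * B)"
    proof (rule set_integral_mono)
      show "set_integrable lborel ?R (\<lambda>x. \<bar>norm x ^ p * f (sgn x) - norm x ^ 0 * f (sgn x)\<bar>)"
        by (rule set_integrable_abs) (rule set_integral_diff(1)[OF sub sub])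
      fix x assume x: "x \<in> ?R"
      have 1: "s ^ p \<le> norm x ^ p" "norm x ^ p \<le> 1" using x s by (auto intro!: power_mono power_le_one)
      have "\<bar>norm x ^ p * f (sgn x) - norm x ^ 0 * f (sgn x)\<bar> = (1 - norm x ^ p) * \<bar>f (sgn x)\<bar>"
      proof -
        have "norm x ^ p * f (sgn x) - norm x ^ 0 * f (sgn x) = - ((1 - norm x ^ p) * f (sgn x))"
          by (simp add: algebra_simps)
        then show ?thesis using 1 by (simp only: abs_minus_cancel abs_mult abs_of_nonneg diff_ge_0_iff_ge)
      qed
      also have "\<dots> \<le> (1 - s ^ p) * B" using 1 B' x by (intro mult_mono) auto
      finally show "\<bar>norm x ^ p * f (sgn x) - norm x ^ 0 * f (sgn x)\<bar> \<le> (1 - s ^ p) * B" .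
    qed (rule cst)
    also have "\<dots> = (1 - s ^ p) * B * measure lborel ?R"
      unfolding set_lebesgue_integral_def using fin by simp
    finally show ?thesis using mono by (simp add: mult_ac)
  qed
  have lim: "((\<lambda>s. (1 - s ^ (p + ?d)) / (1 - s) * I p - (1 - s ^ ?d) / (1 - s) * I 0)
      \<longlongrightarrow> real (p + ?d) * I p - real ?d * I 0) (at_left 1)"
    by (intro tendsto_intros one_minus_power_quotient)
  have lim0: "((\<lambda>s. (1 - s ^ p) * ((1 - s ^ ?d) / (1 - s) * (B * measure lborel ?A))) \<longlongrightarrow>
      (1 - 1 ^ p) * (real ?d * (B * measure lborel ?A))) (at_left (1::real))"
    by (intro tendsto_intros one_minus_power_quotient)
  have "((\<lambda>s. (1 - s ^ (p + ?d)) / (1 - s) * I p - (1 - s ^ ?d) / (1 - s) * I 0) \<longlongrightarrow> 0) (at_left 1)"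
  proof (rule Lim_null_comparison)
    show "((\<lambda>s. (1 - s ^ p) * ((1 - s ^ ?d) / (1 - s) * (B * measure lborel ?A))) \<longlongrightarrow> 0) (at_left (1::real))"
      using lim0 by simp
    have "\<forall>\<^sub>F s in at_left (1::real). s \<in> {0<..<1}" by (rule eventually_at_leftI[of 0]) auto
    then show "\<forall>\<^sub>F s in at_left 1. norm ((1 - s ^ (p + ?d)) / (1 - s) * I p - (1 - s ^ ?d) / (1 - s) * I 0)
        \<le> (1 - s ^ p) * ((1 - s ^ ?d) / (1 - s) * (B * measure lborel ?A))"
    proof (rule eventually_mono)
      fix s :: real assume s: "s \<in> {0<..<1}"
      have "norm ((1 - s ^ (p + ?d)) / (1 - s) * I p - (1 - s ^ ?d) / (1 - s) * I 0) =
        \<bar>(1 - s ^ (p + ?d)) * I p - (1 - s ^ ?d) * I 0\<bar> / (1 - s)"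
        using s by (simp add: diff_divide_distrib[symmetric])
      also have "\<dots> \<le> (1 - s ^ p) * ((1 - s ^ ?d) * (B * measure lborel ?A)) / (1 - s)"
        using s key by (intro divide_right_mono) auto
      finally show "norm ((1 - s ^ (p + ?d)) / (1 - s) * I p - (1 - s ^ ?d) / (1 - s) * I 0)
        \<le> (1 - s ^ p) * ((1 - s ^ ?d) / (1 - s) * (B * measure lborel ?A))" by simp
    qed
  qed
  with lim have "real (p + ?d) * I p - real ?d * I 0 = 0"
    by (rule tendsto_unique[rotated]) simp
  then show ?thesis unfolding I_def by simp
qed


lemma set_integrable_compact:
  fixes f :: "'a::euclidean_space \<Rightarrow> real"
  shows "compact S \<Longrightarrow> continuous_on S f \<Longrightarrow> set_integrable lborel S f"
  unfolding set_integrable_def by (rule borel_integrable_compact)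

text \<open>For a homogeneous polynomial the radial weight \<open>norm x ^ p\<close> is already part
  of \<open>f\<close>, so \<open>radial_integral\<close> compares \<open>f\<close> on the sphere
  directly with \<open>f\<close> on the ball.\<close>

lemma sphere_integral_homog:
  fixes f :: "'a::euclidean_space \<Rightarrow> real"
  assumes "rpoly f" "homog p f"
  shows "integral\<^sup>L sphere_volume f = real (p + DIM('a)) * (LINT x:cball 0 1|lborel. f x)"
proof -
  have eq: "norm x ^ p * f (sgn x) = f x" for x
    using homogD[OF assms(2), of "norm x" "sgn x"] by (cases "x = 0") (simp_all add: sgn_div_norm)
  have "(LINT x:cball 0 1 - {0}|lborel. norm x ^ p * f (sgn x)) = (LINT x:cball 0 1 - {0}|lborel. f x)"
    unfolding eq ..
  also have "\<dots> = (LINT x:cball 0 1|lborel. f x)"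
    unfolding set_lebesgue_integral_def
  proof (rule integral_cong_AE)
    have "integrable lborel (\<lambda>x. indicator S x *\<^sub>R f x)" if "S \<in> sets borel" "S \<subseteq> cball 0 1" for S
      using set_integrable_subset[OF set_integrable_compact[OF compact_cball rpoly_continuous[OF assms(1)]], of S 0 1] that
      unfolding set_integrable_def by simp
    then show "(\<lambda>x. indicator (cball 0 1 - {0}) x *\<^sub>R f x) \<in> borel_measurable lborel"
      "(\<lambda>x. indicator (cball 0 1) x *\<^sub>R f x) \<in> borel_measurable lborel" by auto
    show "AE x in lborel. indicator (cball 0 1 - {0}) x *\<^sub>R f x = indicator (cball 0 1) x *\<^sub>R f x"
      using AE_lborel_singleton[of "0::'a"] by eventually_elim (simp add: indicator_def)
  qed
  finally show ?thesis
    using radial_integral[OF rpoly_continuous[OF assms(1)], of p]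
      sphere_integral_eq(1)[OF rpoly_continuous[OF assms(1)]] by simp
qed

text \<open>Squaring makes the positive part continuously differentiable at 0, so the square of
  \<open>max 0 (1 - x \<bullet> x)\<close> can serve as a cutoff that is polynomial on the
  ball.\<close>

lemma max0_square_derivative:
  "((\<lambda>u::real. (max 0 u)\<^sup>2) has_real_derivative 2 * max 0 u) (at u)"
proof -
  consider "u > 0" | "u < 0" | "u = 0" by linarith
  then show ?thesis
  proof cases
    case 1
    have "((\<lambda>u::real. u\<^sup>2) has_real_derivative 2 * max 0 u) (at u)"
      using 1 by (auto intro!: derivative_eq_intros)
    then show ?thesis
      by (rule has_field_derivative_transform_within_open[of _ _ _ "{0<..}"]) (use 1 in auto)
  next
    case 2
    have "((\<lambda>u::real. 0) has_real_derivative 2 * max 0 u) (at u)"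
      using 2 by (auto intro!: derivative_eq_intros)
    then show ?thesis
      by (rule has_field_derivative_transform_within_open[of _ _ _ "{..<0}"]) (use 2 in auto)
  next
    case 3
    have "((\<lambda>h::real. ((max 0 (0 + h))\<^sup>2 - (max 0 0)\<^sup>2) / h) \<longlongrightarrow> 0) (at 0)"
    proof (rule Lim_null_comparison)
      show "\<forall>\<^sub>F h::real in at 0. norm (((max 0 (0 + h))\<^sup>2 - (max 0 0)\<^sup>2) / h) \<le> \<bar>h\<bar>"
        by (rule always_eventually) (auto simp: max_def power2_eq_square)
      show "((\<lambda>h::real. \<bar>h\<bar>) \<longlongrightarrow> 0) (at 0)" by (intro tendsto_eq_intros) auto
    qed
    then show ?thesis unfolding DERIV_def 3 by simp
  qed
qed

text \<open>The integrand is the derivative along \<open>v\<close> of \<open>G\<close> times the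
  squared cutoff. By translation invariance the integral of \<open>W (x + s *\<^sub>R v)\<close>
  does not depend on \<open>s\<close>, so differentiating under the integral at \<open>s = 0\<close>
  gives 0.\<close>

lemma integral_derivative_cutoff:
  fixes G :: "'a::euclidean_space \<Rightarrow> real"
  assumes "rpoly G"
  shows "(LINT x:cball 0 1|lborel. dird v G x * (1 - x \<bullet> x)\<^sup>2 - 4 * (v \<bullet> x) * (1 - x \<bullet> x) * G x) = 0"
proof -
  define m where "m x = max 0 (1 - x \<bullet> x)" for x :: 'a
  define W where "W x = G x * (m x)\<^sup>2" for x
  define W' where "W' x = dird v G x * (m x)\<^sup>2 - 4 * (v \<bullet> x) * m x * G x" for x
  have contG: "continuous_on S G" "continuous_on S (dird v G)" for S
    using assms rpoly_continuous rpoly_dird by blast+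
  have contm: "continuous_on S m" for S unfolding m_def[abs_def] by (intro continuous_intros)
  have contW: "continuous_on S W" for S unfolding W_def[abs_def] by (intro continuous_intros contG contm)
  have contW': "continuous_on S W'" for S unfolding W'_def[abs_def] by (intro continuous_intros contG contm)
  have zero: "m x = 0" if "norm x \<ge> 1" for x
    using that power_mono[of 1 "norm x" 2] by (simp add: m_def power2_norm_eq_inner)
  have deriv: "((\<lambda>s. W (x + s *\<^sub>R v)) has_field_derivative W' (x + s *\<^sub>R v)) (at s within U)" for x s U
  proof -
    note 1 = rpoly_line_derivative[OF assms, of x v s]
    have "((\<lambda>s. 1 - (x + s *\<^sub>R v) \<bullet> (x + s *\<^sub>R v)) has_vector_derivative - 2 * (v \<bullet> (x + s *\<^sub>R v))) (at s)"
      unfolding has_vector_derivative_def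
      by (auto intro!: derivative_eq_intros simp: inner_commute algebra_simps inner_add_left inner_add_right)
    then have "((\<lambda>s. 1 - (x + s *\<^sub>R v) \<bullet> (x + s *\<^sub>R v)) has_field_derivative - 2 * (v \<bullet> (x + s *\<^sub>R v))) (at s)"
      by (simp add: has_real_derivative_iff_has_vector_derivative)
    from DERIV_chain2[OF max0_square_derivative this]
    have 2: "((\<lambda>s. (m (x + s *\<^sub>R v))\<^sup>2) has_field_derivative 2 * m (x + s *\<^sub>R v) * (- 2 * (v \<bullet> (x + s *\<^sub>R v)))) (at s)"
      unfolding m_def .
    have "((\<lambda>s. W (x + s *\<^sub>R v)) has_field_derivative W' (x + s *\<^sub>R v)) (at s)"
      unfolding W_def by (rule DERIV_cong[OF DERIV_mult[OF 1 2]]) (simp add: W'_def algebra_simps)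
    then show ?thesis by (rule has_field_derivative_at_within)
  qed
  \<comment> \<open>One box contains the supports of all translates with
    \<open>\<bar>s\<bar> \<le> 1\<close>, so that the Leibniz rule on a compact box applies.\<close>
  obtain b where b: "cball (0::'a) (1 + norm v) \<subseteq> cbox (-b) b"
    using bounded_subset_cbox_symmetric[OF bounded_cball] by blast
  define F where "F s = integral (cbox (-b) b) (\<lambda>x. W (x + s *\<^sub>R v))" for s
  have int: "set_integrable lborel (cbox (-b) b) (\<lambda>x. W (x + s *\<^sub>R v))" for s
    by (rule set_integrable_compact) (auto intro!: continuous_on_compose2[OF contW] continuous_intros)
  have const: "F s = (LINT x|lborel. W x)" if s: "s \<in> {-1..1}" for s
  proof -
    have "F s = (LINT x:cbox (-b) b|lborel. W (x + s *\<^sub>R v))"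
      unfolding F_def using set_borel_integral_eq_integral(2)[OF int] by simp
    also have "\<dots> = (LINT x|lborel. W (x + s *\<^sub>R v))"
      unfolding set_lebesgue_integral_def
    proof (rule Bochner_Integration.integral_cong[OF refl])
      fix x
      show "indicat_real (cbox (-b) b) x *\<^sub>R W (x + s *\<^sub>R v) = W (x + s *\<^sub>R v)"
      proof (cases "x \<in> cbox (-b) b")
        case False
        then have "norm x > 1 + norm v" using b by (metis mem_cball_0 not_le subsetD)
        moreover have "norm (s *\<^sub>R v) \<le> norm v" using s by (auto simp: mult_left_le_one_le)
        ultimately have "norm (x + s *\<^sub>R v) \<ge> 1" using norm_triangle_ineq4[of "x + s *\<^sub>R v" "s *\<^sub>R v"] by simp
        then show ?thesis using zero by (simp add: W_def)
      qed auto
    qed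
    also have "\<dots> = (LINT x|lborel. W x)"
      using lborel_integral_affine[of 1 W "s *\<^sub>R v"] borel_measurable_continuous_onI[OF contW]
      by (simp add: add.commute)
    finally show ?thesis .
  qed
  have "((\<lambda>s. F s) has_field_derivative integral (cbox (-b) b) (\<lambda>x. W' (x + 0 *\<^sub>R v))) (at 0 within {-1..1})"
    unfolding F_def
  proof (rule leibniz_rule_field_derivative)
    show "(\<lambda>x. W (x + s *\<^sub>R v)) integrable_on cbox (-b) b" for s
      by (rule set_borel_integral_eq_integral(1)[OF int])
    show "continuous_on ({-1..1} \<times> cbox (-b) b) (\<lambda>(s, x). W' (x + s *\<^sub>R v))"
      unfolding case_prod_beta by (auto intro!: continuous_on_compose2[OF contW'] continuous_intros)
  qed (auto intro: deriv)
  moreover have "((\<lambda>s. F s) has_field_derivative 0) (at 0 within {-1..1})"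
    by (rule has_field_derivative_transform_within[of "\<lambda>_. LINT x|lborel. W x" _ _ _ 1]) (auto simp: const)
  ultimately have "integral (cbox (-b) b) W' = 0"
    using has_field_derivative_unique[of F _ 0 "{-1..1}" 0] by (auto simp: trivial_limit_within islimpt_Icc)
  then have "(LINT x:cbox (-b) b|lborel. W' x) = 0"
    using set_borel_integral_eq_integral(2)[OF set_integrable_compact[OF compact_cbox contW']] by simp
  moreover have "(LINT x:cbox (-b) b|lborel. W' x) =
      (LINT x:cball 0 1|lborel. dird v G x * (1 - x \<bullet> x)\<^sup>2 - 4 * (v \<bullet> x) * (1 - x \<bullet> x) * G x)"
    unfolding set_lebesgue_integral_def
  proof (rule Bochner_Integration.integral_cong[OF refl])
    fix x :: 'a
    show "indicat_real (cbox (-b) b) x *\<^sub>R W' x = indicator (cball 0 1) x *\<^sub>R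
      (dird v G x * (1 - x \<bullet> x)\<^sup>2 - 4 * (v \<bullet> x) * (1 - x \<bullet> x) * G x)"
    proof (cases "norm x \<le> 1")
      case True
      then have "x \<in> cball 0 (1 + norm v)" by (simp add: add_increasing2)
      then have "x \<in> cbox (-b) b" using b by blast
      moreover have "m x = 1 - x \<bullet> x" using True power_mono[of "norm x" 1 2] by (simp add: m_def power2_norm_eq_inner)
      ultimately show ?thesis using True by (simp add: W'_def)
    next
      case False
      then show ?thesis using zero[of x] by (simp add: W'_def)
    qed
  qed
  ultimately show ?thesis by simp
qed

text \<open>The divergence theorem on the sphere. The cutoff identity is expanded in powers of
  \<open>x \<bullet> x\<close>. These equal 1 on the sphere, so every ball integral that occurs is
  tied to \<open>D\<close> or to \<open>E\<close> by an explicit factor, and a single linear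
  relation between \<open>D\<close> and \<open>E\<close> remains.\<close>

lemma sphere_integral_dird:
  fixes G :: "'a::euclidean_space \<Rightarrow> real"
  assumes "rpoly G" "homog p G"
  shows "integral\<^sup>L sphere_volume (dird v G) =
    (real p + real DIM('a) - 1) * (LINT x|sphere_volume. (v \<bullet> x) * G x)"
proof -
  let ?B = "cball (0::'a) 1" and ?d = "real DIM('a)"
  define a where "a = real p + ?d - 1"
  define D where "D = integral\<^sup>L sphere_volume (dird v G)"
  define E where "E = (LINT x|sphere_volume. (v \<bullet> x) * G x)"
  have d: "?d \<ge> 1" by (simp add: DIM_positive Suc_leI)
  have pD: "rpoly (dird v G)" by (rule rpoly_dird[OF assms(1)])
  have pDR: "rpoly (\<lambda>x. dird v G x * (x \<bullet> x) ^ i)" for i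
    by (intro rpoly_mult pD real_polynomial_function_power rpoly_norm2)
  have pE: "rpoly (\<lambda>x. (v \<bullet> x) * G x * (x \<bullet> x) ^ i)" for i
    by (intro rpoly_mult rpoly_inner_left assms(1) real_polynomial_function_power rpoly_norm2)
  have on_sphere: "(LINT x|sphere_volume. f x * (x \<bullet> x) ^ i) = (LINT x|sphere_volume. f x)" for f :: "'a \<Rightarrow> real" and i
    by (rule Bochner_Integration.integral_cong[OF refl])
      (auto simp: space_sphere_volume power2_norm_eq_inner[symmetric])
  have ID: "D = (a + 2 * real i) * (LINT x:?B|lborel. dird v G x * (x \<bullet> x) ^ i)" for i
  proof (cases p)
    \<comment> \<open>The derivative of a constant has no degree \<open>p - 1\<close>; here both
      sides vanish.\<close>
    case 0
    then show ?thesis using dird_homog_0[of G v] assms(2) unfolding D_def by simp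
  next
    case (Suc q)
    have "homog (q + 2 * i) (\<lambda>x. dird v G x * (x \<bullet> x) ^ i)"
      using homog_mult[OF homog_dird[OF assms(1), of q v] homog_power[OF homog_norm2, where n=i]] assms(2) Suc by simp
    from sphere_integral_homog[OF pDR this] show ?thesis
      unfolding on_sphere D_def a_def Suc by (simp add: algebra_simps)
  qed
  have IE: "E = (a + 2 + 2 * real i) * (LINT x:?B|lborel. (v \<bullet> x) * G x * (x \<bullet> x) ^ i)" for i
  proof -
    have "homog (1 + p + 2 * i) (\<lambda>x. (v \<bullet> x) * G x * (x \<bullet> x) ^ i)"
      by (intro homog_mult homog_power homog_norm2 assms(2) homog_inner_left)
    from sphere_integral_homog[OF pE this] show ?thesis
      unfolding on_sphere E_def a_def by (simp add: algebra_simps)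
  qed
  have iD: "set_integrable lborel ?B (\<lambda>x. dird v G x * (x \<bullet> x) ^ i)" for i
    by (rule set_integrable_compact[OF compact_cball rpoly_continuous[OF pDR]])
  have iE: "set_integrable lborel ?B (\<lambda>x. (v \<bullet> x) * G x * (x \<bullet> x) ^ i)" for i
    by (rule set_integrable_compact[OF compact_cball rpoly_continuous[OF pE]])
  define ID' where "ID' i = (LINT x:?B|lborel. dird v G x * (x \<bullet> x) ^ i)" for i
  define IE' where "IE' i = (LINT x:?B|lborel. (v \<bullet> x) * G x * (x \<bullet> x) ^ i)" for i
  have "0 = (LINT x:?B|lborel. dird v G x * (1 - x \<bullet> x)\<^sup>2 - 4 * (v \<bullet> x) * (1 - x \<bullet> x) * G x)"
    using integral_derivative_cutoff[OF assms(1), of v] by simp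
  also have "\<dots> = (LINT x:?B|lborel. (dird v G x * (x \<bullet> x) ^ 0 - 2 * (dird v G x * (x \<bullet> x) ^ 1) + dird v G x * (x \<bullet> x) ^ 2)
      - (4 * ((v \<bullet> x) * G x * (x \<bullet> x) ^ 0) - 4 * ((v \<bullet> x) * G x * (x \<bullet> x) ^ 1)))"
    by (rule arg_cong[where f="\<lambda>f. set_lebesgue_integral lborel ?B f"])
      (auto simp: fun_eq_iff power2_eq_square algebra_simps)
  also have "\<dots> = (ID' 0 - 2 * ID' 1 + ID' 2) - (4 * IE' 0 - 4 * IE' 1)"
    unfolding ID'_def IE'_def
    by (subst set_integral_diff(2) set_integral_add(2) set_integral_mult_right;
        (intro set_integral_diff(1) set_integral_add(1) set_integrable_mult_right iD iE)?)+ simp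
  finally have eq: "ID' 0 - 2 * ID' 1 + ID' 2 = 4 * (IE' 0 - IE' 1)" by simp
  have D: "D = a * ID' 0" "D = (a + 2) * ID' 1" "D = (a + 4) * ID' 2"
    using ID[of 0] ID[of 1] ID[of 2] unfolding ID'_def by simp_all
  have E: "E = (a + 2) * IE' 0" "E = (a + 4) * IE' 1"
    using IE[of 0] IE[of 1] unfolding IE'_def by (simp_all only: of_nat_1 of_nat_0) (simp_all add: add.assoc)
  have a: "a \<ge> 0" using d unfolding a_def by linarith
  \<comment> \<open>Multiplying by this product instead of dividing by its factors keeps the case
    \<open>a = 0\<close> (constants in dimension 1) valid.\<close>
  have "a * (a + 2) * (a + 4) * (ID' 0 - 2 * ID' 1 + ID' 2) =
     (a * ID' 0) * (a + 2) * (a + 4) - 2 * ((a + 2) * ID' 1) * a * (a + 4) + ((a + 4) * ID' 2) * a * (a + 2)"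
    by (simp add: algebra_simps)
  also have "\<dots> = D * 8" unfolding D[symmetric] by (simp add: algebra_simps)
  finally have 1: "a * (a + 2) * (a + 4) * (ID' 0 - 2 * ID' 1 + ID' 2) = D * 8" .
  have "a * (a + 2) * (a + 4) * (4 * (IE' 0 - IE' 1)) =
     4 * a * (((a + 2) * IE' 0) * (a + 4) - ((a + 4) * IE' 1) * (a + 2))"
    by (simp add: algebra_simps)
  also have "\<dots> = a * E * 8" unfolding E[symmetric] by (simp add: algebra_simps)
  finally have "a * (a + 2) * (a + 4) * (4 * (IE' 0 - IE' 1)) = a * E * 8" .
  then have "D * 8 = a * E * 8" using 1 unfolding eq by linarith
  then have "D = a * E" by simp
  then show ?thesis unfolding D_def E_def a_def .
qed

section \<open>Spherical harmonics and Gegenbauer polynomials\<close>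

definition harmonic_poly :: "nat \<Rightarrow> ('a::euclidean_space \<Rightarrow> real) \<Rightarrow> bool" where
  "harmonic_poly m H \<longleftrightarrow> rpoly H \<and> homog m H \<and> lap H = (\<lambda>x. 0)"

lemma harmonic_polyD:
  assumes "harmonic_poly m H" shows "rpoly H" "homog m H" "lap H = (\<lambda>x. 0)"
  using assms by (auto simp: harmonic_poly_def)

lemma harmonic_poly_dird:
  assumes "harmonic_poly (Suc m) H" shows "harmonic_poly m (dird v H)"
  using harmonic_polyD[OF assms] by (simp add: harmonic_poly_def rpoly_dird homog_dird lap_dird)

lemma sphere_integral_add:
  fixes f g :: "'a::euclidean_space \<Rightarrow> real"
  assumes "continuous_on (sphere 0 1) f" "continuous_on (sphere 0 1) g"
  shows "(LINT x|sphere_volume. f x + g x) = integral\<^sup>L sphere_volume f + integral\<^sup>L sphere_volume g"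
  by (intro Bochner_Integration.integral_add sphere_integrable assms)

lemma sphere_integral_diff:
  fixes f g :: "'a::euclidean_space \<Rightarrow> real"
  assumes "continuous_on (sphere 0 1) f" "continuous_on (sphere 0 1) g"
  shows "(LINT x|sphere_volume. f x - g x) = integral\<^sup>L sphere_volume f - integral\<^sup>L sphere_volume g"
  by (intro Bochner_Integration.integral_diff sphere_integrable assms)

lemma sphere_integral_sum:
  fixes f :: "'i \<Rightarrow> 'a::euclidean_space \<Rightarrow> real"
  assumes "\<And>i. i \<in> I \<Longrightarrow> continuous_on (sphere 0 1) (f i)"
  shows "(LINT x|sphere_volume. (\<Sum>i\<in>I. f i x)) = (\<Sum>i\<in>I. integral\<^sup>L sphere_volume (f i))"
  by (intro Bochner_Integration.integral_sum sphere_integrable assms)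

lemma sphere_integral_cong:
  "(\<And>x. norm x = 1 \<Longrightarrow> f x = g x) \<Longrightarrow>
    integral\<^sup>L sphere_volume f = integral\<^sup>L (sphere_volume::'a::euclidean_space measure) g"
  by (rule Bochner_Integration.integral_cong) (auto simp: space_sphere_volume)

lemma sphere_volume_total:
  assumes "DIM('a::euclidean_space) = 2 * Suc l"
  shows "(LINT x|(sphere_volume::'a measure). c) = c * (2 * pi ^ Suc l / fact l)"
proof -
  have "(LINT x|(sphere_volume::'a measure). c) = real DIM('a) * (LINT x:cball (0::'a) 1|lborel. c)"
    using sphere_integral_homog[of "\<lambda>x::'a. c" 0] by (simp add: homog_const)
  also have "(LINT x:cball (0::'a) 1|lborel. c) = c * unit_ball_vol (real DIM('a))"
    using emeasure_lborel_cball_finite[of "0::'a" 1] content_cball[of 1 "0::'a"]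
    unfolding set_lebesgue_integral_def by simp
  also have "unit_ball_vol (real DIM('a)) = pi ^ Suc l / (real (Suc l) * fact l)"
    unfolding assms unit_ball_vol_even fact_Suc ..
  also have "real DIM('a) * (c * (pi ^ Suc l / (real (Suc l) * fact l))) = c * (2 * pi ^ Suc l / fact l)"
    unfolding assms of_nat_mult by (simp add: divide_simps del: of_nat_Suc power_Suc)
  finally show ?thesis .
qed

text \<open>Integrating \<open>lap H = 0\<close> by parts and applying Euler's identity to the sum
  over the basis yields a nonzero multiple of the integral of \<open>H\<close>.\<close>

lemma harmonic_sphere_mean_zero:
  fixes H :: "'a::euclidean_space \<Rightarrow> real"
  assumes "harmonic_poly (Suc m) H" "DIM('a) \<ge> 2"
  shows "integral\<^sup>L sphere_volume H = 0"
proof -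
  note H = harmonic_polyD[OF assms(1)]
  have "0 = (LINT x|sphere_volume. lap H x)" unfolding H(3) by simp
  also have "\<dots> = (\<Sum>b\<in>Basis. LINT x|sphere_volume. dird b (dird b H) x)"
    unfolding lap_def by (rule sphere_integral_sum) (intro rpoly_continuous rpoly_dird H(1))
  also have "\<dots> = (\<Sum>b\<in>Basis. (real m + real DIM('a) - 1) * (LINT x|sphere_volume. (b \<bullet> x) * dird b H x))"
    by (intro sum.cong refl sphere_integral_dird rpoly_dird homog_dird H)
  also have "\<dots> = (real m + real DIM('a) - 1) * (LINT x|sphere_volume. (\<Sum>b\<in>Basis. (b \<bullet> x) * dird b H x))"
    unfolding sum_distrib_left[symmetric]
    by (subst sphere_integral_sum) (auto intro!: rpoly_continuous rpoly_dird rpoly_mult H(1))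
  also have "(LINT x|sphere_volume. (\<Sum>b\<in>Basis. (b \<bullet> x) * dird b H x)) = (LINT x|sphere_volume. real (Suc m) * H x)"
    by (rule Bochner_Integration.integral_cong[OF refl])
      (simp only: dird_euclidean[OF H(1), symmetric] inner_commute[of _ "_::'a"] euler_homog[OF H(1,2)] )
  finally show ?thesis using assms(2) by simp
qed

text \<open>\<open>zonal_moment l j m\<close> is the factor by which integration against \<open>(x \<bullet> y)\<^sup>j\<close> over the unit
  sphere of dimension \<open>2 l + 1\<close> multiplies a spherical harmonic of degree \<open>m\<close>.\<close>

definition zonal_moment :: "nat \<Rightarrow> nat \<Rightarrow> nat \<Rightarrow> real" where
  "zonal_moment l j m =
    (if m \<le> j \<and> even (j - m)
     then 2 * pi ^ Suc l * fact j / (2 ^ j * fact ((j - m) div 2) * fact (l + m + (j - m) div 2)) else 0)"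

lemma zonal_moment_rec_aux:
  assumes "m \<le> Suc j \<and> even (Suc j - m)"
  shows "(real m + real (Suc j) + 2 * real l) * zonal_moment l (Suc j) m =
    real j * zonal_moment l (j - 1) m + real m * zonal_moment l j (m - 1)"
proof -
  obtain i where i: "Suc j = m + 2 * i" using assms by (metis dvd_def le_add_diff_inverse)
  have zm: "zonal_moment l (a + 2 * b) a =
     2 * pi ^ Suc l * fact (a + 2 * b) / (2 ^ (a + 2 * b) * fact b * fact (l + a + b))" for a b
    by (simp add: zonal_moment_def)
  \<comment> \<open>All three moments are multiples of \<open>c\<close>, and the recursion becomes
    \<open>2 (l + m + i) (m + 2 i) = 4 i (l + m + i) + 2 m (l + m + i)\<close>.\<close>
  define c where "c = 2 * pi ^ Suc l * fact j / (2 ^ Suc j * fact i * fact (l + m + i))"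
  have lhs: "zonal_moment l (Suc j) m = c * real (Suc j)"
    using zm[of m i] unfolding i[symmetric] c_def by (simp del: power_Suc)
  have r2: "real m * zonal_moment l j (m - 1) = c * (2 * real m * real (l + m + i))"
  proof (cases m)
    case (Suc k)
    then have "j = k + 2 * i" using i by simp
    then have "zonal_moment l j (m - 1) = 2 * pi ^ Suc l * fact j / (2 ^ j * fact i * fact (l + k + i))"
      using zm[of k i] Suc by simp
    also have "\<dots> = c * (2 * real (l + m + i))"
      unfolding c_def Suc by (simp add: divide_simps)
    finally show ?thesis by simp
  qed (simp add: c_def)
  have r1: "real j * zonal_moment l (j - 1) m = c * (4 * real i * real (l + m + i))"
  proof (cases i)
    case (Suc k)
    then have j: "j = Suc (m + 2 * k)" using i by simp
    then have "zonal_moment l (j - 1) m = 2 * pi ^ Suc l * fact (j - 1) / (2 ^ (j - 1) * fact k * fact (l + m + k))"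
      using zm[of m k] by simp
    define P D where "P = 2 * pi ^ Suc l * fact (j - 1)"
      and "D = 2 ^ (j - 1) * fact k * (fact (l + m + k) :: real)"
    have z: "zonal_moment l (j - 1) m = P / D" unfolding P_def D_def by fact
    have c: "c = P * real j / (4 * real i * real (l + m + i) * D)"
    proof -
      have "(fact j :: real) = real j * fact (j - 1)" "(2::real) ^ Suc j = 4 * 2 ^ (j - 1)"
        "(fact i :: real) = real i * fact k" "(fact (l + m + i) :: real) = real (l + m + i) * fact (l + m + k)"
        using Suc j by simp_all
      then show ?thesis unfolding c_def P_def D_def by (simp add: mult_ac del: of_nat_add)
    qed
    have "real i \<noteq> 0" "real (l + m + i) \<noteq> 0" "D \<noteq> 0" using Suc by (simp_all add: D_def)
    then show ?thesis unfolding z c by (simp del: of_nat_add)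
  next
    case 0
    then show ?thesis using i unfolding zonal_moment_def by auto
  qed
  show ?thesis unfolding lhs r1 r2 using i by (simp add: algebra_simps flip: of_nat_Suc)
qed

text \<open>The recursion that integration by parts imposes in \<open>sphere_moment\<close>. For
  \<open>j = 0\<close> or \<open>m = 0\<close> the truncated \<open>j - 1\<close> or
  \<open>m - 1\<close> is multiplied by 0.\<close>

lemma zonal_moment_rec:
  "(real m + real (Suc j) + 2 * real l) * zonal_moment l (Suc j) m =
    real j * zonal_moment l (j - 1) m + real m * zonal_moment l j (m - 1)"
proof (cases "m \<le> Suc j \<and> even (Suc j - m)")
  case False
  have "real j * zonal_moment l (j - 1) m = 0"
  proof (cases "j = 0 \<or> \<not> m \<le> j - 1")
    case 2: False
    then have "Suc j - m = 2 + (j - 1 - m)" by auto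
    then show ?thesis using False 2 unfolding zonal_moment_def by auto
  qed (auto simp: zonal_moment_def)
  moreover have "real m * zonal_moment l j (m - 1) = 0"
    using False unfolding zonal_moment_def by (cases m) auto
  moreover have "zonal_moment l (Suc j) m = 0" using False unfolding zonal_moment_def by simp
  ultimately show ?thesis by (simp only: mult_zero_right add_0)
qed (rule zonal_moment_rec_aux)

text \<open>The Funk-Hecke formula for powers. \<open>sphere_integral_dird\<close> in the direction
  \<open>x\<close>, applied to \<open>(x \<bullet> y) ^ i * H y\<close> with
  \<open>j = Suc i\<close>, lowers either the power or the degree of \<open>H\<close>. The induction
  closes because \<open>dird x H\<close> is again harmonic, of degree \<open>m - 1\<close>, and
  equals \<open>m * H x\<close> at \<open>x\<close> by Euler's identity.\<close>

lemma sphere_moment: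
  fixes H :: "'a::euclidean_space \<Rightarrow> real"
  assumes "harmonic_poly m H" "DIM('a) = 2 * Suc l" "norm x = 1"
  shows "(LINT y|sphere_volume. (x \<bullet> y) ^ j * H y) = zonal_moment l j m * H x"
  using assms(1)
proof (induction j arbitrary: m H rule: less_induct)
  case (less j)
  note H = harmonic_polyD[OF less.prems]
  show ?case
  proof (cases j)
    case 0
    show ?thesis
    proof (cases m)
      case m: 0
      have "H y = H 0" for y using homog_0_const[of H] H(2) m by simp
      then have "H = (\<lambda>y. H x)" by metis
      then have "(LINT y|sphere_volume. H y) = (LINT y|(sphere_volume::'a measure). H x)" by metis
      then show ?thesis unfolding sphere_volume_total[OF assms(2)] zonal_moment_def m 0 by simp
    next
      case (Suc k)
      then show ?thesis using harmonic_sphere_mean_zero[of k H] less.prems assms(2)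
        unfolding zonal_moment_def 0 by simp
    qed
  next
    case (Suc i)
    have pl: "rpoly (\<lambda>y. (x \<bullet> y) ^ k)" for k by (intro real_polynomial_function_power) simp
    have hl: "homog k (\<lambda>y. (x \<bullet> y) ^ k)" for k by (simp add: homog_def power_mult_distrib)
    have dl: "dird x (\<lambda>y. (x \<bullet> y) ^ k) = (\<lambda>y. real k * (x \<bullet> y) ^ (k - 1))" for k
    proof (rule ext, rule dird_eqI[THEN trans])
      fix y
      show "((\<lambda>y. (x \<bullet> y) ^ k) has_derivative (\<lambda>h. real k * (x \<bullet> h) * (x \<bullet> y) ^ (k - 1))) (at y)"
        by (auto intro!: derivative_eq_intros simp: mult_ac)
      show "real k * (x \<bullet> x) * (x \<bullet> y) ^ (k - 1) = real k * (x \<bullet> y) ^ (k - 1)"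
        using assms(3) by (simp add: norm_eq_1)
    qed
    let ?B = "\<lambda>k G. LINT y|sphere_volume. (x \<bullet> y) ^ k * G y"
    have cont: "continuous_on (sphere 0 1) (\<lambda>y. (x \<bullet> y) ^ k * G y)" if "rpoly G" for k G
      by (intro rpoly_continuous rpoly_mult pl that)
    have "(real (i + m) + real DIM('a) - 1) * ?B j H =
      (real (i + m) + real DIM('a) - 1) * (LINT y|sphere_volume. (x \<bullet> y) * ((x \<bullet> y) ^ i * H y))"
      unfolding Suc by (simp add: mult.assoc)
    also have "\<dots> = integral\<^sup>L sphere_volume (dird x (\<lambda>y. (x \<bullet> y) ^ i * H y))"
      by (rule sphere_integral_dird[symmetric]) (intro rpoly_mult pl H, intro homog_mult hl H)
    also have "dird x (\<lambda>y. (x \<bullet> y) ^ i * H y) =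
        (\<lambda>y. (x \<bullet> y) ^ i * dird x H y + real i * ((x \<bullet> y) ^ (i - 1) * H y))"
      unfolding dird_mult[OF pl H(1)] dl by (simp add: mult_ac)
    also have "(LINT y|sphere_volume. (x \<bullet> y) ^ i * dird x H y + real i * ((x \<bullet> y) ^ (i - 1) * H y)) =
        ?B i (dird x H) + (LINT y|sphere_volume. real i * ((x \<bullet> y) ^ (i - 1) * H y))"
      by (intro sphere_integral_add rpoly_continuous rpoly_mult rpoly_cmult pl H rpoly_dird)
    also have "(LINT y|sphere_volume. real i * ((x \<bullet> y) ^ (i - 1) * H y)) = real i * ?B (i - 1) H" by simp
    also have "real i * ?B (i - 1) H = real i * (zonal_moment l (i - 1) m * H x)"
      using less.IH[OF _ less.prems, of "i - 1"] Suc by (cases i) auto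
    also have "?B i (dird x H) = zonal_moment l i (m - 1) * (real m * H x)"
    proof (cases m)
      case 0
      then show ?thesis using dird_homog_0[of H x] H(2) by simp
    next
      case m: (Suc k)
      have "?B i (dird x H) = zonal_moment l i k * dird x H x"
        by (rule less.IH) (use Suc less.prems m in \<open>auto intro: harmonic_poly_dird\<close>)
      then show ?thesis using m euler_homog[OF H(1,2), of x] by simp
    qed
    also have "zonal_moment l i (m - 1) * (real m * H x) + real i * (zonal_moment l (i - 1) m * H x) =
      (real m + real (Suc i) + 2 * real l) * zonal_moment l (Suc i) m * H x"
      unfolding zonal_moment_rec by (simp add: algebra_simps)
    also have "real (i + m) + real DIM('a) - 1 = real m + real (Suc i) + 2 * real l"
      unfolding assms(2) by simp
    finally have "(real m + real (Suc i) + 2 * real l) * ?B j H =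
      (real m + real (Suc i) + 2 * real l) * (zonal_moment l j m * H x)" using Suc by (simp only: mult.assoc)
    then show ?thesis
      by (rule mult_left_cancel[THEN iffD1, rotated]) (simp add: add_nonneg_eq_0_iff)
  qed
qed

text \<open>An \<open>s\<close>-fold finite difference of \<open>(N - k) choose r\<close>, a
  polynomial in \<open>k\<close> of degree \<open>r < s\<close>. Pascal's rule trades one difference
  for one degree.\<close>

lemma alternating_binomial_sum_zero:
  assumes "r < s" "s \<le> N"
  shows "(\<Sum>k\<le>s. (-1) ^ k * real (s choose k) * real ((N - k) choose r)) = 0"
  using assms
proof (induction s arbitrary: r N)
  case (Suc s)
  let ?g = "\<lambda>k. real ((N - k) choose r)"
  have "(\<Sum>k\<le>Suc s. (-1) ^ k * real (Suc s choose k) * ?g k) =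
     ?g 0 + (\<Sum>k\<le>s. (-1) ^ Suc k * real (Suc s choose Suc k) * ?g (Suc k))"
    by (subst sum.atMost_Suc_shift) simp
  also have "(\<Sum>k\<le>s. (-1) ^ Suc k * real (Suc s choose Suc k) * ?g (Suc k)) =
     (\<Sum>k\<le>s. (-1) ^ Suc k * real (s choose Suc k) * ?g (Suc k)) - (\<Sum>k\<le>s. (-1) ^ k * real (s choose k) * ?g (Suc k))"
    unfolding sum_subtractf[symmetric] by (rule sum.cong) (auto simp: algebra_simps)
  also have "?g 0 + ((\<Sum>k\<le>s. (-1) ^ Suc k * real (s choose Suc k) * ?g (Suc k)) - (\<Sum>k\<le>s. (-1) ^ k * real (s choose k) * ?g (Suc k)))
    = (\<Sum>k\<le>Suc s. (-1) ^ k * real (s choose k) * ?g k) - (\<Sum>k\<le>s. (-1) ^ k * real (s choose k) * ?g (Suc k))"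
  proof -
    have "(\<Sum>k\<le>Suc s. (-1) ^ k * real (s choose k) * ?g k) =
      ?g 0 + (\<Sum>k\<le>s. (-1) ^ Suc k * real (s choose Suc k) * ?g (Suc k))"
      by (subst sum.atMost_Suc_shift) simp
    then show ?thesis by linarith
  qed
  also have "\<dots> = (\<Sum>k\<le>s. (-1) ^ k * real (s choose k) * (?g k - ?g (Suc k)))"
    unfolding right_diff_distrib sum_subtractf by simp
  also have "\<dots> = 0"
  proof (cases r)
    case 0
    then show ?thesis by simp
  next
    case (Suc r')
    have "?g k - ?g (Suc k) = real ((N - 1 - k) choose r')" if "k \<le> s" for k
    proof -
      have "N - k = Suc (N - Suc k)" using that Suc.prems by auto
      then show ?thesis unfolding Suc by simp
    qed
    then have "(\<Sum>k\<le>s. (-1) ^ k * real (s choose k) * (?g k - ?g (Suc k))) =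
      (\<Sum>k\<le>s. (-1) ^ k * real (s choose k) * real ((N - 1 - k) choose r'))" by (intro sum.cong) auto
    also have "\<dots> = 0" by (rule Suc.IH) (use Suc.prems \<open>r = Suc r'\<close> in auto)
    finally show ?thesis .
  qed
  finally show ?case .
qed simp

text \<open>Inserting the moments of the powers leaves a sum over the Gegenbauer coefficients alone.
  With \<open>M = m + 2 * s\<close> it is an \<open>s\<close>-fold finite difference of a polynomial
  of degree \<open>s - 1\<close>, so only \<open>s = 0\<close> survives.\<close>

lemma gegenbauer_reproducing:
  fixes H :: "'a::euclidean_space \<Rightarrow> real"
  assumes "harmonic_poly m H" "DIM('a) = 2 * Suc l" "l > 0" "norm x = 1"
  shows "(LINT y|sphere_volume. gegenbauer (real l) M (x \<bullet> y) * H y) =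
     (if M = m then 2 * pi ^ Suc l / (fact (l - 1) * real (m + l)) * H x else 0)"
proof -
  note H = harmonic_polyD[OF assms(1)]
  let ?c = "\<lambda>k. (-1) ^ k * pochhammer (real l) (M - k) / (fact k * fact (M - 2 * k)) * 2 ^ (M - 2 * k)"
  have poch: "pochhammer (real l) i = fact (l + i - 1) / fact (l - 1)" for i
  proof -
    have "pochhammer (1::real) (l + i - 1) = pochhammer 1 (l - 1) * pochhammer (1 + real (l - 1)) i"
      using assms(3) pochhammer_product'[of "1::real" "l - 1" i] by simp
    then show ?thesis using assms(3) by (simp add: pochhammer_fact[symmetric] of_nat_diff)
  qed
  have "(LINT y|sphere_volume. gegenbauer (real l) M (x \<bullet> y) * H y) =
     (LINT y|sphere_volume. (\<Sum>k\<le>M div 2. ?c k * ((x \<bullet> y) ^ (M - 2 * k) * H y)))"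
    unfolding gegenbauer_def by (simp add: sum_distrib_right sum_distrib_left power_mult_distrib mult_ac)
  also have "\<dots> = (\<Sum>k\<le>M div 2. ?c k * (zonal_moment l (M - 2 * k) m * H x))"
    unfolding sphere_moment[OF assms(1,2,4), symmetric]
    by (subst sphere_integral_sum)
      (auto intro!: rpoly_continuous rpoly_cmult rpoly_mult real_polynomial_function_power H(1))
  also have "\<dots> = (\<Sum>k\<le>M div 2. ?c k * zonal_moment l (M - 2 * k) m) * H x"
    by (simp add: sum_distrib_right sum_distrib_left mult_ac)
  also have "(\<Sum>k\<le>M div 2. ?c k * zonal_moment l (M - 2 * k) m) =
     (if M = m then 2 * pi ^ Suc l / (fact (l - 1) * real (m + l)) else 0)"
  proof (cases "m \<le> M \<and> even (M - m)")
    case False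
    have "zonal_moment l (M - 2 * k) m = 0" if "k \<le> M div 2" for k
      using False that unfolding zonal_moment_def by auto
    then show ?thesis using False by auto
  next
    case True
    then obtain s where M: "M = m + 2 * s" by (metis dvd_def le_add_diff_inverse)
    have "?c k * zonal_moment l (M - 2 * k) m =
      (if k \<le> s then 2 * pi ^ Suc l / fact (l - 1) * ((-1) ^ k * fact (l + m + 2 * s - k - 1) /
         (fact k * fact (s - k) * fact (l + m + s - k))) else 0)" if "k \<le> M div 2" for k
    proof (cases "k \<le> s")
      case True
      have 1: "M - 2 * k = m + 2 * (s - k)" using True M by auto
      have 2: "l + (M - k) - 1 = l + m + 2 * s - k - 1" using M True by auto
      have 3: "l + m + (s - k) = l + m + s - k" using True by auto
      have "zonal_moment l (M - 2 * k) m = 2 * pi ^ Suc l * fact (M - 2 * k) /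
         (2 ^ (M - 2 * k) * fact (s - k) * fact (l + m + s - k))"
        unfolding zonal_moment_def 1 by (simp add: 3)
      then show ?thesis unfolding poch 2 using True by (simp add: mult_ac)
    qed (use that M in \<open>auto simp: zonal_moment_def\<close>)
    then have "(\<Sum>k\<le>M div 2. ?c k * zonal_moment l (M - 2 * k) m) =
      (\<Sum>k\<le>M div 2. if k \<le> s then 2 * pi ^ Suc l / fact (l - 1) * ((-1) ^ k * fact (l + m + 2 * s - k - 1) /
         (fact k * fact (s - k) * fact (l + m + s - k))) else 0)"
      by (intro sum.cong) auto
    also have "\<dots> = (\<Sum>k\<le>s. 2 * pi ^ Suc l / fact (l - 1) * ((-1) ^ k * fact (l + m + 2 * s - k - 1) /
         (fact k * fact (s - k) * fact (l + m + s - k))))"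
      unfolding M by (rule sum.mono_neutral_cong_right) auto
    also have "\<dots> = 2 * pi ^ Suc l / fact (l - 1) * (\<Sum>k\<le>s. (-1) ^ k * fact (l + m + 2 * s - k - 1) /
         (fact k * fact (s - k) * fact (l + m + s - k)))"
      by (simp only: sum_distrib_left)
    also have "(\<Sum>k\<le>s. (-1) ^ k * fact (l + m + 2 * s - k - 1) /
         (fact k * fact (s - k) * fact (l + m + s - k))) = (if s = 0 then 1 / real (m + l) else (0::real))"
    proof (cases s)
      case 0
      have "fact (l + m) = real (l + m) * fact (l + m - 1)" using assms(3) by (simp add: fact_reduce)
      then show ?thesis using 0 assms(3) by (simp add: add.commute)
    next
      case (Suc r)
      \<comment> \<open>With \<open>s = Suc r\<close> the quotient of factorials is, up to
        constants, a binomial coefficient with lower index \<open>r\<close>, one less than the order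
        of the difference.\<close>
      let ?N = "l + m + 2 * s - 1"
      have "(-1) ^ k * fact (l + m + 2 * s - k - 1) / (fact k * fact (s - k) * fact (l + m + s - k)) =
         fact r / fact s * ((-1) ^ k * real (s choose k) * real ((?N - k) choose r))" if "k \<le> s" for k
      proof -
        have 1: "l + m + 2 * s - k - 1 = ?N - k" by simp
        have 2: "l + m + s - k = ?N - k - r" using Suc that by simp
        have 3: "real (s choose k) = fact s / (fact k * fact (s - k))" using that by (rule binomial_fact)
        have 4: "real ((?N - k) choose r) = fact (?N - k) / (fact r * fact (?N - k - r))"
          by (rule binomial_fact) (use Suc that in simp)
        show ?thesis unfolding 1 2 3 4 by simp
      qed
      then have "(\<Sum>k\<le>s. (-1) ^ k * fact (l + m + 2 * s - k - 1) / (fact k * fact (s - k) * fact (l + m + s - k)))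
        = (\<Sum>k\<le>s. fact r / fact s * ((-1) ^ k * real (s choose k) * real ((?N - k) choose r)))"
        by (intro sum.cong) auto
      also have "\<dots> = fact r / fact s * (\<Sum>k\<le>s. (-1) ^ k * real (s choose k) * real ((?N - k) choose r))"
        by (simp only: sum_distrib_left)
      also have "\<dots> = 0"
        using alternating_binomial_sum_zero[of r s ?N] Suc by simp
      finally show ?thesis using Suc by simp
    qed
    finally show ?thesis using M by simp
  qed
  finally show ?thesis by simp
qed

section \<open>The Laplace-Beltrami operator on polynomials\<close>

lemma homog_normalize: "homog p f \<Longrightarrow> f x = norm x ^ p * f (sgn x)"
  using homogD[of p f "norm x" "sgn x"] by (cases "x = 0") (simp_all add: sgn_div_norm)

lemma homog_sgn: "homog p f \<Longrightarrow> x \<noteq> 0 \<Longrightarrow> f (sgn x) = f x / norm x ^ p"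
  using homog_normalize[of p f x] by simp

text \<open>Only the value on the sphere matters: \<open>f \<circ> sgn\<close> equals \<open>f / \<parallel>x\<parallel>\<^sup>p\<close>.\<close>

lemma sphere_deriv_homog:
  fixes f g :: "'a::euclidean_space \<Rightarrow> real"
  assumes "rpoly f" "homog p f" "norm x = 1" "\<And>y. norm y = 1 \<Longrightarrow> g y = f y"
  shows "sphere_deriv v g x = dird v f x - real p * (v \<bullet> x) * f x"
    and "((\<lambda>s. g (sgn (x + s *\<^sub>R v))) has_real_derivative (dird v f x - real p * (v \<bullet> x) * f x)) (at 0)"
proof -
  have x: "x \<noteq> 0" using assms(3) by auto
  have f': "((\<lambda>s. f (x + s *\<^sub>R v)) has_field_derivative dird v f x) (at 0)"
    using rpoly_line_derivative[OF assms(1), of x v 0] by simp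
  have "((\<lambda>s. norm (x + s *\<^sub>R v)) has_derivative (\<lambda>h. (h *\<^sub>R v) \<bullet> sgn (x + 0 *\<^sub>R v))) (at 0)"
    by (rule has_derivative_compose[of "\<lambda>s. x + s *\<^sub>R v" "\<lambda>h. h *\<^sub>R v" _ _ norm, OF _ has_derivative_norm])
       (use x in \<open>auto intro!: derivative_eq_intros\<close>)
  then have n': "((\<lambda>s. norm (x + s *\<^sub>R v)) has_field_derivative v \<bullet> x) (at 0)"
    using assms(3) by (simp add: has_field_derivative_def mult_commute_abs sgn_div_norm)
  have "((\<lambda>s. f (x + s *\<^sub>R v) / norm (x + s *\<^sub>R v) ^ p) has_field_derivative
      (dird v f x * norm x ^ p - f x * (real p * norm x ^ (p - 1) * (v \<bullet> x))) / (norm x ^ p * norm x ^ p)) (at 0)"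
    by (rule DERIV_cong[OF DERIV_divide[OF f' DERIV_power[OF n']]]) (use x in simp_all)
  then have q: "((\<lambda>s. f (x + s *\<^sub>R v) / norm (x + s *\<^sub>R v) ^ p) has_field_derivative
      (dird v f x - real p * (v \<bullet> x) * f x)) (at 0)"
    using assms(3) by (simp add: mult_ac)
  have "isCont (\<lambda>s::real. x + s *\<^sub>R v) 0" by (intro continuous_intros)
  then have "\<forall>\<^sub>F s in at 0. x + s *\<^sub>R v \<noteq> 0"
    unfolding isCont_def using x by (intro tendsto_imp_eventually_ne[of _ x]) auto
  then have "\<forall>\<^sub>F s in nhds 0. x + s *\<^sub>R v \<noteq> 0"
    using x by (auto simp: eventually_nhds_conv_at)
  then have ev: "\<forall>\<^sub>F s in nhds 0. g (sgn (x + s *\<^sub>R v)) = f (x + s *\<^sub>R v) / norm (x + s *\<^sub>R v) ^ p"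
    by eventually_elim (use assms(4) homog_sgn[OF assms(2)] in \<open>simp add: norm_sgn\<close>)
  show d: "((\<lambda>s. g (sgn (x + s *\<^sub>R v))) has_real_derivative (dird v f x - real p * (v \<bullet> x) * f x)) (at 0)"
    using q DERIV_cong_ev[OF refl ev refl] by blast
  show "sphere_deriv v g x = dird v f x - real p * (v \<bullet> x) * f x"
    unfolding sphere_deriv_def by (rule DERIV_imp_deriv[OF d])
qed

text \<open>On the sphere a component of the gradient is
  \<open>dird b H y - m (b \<bullet> y) H y\<close>. Its two parts are homogeneous of the different
  degrees \<open>m - 1\<close> and \<open>m + 1\<close>, so \<open>sphere_deriv_homog\<close> is
  applied to each separately; Euler's identity evaluates the sum over the basis.\<close>

lemma laplace_beltrami_homog:
  fixes H :: "'a::euclidean_space \<Rightarrow> real"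
  assumes "rpoly H" "homog m H" "norm x = 1"
  shows "laplace_beltrami H x = lap H x - real m * (real m + real DIM('a) - 2) * H x"
proof -
  have grad: "sphere_grad H y \<bullet> b = dird b H y - real m * (b \<bullet> y) * H y" if "norm y = 1" "b \<in> Basis" for y b
    unfolding sphere_grad_def
    using that sphere_deriv_homog(1)[OF assms(1,2) that(1), of H] by (simp add: inner_sum_left inner_Basis if_distrib cong: if_cong)
  have pb: "rpoly (\<lambda>y. (b \<bullet> y) * H y)" "homog (Suc m) (\<lambda>y. (b \<bullet> y) * H y)" for b
    using assms homog_mult[OF homog_inner_left(1) assms(2), of b] by (auto intro: rpoly_mult)
  have comp: "sphere_deriv b (\<lambda>y. sphere_grad H y \<bullet> b) x =
      dird b (dird b H) x - (real m - 1) * ((b \<bullet> x) * dird b H x)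
      - real m * ((b \<bullet> b) * H x + (b \<bullet> x) * dird b H x - (real m + 1) * ((b \<bullet> x) * (b \<bullet> x)) * H x)"
    if b: "b \<in> Basis" for b
  proof -
    define u where "u = (\<lambda>y. dird b H y)"
    have du: "((\<lambda>s. u (sgn (x + s *\<^sub>R b))) has_real_derivative
        (dird b (dird b H) x - (real m - 1) * ((b \<bullet> x) * dird b H x))) (at 0)"
    proof (cases m)
      \<comment> \<open>There is no degree \<open>m - 1\<close> here; the factor
        \<open>real m - 1\<close> multiplies a vanishing derivative.\<close>
      case 0
      then have "dird b H = (\<lambda>x. 0)" using dird_homog_0 assms(2) by blast
      then show ?thesis unfolding u_def by simp
    next
      case (Suc k)
      show ?thesis
        by (rule DERIV_cong[OF sphere_deriv_homog(2)[of "dird b H" k x u b]])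
          (use assms Suc rpoly_dird homog_dird in \<open>auto simp: u_def\<close>)
    qed
    have dv: "((\<lambda>s. (b \<bullet> sgn (x + s *\<^sub>R b)) * H (sgn (x + s *\<^sub>R b))) has_real_derivative
       ((b \<bullet> b) * H x + (b \<bullet> x) * dird b H x - (real m + 1) * ((b \<bullet> x) * (b \<bullet> x)) * H x)) (at 0)"
      by (rule DERIV_cong[OF sphere_deriv_homog(2)[OF pb assms(3), of "\<lambda>y. (b \<bullet> y) * H y" b b]])
        (rule refl, simp only: dird_mult[OF rpoly_inner_left assms(1)] dird_inner_left, simp add: algebra_simps)
    have "((\<lambda>s. u (sgn (x + s *\<^sub>R b)) - real m * ((b \<bullet> sgn (x + s *\<^sub>R b)) * H (sgn (x + s *\<^sub>R b)))) has_real_derivative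
       (dird b (dird b H) x - (real m - 1) * ((b \<bullet> x) * dird b H x)
      - real m * ((b \<bullet> b) * H x + (b \<bullet> x) * dird b H x - (real m + 1) * ((b \<bullet> x) * (b \<bullet> x)) * H x))) (at 0)"
      by (intro DERIV_diff du DERIV_cmult dv)
    moreover
    have "\<forall>\<^sub>F s in nhds 0. x + s *\<^sub>R b \<noteq> 0"
    proof -
      have x: "x \<noteq> 0" using assms(3) by auto
      have "isCont (\<lambda>s::real. x + s *\<^sub>R b) 0" by (intro continuous_intros)
      then have "\<forall>\<^sub>F s in at 0. x + s *\<^sub>R b \<noteq> 0"
        unfolding isCont_def using x by (intro tendsto_imp_eventually_ne[of _ x]) auto
      then show ?thesis using x by (auto simp: eventually_nhds_conv_at)
    qed
    then have ev: "\<forall>\<^sub>F s in nhds 0. sphere_grad H (sgn (x + s *\<^sub>R b)) \<bullet> b =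
        u (sgn (x + s *\<^sub>R b)) - real m * ((b \<bullet> sgn (x + s *\<^sub>R b)) * H (sgn (x + s *\<^sub>R b)))"
      by eventually_elim (use grad b in \<open>simp add: norm_sgn u_def\<close>)
    ultimately have "((\<lambda>s. sphere_grad H (sgn (x + s *\<^sub>R b)) \<bullet> b) has_real_derivative
       (dird b (dird b H) x - (real m - 1) * ((b \<bullet> x) * dird b H x)
      - real m * ((b \<bullet> b) * H x + (b \<bullet> x) * dird b H x - (real m + 1) * ((b \<bullet> x) * (b \<bullet> x)) * H x))) (at 0)"
      by (intro DERIV_cong_ev[OF refl ev refl, THEN iffD2])
    then show ?thesis unfolding sphere_deriv_def by (rule DERIV_imp_deriv)
  qed
  have e1: "(\<Sum>b\<in>Basis. (b \<bullet> x) * dird b H x) = real m * H x"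
    using dird_euclidean[OF assms(1), of x x] euler_homog[OF assms(1,2), of x] by (simp add: inner_commute)
  have e2: "(\<Sum>b\<in>Basis. (b \<bullet> x) * (b \<bullet> x)) = 1"
    using euclidean_inner[of x x] assms(3) by (simp add: inner_commute norm_eq_1)
  have e3: "(\<Sum>b\<in>(Basis::'a set). b \<bullet> b) = real DIM('a)" by simp
  have "laplace_beltrami H x = (\<Sum>b\<in>Basis. dird b (dird b H) x - (real m - 1) * ((b \<bullet> x) * dird b H x)
      - real m * ((b \<bullet> b) * H x + (b \<bullet> x) * dird b H x - (real m + 1) * ((b \<bullet> x) * (b \<bullet> x)) * H x))"
    unfolding laplace_beltrami_def sphere_div_def by (intro sum.cong refl comp)
  also have "\<dots> = lap H x - (real m - 1) * (\<Sum>b\<in>Basis. (b \<bullet> x) * dird b H x)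
     - real m * ((\<Sum>b\<in>(Basis::'a set). b \<bullet> b) * H x + (\<Sum>b\<in>Basis. (b \<bullet> x) * dird b H x)
        - (real m + 1) * (\<Sum>b\<in>Basis. (b \<bullet> x) * (b \<bullet> x)) * H x)"
    unfolding lap_def sum_subtractf sum.distrib sum_distrib_left[symmetric] sum_distrib_right[symmetric] ..
  also have "\<dots> = lap H x - real m * (real m + real DIM('a) - 2) * H x"
    unfolding e1 e2 e3 by (simp add: algebra_simps)
  finally show ?thesis .
qed

section \<open>Smoothness of polynomials on the sphere\<close>

lemma Ck_on_cong:
  assumes "open U" "\<And>x. x \<in> U \<Longrightarrow> f x = g x" "Ck_on k U f"
  shows "Ck_on k U g"
  using assms(2,3)
proof (induction k arbitrary: f g)
  case 0
  then show ?case using continuous_on_cong[of U U f g] by simp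
next
  case (Suc k)
  have d: "(g has_derivative frechet_derivative f (at x)) (at x)" if "x \<in> U" for x
  proof (rule has_derivative_transform_within_open[OF _ assms(1) that])
    show "(f has_derivative frechet_derivative f (at x)) (at x)"
      using Suc.prems(2) that frechet_derivative_works by (subst (asm) Ck_on.simps(2)) blast
  qed (rule Suc.prems(1))
  have "frechet_derivative f (at x) v = frechet_derivative g (at x) v" if "x \<in> U" for x v
    by (rule fun_cong[OF frechet_derivative_at[OF d[OF that]]])
  then have "Ck_on k U (\<lambda>x. frechet_derivative g (at x) v)" for v
    using Suc.IH[of "\<lambda>x. frechet_derivative f (at x) v" "\<lambda>x. frechet_derivative g (at x) v"] Suc.prems(2) by simp
  then show ?case using d by (auto simp: differentiable_def)
qed

text \<open>Lets the derivative be supplied by any formula valid on \<open>U\<close>; by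
  \<open>Ck_on_cong\<close> the values of \<open>frechet_derivative\<close> outside \<open>U\<close>
  have no influence.\<close>

lemma Ck_on_SucI:
  assumes "open U" "\<And>x. x \<in> U \<Longrightarrow> (f has_derivative (\<lambda>v. f' v x)) (at x)" "\<And>v. Ck_on k U (f' v)"
  shows "Ck_on (Suc k) U f"
proof -
  have "f' v x = frechet_derivative f (at x) v" if "x \<in> U" for v x
    using frechet_derivative_at[OF assms(2)[OF that]] by metis
  then have "Ck_on k U (\<lambda>x. frechet_derivative f (at x) v)" for v
    by (intro Ck_on_cong[OF assms(1) _ assms(3)[of v]])
  then show ?thesis using assms(2) by (auto simp: differentiable_def)
qed

lemma Ck_on_Suc_imp: "Ck_on (Suc k) U f \<Longrightarrow> Ck_on k U f"
proof (induction k arbitrary: f)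
  case 0
  then have "\<forall>x\<in>U. f differentiable at x" by (subst (asm) Ck_on.simps(2)) blast
  then have "continuous_on U f"
    by (meson continuous_at_imp_continuous_on differentiable_imp_continuous_within)
  then show ?case by (simp only: Ck_on.simps)
next
  case (Suc k)
  show ?case
    unfolding Ck_on.simps(2)
  proof (intro conjI allI)
    show "\<forall>x\<in>U. f differentiable at x" using Suc.prems by (subst (asm) Ck_on.simps(2)) blast
    show "Ck_on k U (\<lambda>x. frechet_derivative f (at x) v)" for v
      using Suc.prems by (intro Suc.IH) (subst (asm) Ck_on.simps(2), blast)
  qed
qed

lemma Ck_on_SucD:
  "Ck_on (Suc k) U f \<Longrightarrow> x \<in> U \<Longrightarrow> (f has_derivative (\<lambda>v. frechet_derivative f (at x) v)) (at x)"
  "Ck_on (Suc k) U f \<Longrightarrow> Ck_on k U (\<lambda>x. frechet_derivative f (at x) v)"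
  using frechet_derivative_works[of f "at x"] by auto

lemma Ck_on_const: "open U \<Longrightarrow> Ck_on k U (\<lambda>x. c)"
proof (induction k arbitrary: c)
  case (Suc k)
  show ?case by (rule Ck_on_SucI[where f'="\<lambda>v x. 0"]) (use Suc in auto)
qed auto

lemma Ck_on_linear:
  assumes "open U" "bounded_linear f" shows "Ck_on k U f"
proof (cases k)
  case 0
  then show ?thesis by (simp add: linear_continuous_on assms(2))
next
  case (Suc j)
  show ?thesis unfolding Suc
    by (rule Ck_on_SucI[where f'="\<lambda>v x. f v"])
      (use assms in \<open>auto intro: bounded_linear_imp_has_derivative Ck_on_const\<close>)
qed

lemma Ck_on_add:
  assumes "open U" shows "Ck_on k U f \<Longrightarrow> Ck_on k U g \<Longrightarrow> Ck_on k U (\<lambda>x. f x + g x)"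
proof (induction k arbitrary: f g)
  case (Suc k)
  show ?case
    by (rule Ck_on_SucI[where f'="\<lambda>v x. frechet_derivative f (at x) v + frechet_derivative g (at x) v"])
      (use assms Suc Ck_on_SucD in \<open>blast intro: has_derivative_add\<close>)+
qed (auto intro: continuous_on_add)

lemma Ck_on_mult:
  assumes "open U" shows "Ck_on k U f \<Longrightarrow> Ck_on k U g \<Longrightarrow> Ck_on k U (\<lambda>x. f x * g x)"
proof (induction k arbitrary: f g)
  case (Suc k)
  show ?case
  proof (rule Ck_on_SucI[where f'="\<lambda>v x. f x * frechet_derivative g (at x) v + frechet_derivative f (at x) v * g x"])
    fix x assume "x \<in> U"
    then show "((\<lambda>x. f x * g x) has_derivative
        (\<lambda>v. f x * frechet_derivative g (at x) v + frechet_derivative f (at x) v * g x)) (at x)"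
      using Ck_on_SucD(1) Suc.prems by (intro has_derivative_mult) auto
  next
    fix v
    show "Ck_on k U (\<lambda>x. f x * frechet_derivative g (at x) v + frechet_derivative f (at x) v * g x)"
      by (rule Ck_on_add[OF assms Suc.IH[OF Ck_on_Suc_imp[OF Suc.prems(1)] Ck_on_SucD(2)[OF Suc.prems(2)]]
          Suc.IH[OF Ck_on_SucD(2)[OF Suc.prems(1)] Ck_on_Suc_imp[OF Suc.prems(2)]]])
  qed (rule assms)
qed (simp add: continuous_on_mult)

text \<open>The derivative is a product of a linear form and powers of the function itself, so the
  induction on \<open>k\<close> closes under \<open>Ck_on_mult\<close>.\<close>

lemma Ck_on_inverse_norm: "Ck_on k (- {0}) (\<lambda>x::'a::euclidean_space. inverse (norm x))"
proof (induction k)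
  case 0
  show ?case by (auto intro!: continuous_intros)
next
  case (Suc k)
  let ?g = "\<lambda>x::'a. inverse (norm x)"
  have o: "open (- {0::'a})" by auto
  show ?case
  proof (rule Ck_on_SucI[OF o, where f'="\<lambda>v x. - 1 * ((v \<bullet> x) * (?g x * (?g x * ?g x)))"])
    fix x :: 'a assume x: "x \<in> - {0}"
    then have "((\<lambda>x. inverse (norm x)) has_derivative (\<lambda>v. - (inverse (norm x) * (v \<bullet> sgn x) * inverse (norm x)))) (at x)"
      by (intro Deriv.has_derivative_inverse has_derivative_norm) auto
    also have "(\<lambda>v. - (inverse (norm x) * (v \<bullet> sgn x) * inverse (norm x))) = (\<lambda>v. - 1 * ((v \<bullet> x) * (?g x * (?g x * ?g x))))"
      by (auto simp: fun_eq_iff sgn_div_norm)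
    finally show "((\<lambda>x. inverse (norm x)) has_derivative (\<lambda>v. - 1 * ((v \<bullet> x) * (?g x * (?g x * ?g x))))) (at x)" .
  next
    fix v :: 'a
    show "Ck_on k (- {0}) (\<lambda>x. - 1 * ((v \<bullet> x) * (?g x * (?g x * ?g x))))"
      by (intro Ck_on_mult o Ck_on_const Suc Ck_on_linear bounded_linear_inner_right)
  qed
qed

text \<open>Composition with \<open>sgn\<close> turns a linear form \<open>f\<close> into
  \<open>inverse (norm x) * f x\<close> and respects sums and products.\<close>

lemma rpoly_smooth_on_sphere:
  fixes f :: "'a::euclidean_space \<Rightarrow> real"
  assumes "rpoly f" shows "smooth_on_sphere f"
  unfolding smooth_on_sphere_def
proof
  fix k
  have o: "open (- {0::'a})" by auto
  show "Ck_on k (- {0}) (f \<circ> sgn)"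
    using assms
  proof (induction rule: real_polynomial_function.induct)
    case (linear f)
    have "Ck_on k (- {0}) (\<lambda>x. inverse (norm x) * f x)"
      by (intro Ck_on_mult o Ck_on_inverse_norm Ck_on_linear linear)
    moreover have "(\<lambda>x. inverse (norm x) * f x) = f \<circ> sgn"
      using bounded_linear.linear[OF linear] by (auto simp: fun_eq_iff sgn_div_norm linear_cmul)
    ultimately show ?case by (simp only:)
  qed (auto simp: o_def intro!: Ck_on_add Ck_on_mult Ck_on_const)
qed

section \<open>Eigenfunctions of strongly continuous semigroups\<close>

lemma C0_semigroup_onD:
  assumes "C0_semigroup_on S P"
  shows "\<And>t f. t \<ge> 0 \<Longrightarrow> continuous_on S f \<Longrightarrow> continuous_on S (P t f)"
    and "\<And>t f g a b x. t \<ge> 0 \<Longrightarrow> continuous_on S f \<Longrightarrow> continuous_on S g \<Longrightarrow> x \<in> S \<Longrightarrow>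
        P t (\<lambda>y. a * f y + b * g y) x = a * P t f x + b * P t g x"
    and "\<And>t. t \<ge> 0 \<Longrightarrow> \<exists>M. \<forall>f B. continuous_on S f \<longrightarrow> (\<forall>x\<in>S. \<bar>f x\<bar> \<le> B) \<longrightarrow> (\<forall>x\<in>S. \<bar>P t f x\<bar> \<le> M * B)"
    and "\<And>f x. continuous_on S f \<Longrightarrow> x \<in> S \<Longrightarrow> P 0 f x = f x"
    and "\<And>s t f x. s \<ge> 0 \<Longrightarrow> t \<ge> 0 \<Longrightarrow> continuous_on S f \<Longrightarrow> x \<in> S \<Longrightarrow> P (s + t) f x = P s (P t f) x"
    and "\<And>f. continuous_on S f \<Longrightarrow> uniform_limit S (\<lambda>t. P t f) f (at_right 0)"
proof -
  note D = assms[unfolded C0_semigroup_on_def]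
  note D2 = D[THEN conjunct2] and D3 = D[THEN conjunct2, THEN conjunct2]
    and D4 = D[THEN conjunct2, THEN conjunct2, THEN conjunct2]
  show "\<And>t f. t \<ge> 0 \<Longrightarrow> continuous_on S f \<Longrightarrow> continuous_on S (P t f)"
    using D[THEN conjunct1] by blast
  show "\<And>t f g a b x. t \<ge> 0 \<Longrightarrow> continuous_on S f \<Longrightarrow> continuous_on S g \<Longrightarrow> x \<in> S \<Longrightarrow>
        P t (\<lambda>y. a * f y + b * g y) x = a * P t f x + b * P t g x"
    using D2[THEN conjunct1] by blast
  show "\<And>t. t \<ge> 0 \<Longrightarrow> \<exists>M. \<forall>f B. continuous_on S f \<longrightarrow> (\<forall>x\<in>S. \<bar>f x\<bar> \<le> B) \<longrightarrow> (\<forall>x\<in>S. \<bar>P t f x\<bar> \<le> M * B)"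
    using D3[THEN conjunct1] by simp
  show "\<And>f x. continuous_on S f \<Longrightarrow> x \<in> S \<Longrightarrow> P 0 f x = f x"
    using D4[THEN conjunct1] by blast
  show "\<And>s t f x. s \<ge> 0 \<Longrightarrow> t \<ge> 0 \<Longrightarrow> continuous_on S f \<Longrightarrow> x \<in> S \<Longrightarrow> P (s + t) f x = P s (P t f) x"
    using D4[THEN conjunct2, THEN conjunct1] by blast
  show "\<And>f. continuous_on S f \<Longrightarrow> uniform_limit S (\<lambda>t. P t f) f (at_right 0)"
    using D4[THEN conjunct2, THEN conjunct2] by blast
qed

lemma C0_semigroup_scale:
  assumes "C0_semigroup_on S P" "t \<ge> 0" "continuous_on S f" "x \<in> S"
  shows "P t (\<lambda>y. a * f y) x = a * P t f x"
  using C0_semigroup_onD(2)[OF assms(1,2,3,3,4), of a 0] by simp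

text \<open>Boundedness of \<open>P t\<close>, applied to \<open>f - g\<close> with the bound 0:
  values off \<open>S\<close> do not influence \<open>P t f\<close> on \<open>S\<close>.\<close>

lemma C0_semigroup_cong:
  assumes P: "C0_semigroup_on S P" "t \<ge> 0" and f: "continuous_on S f" "continuous_on S g"
    and eq: "\<And>y. y \<in> S \<Longrightarrow> f y = g y" and x: "x \<in> S"
  shows "P t f x = P t g x"
proof -
  obtain M where M: "\<And>f B. continuous_on S f \<Longrightarrow> (\<forall>x\<in>S. \<bar>f x\<bar> \<le> B) \<Longrightarrow> (\<forall>x\<in>S. \<bar>P t f x\<bar> \<le> M * B)"
    using C0_semigroup_onD(3)[OF P] by blast
  have "continuous_on S (\<lambda>y. 1 * f y + (-1) * g y)" by (intro continuous_intros f)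
  from M[OF this, of 0] have "P t (\<lambda>y. 1 * f y + (-1) * g y) x = 0" using eq x by auto
  then show ?thesis using C0_semigroup_onD(2)[OF P f x, of 1 "-1"] by simp
qed

text \<open>The uniform boundedness principle, by Sokal's gliding hump: the limit of
  \<open>g (Suc n) = g n \<plusminus> 3 ^ (- n) f n\<close> has an unbounded orbit.\<close>

lemma C0_semigroup_locally_bounded:
  fixes P :: "real \<Rightarrow> ('a::topological_space \<Rightarrow> real) \<Rightarrow> 'a \<Rightarrow> real"
  assumes P: "C0_semigroup_on S P" and S: "compact S"
  obtains \<delta> M where "\<delta> > 0"
    "\<And>t f B x. 0 \<le> t \<Longrightarrow> t \<le> \<delta> \<Longrightarrow> continuous_on S f \<Longrightarrow> (\<And>y. y \<in> S \<Longrightarrow> \<bar>f y\<bar> \<le> B) \<Longrightarrow> x \<in> S \<Longrightarrow>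
       \<bar>P t f x\<bar> \<le> M * B"
proof (rule ccontr)
  assume neg: "\<not> thesis"
  define V where "V t = {\<bar>P t f x\<bar> |f x. continuous_on S f \<and> (\<forall>y\<in>S. \<bar>f y\<bar> \<le> 1) \<and> x \<in> S}" for t
  \<comment> \<open>The operator norm of \<open>P t\<close> on the continuous functions on
    \<open>S\<close>. It is finite for each \<open>t\<close> separately; what has to be shown is
    boundedness near 0.\<close>
  define N where "N t = Sup (V t)" for t
  have bdd: "bdd_above (V t)" if t: "t \<ge> 0" for t
  proof -
    obtain M where M: "\<forall>f B. continuous_on S f \<longrightarrow> (\<forall>x\<in>S. \<bar>f x\<bar> \<le> B) \<longrightarrow> (\<forall>x\<in>S. \<bar>P t f x\<bar> \<le> M * B)"
      using C0_semigroup_onD(3)[OF P t] by blast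
    have "v \<le> M * 1" if "v \<in> V t" for v
      using that M unfolding V_def by blast
    then show ?thesis by (rule bdd_aboveI)
  qed
  have N1: "\<bar>P t f x\<bar> \<le> N t" if "t \<ge> 0" "continuous_on S f" "\<And>y. y \<in> S \<Longrightarrow> \<bar>f y\<bar> \<le> 1" "x \<in> S" for t f x
    unfolding N_def by (rule cSup_upper[OF _ bdd[OF that(1)]]) (use that in \<open>auto simp: V_def\<close>)
  have N: "\<bar>P t f x\<bar> \<le> N t * B" if t: "t \<ge> 0" and f: "continuous_on S f" and B: "\<And>y. y \<in> S \<Longrightarrow> \<bar>f y\<bar> \<le> B" and x: "x \<in> S" for t f B x
  proof (cases "B = 0")
    case True
    obtain M where "\<forall>f B. continuous_on S f \<longrightarrow> (\<forall>x\<in>S. \<bar>f x\<bar> \<le> B) \<longrightarrow> (\<forall>x\<in>S. \<bar>P t f x\<bar> \<le> M * B)"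
      using C0_semigroup_onD(3)[OF P t] by blast
    then have "\<bar>P t f x\<bar> \<le> M * B" using f B x by blast
    then show ?thesis using True by simp
  next
    case False
    then have B0: "B > 0" using B[OF x] by linarith
    have "\<bar>P t (\<lambda>y. inverse B * f y) x\<bar> \<le> N t"
      by (rule N1[OF t _ _ x]) (use f B B0 in \<open>auto intro!: continuous_intros simp: abs_mult field_simps\<close>)
    then show ?thesis
      using B0 unfolding C0_semigroup_scale[OF P t f x] by (simp add: abs_mult field_simps)
  qed
  \<comment> \<open>If the claim fails for \<open>\<delta> = 1 / (n + 1)\<close> and
    \<open>M = 4 ^ n\<close>, some positive time below \<open>\<delta>\<close> has norm above
    \<open>4 ^ n\<close>. The growth rate 4 has to beat the weights \<open>(1/3) ^ n\<close> used
    below.\<close>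
  have "\<exists>t>0. t \<le> inverse (real (Suc n)) \<and> N t > 4 ^ n" for n
  proof (rule ccontr)
    assume a: "\<not> ?thesis"
    have "\<bar>P t f x\<bar> \<le> 4 ^ n * B" if "0 \<le> t" "t \<le> inverse (real (Suc n))" "continuous_on S f"
      "\<And>y. y \<in> S \<Longrightarrow> \<bar>f y\<bar> \<le> B" "x \<in> S" for t f B x
    proof -
      have B0: "B \<ge> 0" using that(4)[OF that(5)] by linarith
      show ?thesis
      proof (cases "t = 0")
        case True
        have "(1::real) * B \<le> 4 ^ n * B" using B0 by (intro mult_right_mono) auto
        then show ?thesis using True C0_semigroup_onD(4)[OF P that(3,5)] that(4)[OF that(5)] by simp
      next
        case False
        then have "N t \<le> 4 ^ n" using a that by (metis not_le order_le_imp_less_or_eq)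
        then show ?thesis using N[OF that(1,3,4,5)] mult_right_mono[OF _ B0, of "N t" "4 ^ n"] by linarith
      qed
    qed
    then show False using neg that[of "inverse (real (Suc n))" "4 ^ n"] by simp
  qed
  then obtain t where t: "\<And>n. t n > 0" "\<And>n. t n \<le> inverse (real (Suc n))" "\<And>n. N (t n) > 4 ^ n"
    by metis
  have "\<exists>f x. continuous_on S f \<and> (\<forall>y\<in>S. \<bar>f y\<bar> \<le> 1) \<and> x \<in> S \<and> \<bar>P (t n) f x\<bar> > 2 / 3 * N (t n)" for n
  proof -
    have "N (t n) > 0" using t(3)[of n] by (meson less_trans zero_less_numeral zero_less_power)
    moreover have "V (t n) \<noteq> {}"
    proof
      assume "V (t n) = {}"
      moreover have "\<bar>P (t n) (\<lambda>_. 0) y\<bar> \<in> V (t n)" if "y \<in> S" for y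
        unfolding V_def using that by (intro CollectI exI[of _ "\<lambda>_. 0"] exI[of _ y]) auto
      ultimately have "S = {}" by auto
      then show False using neg that[of 1 0] by auto
    qed
    ultimately obtain v where "v \<in> V (t n)" "2 / 3 * N (t n) < v"
      using less_cSup_iff[OF _ bdd[OF less_imp_le[OF t(1)]], of n "2 / 3 * N (t n)"] unfolding N_def by auto
    then show ?thesis unfolding V_def by blast
  qed
  then obtain f x where f: "\<And>n. continuous_on S (f n)" "\<And>n y. y \<in> S \<Longrightarrow> \<bar>f n y\<bar> \<le> 1"
    and x: "\<And>n. x n \<in> S" and big: "\<And>n. \<bar>P (t n) (f n) (x n)\<bar> > 2 / 3 * N (t n)"
    by metis
  have t0: "t n \<ge> 0" for n using t(1)[of n] by simp
  define Q where "Q n g g' \<longleftrightarrow> (\<forall>y\<in>S. \<bar>g' y - g y\<bar> \<le> (1/3) ^ n) \<and>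
      \<bar>P (t n) g' (x n)\<bar> \<ge> (1/3) ^ n * \<bar>P (t n) (f n) (x n)\<bar>" for n and g g' :: "'a \<Rightarrow> real"
  have "\<exists>g. \<forall>n. continuous_on S (g n) \<and> Q n (g n) (g (Suc n))"
  proof (rule dependent_nat_choice)
    show "\<exists>g. continuous_on S (g :: 'a \<Rightarrow> real)" using f(1) by blast
    fix g :: "'a \<Rightarrow> real" and n assume g: "continuous_on S g"
    let ?e = "(1/3::real) ^ n"
    have lin: "P (t n) (\<lambda>y. 1 * g y + s * f n y) (x n) = 1 * P (t n) g (x n) + s * P (t n) (f n) (x n)" for s
      by (rule C0_semigroup_onD(2)[OF P t0 g f(1) x])
    \<comment> \<open>Of \<open>a + b\<close> and \<open>a - b\<close> at least one has modulus at
      least that of \<open>b\<close>; hence nothing has to be known about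
      \<open>P (t n) g\<close>.\<close>
    have "\<bar>P (t n) g (x n) + ?e * P (t n) (f n) (x n)\<bar> \<ge> ?e * \<bar>P (t n) (f n) (x n)\<bar> \<or>
       \<bar>P (t n) g (x n) + (- ?e) * P (t n) (f n) (x n)\<bar> \<ge> ?e * \<bar>P (t n) (f n) (x n)\<bar>"
    proof -
      have "?e * \<bar>P (t n) (f n) (x n)\<bar> = \<bar>?e * P (t n) (f n) (x n)\<bar>" by (simp add: abs_mult)
      moreover have "\<bar>b\<bar> \<le> \<bar>a + b\<bar> \<or> \<bar>b\<bar> \<le> \<bar>a - b\<bar>" for a b :: real by linarith
      ultimately show ?thesis by (metis minus_mult_left add_uminus_conv_diff)
    qed
    then obtain s where s: "\<bar>s\<bar> = ?e" "\<bar>P (t n) g (x n) + s * P (t n) (f n) (x n)\<bar> \<ge> ?e * \<bar>P (t n) (f n) (x n)\<bar>"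
      by (metis abs_minus_cancel abs_of_nonneg zero_le_power zero_le_divide_1_iff zero_le_numeral)
    have "Q n g (\<lambda>y. 1 * g y + s * f n y)"
      unfolding Q_def lin using s f(2)[of _ n] by (auto simp: abs_mult mult_left_le)
    moreover have "continuous_on S (\<lambda>y. 1 * g y + s * f n y)" by (intro continuous_intros g f)
    ultimately show "\<exists>g'. continuous_on S g' \<and> Q n g g'" by blast
  qed
  then obtain g where g: "\<And>n. continuous_on S (g n)" and Q: "\<And>n. Q n (g n) (g (Suc n))" by blast
  have step: "\<bar>g (Suc n) y - g n y\<bar> \<le> (1/3) ^ n" if "y \<in> S" for n y using Q that unfolding Q_def by blast
  define G where "G y = g 0 y + (\<Sum>n. g (Suc n) y - g n y)" for y
  have "uniform_limit S (\<lambda>n y. \<Sum>i<n. g (Suc i) y - g i y) (\<lambda>y. \<Sum>i. g (Suc i) y - g i y) sequentially"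
    by (rule Weierstrass_m_test[where M="\<lambda>n. (1/3) ^ n"]) (use step in \<open>auto intro: summable_geometric\<close>)
  then have "uniform_limit S (\<lambda>n y. g 0 y + (\<Sum>i<n. g (Suc i) y - g i y)) G sequentially"
    unfolding G_def by (intro uniform_limit_intros)
  moreover have "(\<Sum>i<n. g (Suc i) y - g i y) = g n y - g 0 y" for n y by (rule sum_lessThan_telescope)
  ultimately have lim: "uniform_limit S g G sequentially" by simp
  have G: "continuous_on S G"
    by (rule uniform_limit_theorem[OF always_eventually[OF allI[OF g]] lim]) simp
  \<comment> \<open>The increments from index \<open>Suc n\<close> on sum to at most
    \<open>(1/3) ^ Suc n / (1 - 1/3)\<close>.\<close>
  have tail: "\<bar>G y - g (Suc n) y\<bar> \<le> (1/3) ^ n / 2" if y: "y \<in> S" for y n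
  proof -
    have "\<bar>g (k + Suc n) y - g (Suc n) y\<bar> \<le> (1/3) ^ n / 2 * (1 - (1/3) ^ k)" for k
    proof (induction k)
      case (Suc k)
      have "\<bar>g (Suc k + Suc n) y - g (Suc n) y\<bar> \<le> \<bar>g (Suc (k + Suc n)) y - g (k + Suc n) y\<bar> + \<bar>g (k + Suc n) y - g (Suc n) y\<bar>"
        by simp
      also have "\<dots> \<le> (1/3) ^ (k + Suc n) + (1/3) ^ n / 2 * (1 - (1/3) ^ k)" using step[OF y] Suc by (intro add_mono)
      also have "\<dots> = (1/3) ^ n / 2 * (1 - (1/3) ^ Suc k)" by (simp add: power_add field_simps)
      finally show ?case .
    qed simp
    also have "(1/3) ^ n / 2 * (1 - (1/3) ^ k) \<le> (1/3) ^ n / (2::real)" for k by (simp add: mult_left_le)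
    finally have "\<bar>g (k + Suc n) y - g (Suc n) y\<bar> \<le> (1/3) ^ n / 2" for k .
    moreover have "(\<lambda>k. \<bar>g (k + Suc n) y - g (Suc n) y\<bar>) \<longlonglongrightarrow> \<bar>G y - g (Suc n) y\<bar>"
      using LIMSEQ_ignore_initial_segment[OF tendsto_uniform_limitI[OF lim y], of "Suc n"] by (intro tendsto_intros)
    ultimately show ?thesis by (rule_tac LIMSEQ_le_const2) auto
  qed
  \<comment> \<open>The gain \<open>2/3 * (1/3) ^ n * N (t n)\<close> exceeds the loss
    \<open>1/2 * (1/3) ^ n * N (t n)\<close> caused by the tail; the difference, with
    \<open>N (t n) > 4 ^ n\<close>, gives the bound.\<close>
  have low: "\<bar>P (t n) G (x n)\<bar> \<ge> (4/3) ^ n / 6" for n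
  proof -
    have "\<bar>P (t n) (\<lambda>y. 1 * G y + (-1) * g (Suc n) y) (x n)\<bar> \<le> N (t n) * ((1/3) ^ n / 2)"
      by (rule N[OF t0 _ _ x]) (use tail in \<open>auto intro!: continuous_intros G g\<close>)
    then have "\<bar>P (t n) G (x n) - P (t n) (g (Suc n)) (x n)\<bar> \<le> N (t n) * ((1/3) ^ n / 2)"
      unfolding C0_semigroup_onD(2)[OF P t0 G g x] by simp
    moreover have "\<bar>P (t n) (g (Suc n)) (x n)\<bar> \<ge> (1/3) ^ n * (2 / 3 * N (t n))"
    proof -
      have "(1/3) ^ n * (2 / 3 * N (t n)) \<le> (1/3) ^ n * \<bar>P (t n) (f n) (x n)\<bar>"
        using big[of n] by (intro mult_left_mono) auto
      then show ?thesis using Q[of n] unfolding Q_def by linarith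
    qed
    moreover have "(1/3) ^ n * (2 / 3 * N (t n)) - N (t n) * ((1/3) ^ n / 2) = (1/3) ^ n * N (t n) / 6"
      by (simp add: field_simps)
    moreover have "(1/3) ^ n * 4 ^ n \<le> (1/3) ^ n * N (t n)" using t(3)[of n] by (intro mult_left_mono) auto
    moreover have "(1/3::real) ^ n * 4 ^ n = (4/3) ^ n" by (simp add: power_mult_distrib[symmetric])
    ultimately show ?thesis by linarith
  qed
  \<comment> \<open>The growth in \<open>low\<close> contradicts strong continuity at 0, which
    eventually keeps \<open>P (t n) G\<close> within distance 1 of the bounded function
    \<open>G\<close>.\<close>
  obtain B where B: "\<And>y. y \<in> S \<Longrightarrow> \<bar>G y\<bar> \<le> B"
    using compact_imp_bounded[OF compact_continuous_image[OF G S]] unfolding bounded_iff by auto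
  have "filterlim t (at_right 0) sequentially"
    unfolding filterlim_at
  proof
    show "t \<longlonglongrightarrow> 0"
      by (rule tendsto_sandwich[OF _ _ tendsto_const LIMSEQ_inverse_real_of_nat])
        (use t0 t(2) in \<open>auto intro: always_eventually\<close>)
    show "\<forall>\<^sub>F n in sequentially. t n \<in> {0<..} \<and> t n \<noteq> 0"
      by (rule always_eventually) (use t(1) in \<open>auto simp: less_imp_neq[symmetric]\<close>)
  qed
  moreover have "\<forall>\<^sub>F h in at_right 0. \<forall>y\<in>S. dist (P h G y) (G y) < 1"
    using C0_semigroup_onD(6)[OF P G] zero_less_one unfolding uniform_limit_iff by blast
  ultimately have "\<forall>\<^sub>F n in sequentially. \<forall>y\<in>S. dist (P (t n) G y) (G y) < 1"
    unfolding filterlim_iff by blast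
  moreover
  obtain m where m: "6 * (B + 1) < (4/3) ^ m" using real_arch_pow[of "4/3" "6 * (B + 1)"] by auto
  have "\<forall>\<^sub>F n in sequentially. (4/3::real) ^ n \<ge> 6 * (B + 1)"
    using eventually_ge_at_top[of m]
  proof eventually_elim
    case (elim n)
    then have "(4/3::real) ^ m \<le> (4/3) ^ n" by (rule power_increasing) simp
    then show ?case using m by linarith
  qed
  ultimately have "\<forall>\<^sub>F n in sequentially. False"
  proof eventually_elim
    case (elim n)
    then have "\<bar>P (t n) G (x n)\<bar> < B + 1" using B[OF x[of n]] x[of n] by (force simp: dist_real_def)
    with low[of n] have "(4/3) ^ n / 6 < B + 1" by (rule le_less_trans)
    then have "(4/3) ^ n < (B + 1) * 6" unfolding pos_divide_less_eq[OF zero_less_numeral] .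
    then show ?case using elim(2) by (simp only: mult.commute[of 6] not_le[symmetric] simp_thms)
  qed
  then show False by simp
qed

text \<open>For small \<open>h\<close> the functions \<open>P h f\<close> and
  \<open>exp (- \<mu> * h) * f\<close> differ by at most \<open>e * h\<close> on all of
  \<open>S\<close>, since both difference quotients converge uniformly to the same limit.
  Accumulating this over \<open>t / h\<close> steps leaves an error proportional to
  \<open>e\<close>. The local bound on \<open>P\<close> controls the accumulation up to time
  \<open>\<delta>\<close>; the semigroup law extends the result to all times.\<close>

lemma C0_semigroup_eigenfunction:
  assumes P: "C0_semigroup_on S P" and S: "compact S" and f: "continuous_on S f"
    and gen: "in_generator S P f g" and eig: "\<And>y. y \<in> S \<Longrightarrow> g y = - \<mu> * f y"
    and t: "t \<ge> 0" and x: "x \<in> S"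
  shows "P t f x = exp (- \<mu> * t) * f x"
proof -
  obtain \<delta> M where \<delta>: "\<delta> > 0" and M: "\<And>t f B x. 0 \<le> t \<Longrightarrow> t \<le> \<delta> \<Longrightarrow> continuous_on S f \<Longrightarrow>
      (\<And>y. y \<in> S \<Longrightarrow> \<bar>f y\<bar> \<le> B) \<Longrightarrow> x \<in> S \<Longrightarrow> \<bar>P t f x\<bar> \<le> M * B"
    using C0_semigroup_locally_bounded[OF P S] by metis
  obtain B where B: "\<And>y. y \<in> S \<Longrightarrow> \<bar>f y\<bar> \<le> B"
    using compact_imp_bounded[OF compact_continuous_image[OF f S]] unfolding bounded_iff by auto
  have M1: "M \<ge> 0"
    using M[of 0 "\<lambda>_. 1" 1 x] x \<delta> by (auto intro: order_trans[OF abs_ge_zero])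
  have small: "P t f x = exp (- \<mu> * t) * f x" if t: "0 \<le> t" "t \<le> \<delta>" and x: "x \<in> S" for t x
  proof (cases "t = 0")
    case True
    then show ?thesis using C0_semigroup_onD(4)[OF P f x] by simp
  next
    case False
    then have t0: "t > 0" using t by simp
    \<comment> \<open>An upper bound for \<open>exp (\<mu> * s)\<close> over all \<open>s\<close> in
      \<open>{0..\<delta>}\<close>.\<close>
    define E where "E = exp (\<bar>\<mu>\<bar> * \<delta>)"
    have bound: "\<bar>exp (\<mu> * t) * P t f x - f x\<bar> \<le> e * (t * E * M)" if e: "e > 0" for e
    proof -
      have "((\<lambda>h::real. (exp (- \<mu> * h) - 1) / h) \<longlongrightarrow> - \<mu>) (at_right 0)"
      proof -
        have "((\<lambda>h::real. exp (- \<mu> * h)) has_real_derivative - \<mu>) (at 0)"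
          by (auto intro!: derivative_eq_intros)
        then show ?thesis unfolding DERIV_def by (simp add: filterlim_at_split)
      qed
      then have "uniform_limit S (\<lambda>h y. (exp (- \<mu> * h) - 1) / h * f y) (\<lambda>y. - \<mu> * f y) (at_right 0)"
        by (intro uniform_lim_mult uniform_limit_const) (use B in \<open>auto simp: bounded_iff uniform_limit_iff dest: tendstoD\<close>)
      then have "uniform_limit S (\<lambda>h y. (P h f y - f y) / h - (exp (- \<mu> * h) - 1) / h * f y) (\<lambda>y. g y - (- \<mu> * f y)) (at_right 0)"
        using gen unfolding in_generator_def by (intro uniform_limit_minus)
      then have "\<forall>\<^sub>F h in at_right 0. \<forall>y\<in>S. dist ((P h f y - f y) / h - (exp (- \<mu> * h) - 1) / h * f y) (g y - (- \<mu> * f y)) < e"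
        using e unfolding uniform_limit_iff by blast
      then obtain b where b: "b > 0" "\<And>h y. 0 < h \<Longrightarrow> h < b \<Longrightarrow> y \<in> S \<Longrightarrow>
          dist ((P h f y - f y) / h - (exp (- \<mu> * h) - 1) / h * f y) (g y - (- \<mu> * f y)) < e"
        unfolding eventually_at_right_field by auto
      have res: "\<bar>P h f y - exp (- \<mu> * h) * f y\<bar> \<le> e * h" if "0 < h" "h < b" "y \<in> S" for h y
      proof -
        have "(P h f y - f y) / h - (exp (- \<mu> * h) - 1) / h * f y = (P h f y - exp (- \<mu> * h) * f y) / h"
          using that(1) by (simp add: field_simps)
        then have "\<bar>(P h f y - exp (- \<mu> * h) * f y) / h\<bar> < e" using b(2)[OF that] eig[OF that(3)] by (simp add: dist_real_def)
        then show ?thesis using that(1) by (simp add: abs_divide field_simps)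
      qed
      obtain n where n: "t / b < real n" using reals_Archimedean2 by blast
      then have n0: "n > 0" using t0 b(1) by (metis divide_pos_pos gr0I less_asym of_nat_0)
      define h where "h = t / real n"
      have h: "h > 0" "h < b" "real n * h = t" using n n0 t0 b(1) by (simp_all add: h_def field_simps)
      \<comment> \<open>Each of the \<open>n\<close> steps of length \<open>h\<close> adds an error
        of at most \<open>E * M * e * h\<close>; with \<open>n * h = t\<close> the total is
        \<open>e * t * E * M\<close>.\<close>
      have "\<bar>exp (\<mu> * (real i * h)) * P (real i * h) f x - f x\<bar> \<le> real i * (E * (M * (e * h)))" if "i \<le> n" for i
        using that
      proof (induction i)
        case 0
        then show ?case using C0_semigroup_onD(4)[OF P f x] by simp
      next
        case (Suc i)
        have ih: "0 \<le> real i * h" "real (Suc i) * h \<le> \<delta>" "real i * h \<le> \<delta>"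
        proof -
          show "0 \<le> real i * h" using h by simp
          have "real (Suc i) * h \<le> real n * h" using Suc.prems h by (intro mult_right_mono) auto
          then show "real (Suc i) * h \<le> \<delta>" using h t by simp
          moreover have "real i * h \<le> real (Suc i) * h" using h by (intro mult_right_mono) auto
          ultimately show "real i * h \<le> \<delta>" by simp
        qed
        have cP: "continuous_on S (P h f)" using C0_semigroup_onD(1)[OF P _ f] h by simp
        have "P (real (Suc i) * h) f x = P (real i * h) (P h f) x"
          using C0_semigroup_onD(5)[OF P ih(1) _ f x, of h] h by (simp add: algebra_simps)
        moreover have "P (real i * h) (\<lambda>y. 1 * P h f y + (- exp (- \<mu> * h)) * f y) x =
           1 * P (real i * h) (P h f) x + (- exp (- \<mu> * h)) * P (real i * h) f x"
          by (rule C0_semigroup_onD(2)[OF P ih(1) cP f x])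
        moreover have "\<bar>P (real i * h) (\<lambda>y. 1 * P h f y + (- exp (- \<mu> * h)) * f y) x\<bar> \<le> M * (e * h)"
          by (rule M[OF ih(1,3) _ _ x]) (use res h in \<open>auto intro!: continuous_intros cP f\<close>)
        ultimately have 1: "\<bar>P (real (Suc i) * h) f x - exp (- \<mu> * h) * P (real i * h) f x\<bar> \<le> M * (e * h)" by simp
        have 2: "exp (\<mu> * (real (Suc i) * h)) \<le> E"
          unfolding E_def exp_le_cancel_iff
        proof -
          have "\<mu> * (real (Suc i) * h) \<le> \<bar>\<mu>\<bar> * (real (Suc i) * h)" using h by (intro mult_right_mono) auto
          also have "\<dots> \<le> \<bar>\<mu>\<bar> * \<delta>" using ih by (intro mult_left_mono) auto
          finally show "\<mu> * (real (Suc i) * h) \<le> \<bar>\<mu>\<bar> * \<delta>" .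
        qed
        have "exp (\<mu> * (real (Suc i) * h)) * P (real (Suc i) * h) f x - f x =
          exp (\<mu> * (real (Suc i) * h)) * (P (real (Suc i) * h) f x - exp (- \<mu> * h) * P (real i * h) f x)
           + (exp (\<mu> * (real i * h)) * P (real i * h) f x - f x)"
        proof -
          have "exp (\<mu> * (real (Suc i) * h)) * exp (- \<mu> * h) = exp (\<mu> * (real i * h))"
            by (simp add: exp_add[symmetric] algebra_simps)
          then show ?thesis by (simp add: right_diff_distrib mult.assoc[symmetric])
        qed
        also have "\<bar>\<dots>\<bar> \<le> exp (\<mu> * (real (Suc i) * h)) * \<bar>P (real (Suc i) * h) f x - exp (- \<mu> * h) * P (real i * h) f x\<bar>
           + \<bar>exp (\<mu> * (real i * h)) * P (real i * h) f x - f x\<bar>"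
          by (rule order_trans[OF abs_triangle_ineq]) (simp add: abs_mult)
        also have "\<dots> \<le> E * (M * (e * h)) + real i * (E * (M * (e * h)))"
          using Suc 1 2 by (intro add_mono mult_mono) (auto simp: E_def)
        finally show ?case by (simp add: algebra_simps)
      qed
      from this[of n] show ?thesis using h(3) by (simp add: mult_ac)
    qed
    have "\<bar>exp (\<mu> * t) * P t f x - f x\<bar> \<le> 0"
    proof (rule field_le_epsilon)
      fix e :: real assume e: "e > 0"
      have K: "t * E * M \<ge> 0" using t M1 by (simp add: E_def)
      have "\<bar>exp (\<mu> * t) * P t f x - f x\<bar> \<le> e / (t * E * M + 1) * (t * E * M)"
        by (rule bound) (use e K in auto)
      also have "\<dots> \<le> e" using e K by (simp add: field_simps)
      finally show "\<bar>exp (\<mu> * t) * P t f x - f x\<bar> \<le> 0 + e" by simp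
    qed
    then have "exp (\<mu> * t) * P t f x = f x" by simp
    then show ?thesis by (simp add: exp_minus field_simps)
  qed
  \<comment> \<open>Longer times are cut into steps of length at most \<open>\<delta>\<close>, each
    contributing the scalar factor, which passes through \<open>P\<close> by linearity.\<close>
  obtain n where n: "t / \<delta> < real n" using reals_Archimedean2 by blast
  then have n0: "n > 0" using t \<delta> by (metis divide_nonneg_pos gr0I linorder_not_less of_nat_0)
  define h where "h = t / real n"
  have h: "0 \<le> h" "h \<le> \<delta>" "real n * h = t" using n n0 t \<delta> by (simp_all add: h_def field_simps)
  have "P (real i * h) f x = exp (- \<mu> * (real i * h)) * f x" for i
  proof (induction i)
    case 0
    then show ?case using C0_semigroup_onD(4)[OF P f x] by simp
  next
    case (Suc i)
    have ih: "0 \<le> real i * h" using h by simp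
    have "P (real (Suc i) * h) f x = P (real i * h) (P h f) x"
      using C0_semigroup_onD(5)[OF P ih h(1) f x] by (simp add: algebra_simps)
    also have "\<dots> = P (real i * h) (\<lambda>y. exp (- \<mu> * h) * f y) x"
      by (rule C0_semigroup_cong[OF P ih]) (use small h C0_semigroup_onD(1)[OF P h(1) f] f x in \<open>auto intro!: continuous_intros\<close>)
    also have "\<dots> = exp (- \<mu> * h) * P (real i * h) f x" by (rule C0_semigroup_scale[OF P ih f x])
    also have "\<dots> = exp (- \<mu> * (real (Suc i) * h)) * f x"
      unfolding Suc by (simp add: exp_add[symmetric] algebra_simps)
    finally show ?case .
  qed
  from this[of n] show ?thesis using h(3) by simp
qed

section \<open>Zonal harmonics under a quaternionic structure\<close>

lemma grad_inner_linear [simp]: "grad_inner (\<lambda>y. a \<bullet> y) (\<lambda>y. b \<bullet> y) = (\<lambda>y. a \<bullet> b)"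
  unfolding grad_inner_def[abs_def] by (simp add: euclidean_inner[of a b] inner_commute)

lemma grad_inner_left:
  "rpoly f \<Longrightarrow> rpoly g \<Longrightarrow> grad_inner (\<lambda>x. f x + g x) u = (\<lambda>x. grad_inner f u x + grad_inner g u x)"
  "rpoly f \<Longrightarrow> rpoly g \<Longrightarrow> grad_inner (\<lambda>x. f x * g x) u = (\<lambda>x. f x * grad_inner g u x + grad_inner f u x * g x)"
  using grad_inner_add[of f g u] grad_inner_mult[of f g u] by (simp_all add: grad_inner_commute[of _ u])

lemmas rpoly_power = real_polynomial_function_power
lemmas rpoly_diff = real_polynomial_function_diff

lemma grad_inner_power:
  assumes "rpoly f"
  shows "grad_inner u (\<lambda>x. f x ^ n) = (\<lambda>x. real n * f x ^ (n - 1) * grad_inner u f x)"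
proof (induction n)
  case (Suc n)
  have "grad_inner u (\<lambda>x. f x ^ Suc n) = (\<lambda>x. f x * grad_inner u (\<lambda>x. f x ^ n) x + grad_inner u f x * f x ^ n)"
    unfolding power_Suc by (rule grad_inner_mult) (use assms in auto)
  also have "\<dots> = (\<lambda>x. real (Suc n) * f x ^ n * grad_inner u f x)"
    unfolding Suc by (cases n) (auto simp: fun_eq_iff algebra_simps)
  finally show ?case by simp
qed simp

text \<open>Whenever \<open>n - 1\<close> or \<open>n - 2\<close> is truncated, the coefficient in
  front of it is 0.\<close>

lemma lap_power:
  assumes "rpoly f"
  shows "lap (\<lambda>x. f x ^ n) = (\<lambda>x. real n * f x ^ (n - 1) * lap f x
     + real n * (real n - 1) * f x ^ (n - 2) * grad_inner f f x)"
proof (induction n)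
  case (Suc n)
  have "lap (\<lambda>x. f x ^ Suc n) = (\<lambda>x. f x * lap (\<lambda>x. f x ^ n) x + lap f x * f x ^ n
      + 2 * grad_inner f (\<lambda>x. f x ^ n) x)"
    unfolding power_Suc by (rule lap_mult) (use assms in auto)
  also have "\<dots> = (\<lambda>x. real (Suc n) * f x ^ n * lap f x
     + real (Suc n) * (real (Suc n) - 1) * f x ^ (Suc n - 2) * grad_inner f f x)"
  proof -
    consider "n = 0" | "n = 1" | k where "n = Suc (Suc k)" by (metis One_nat_def not0_implies_Suc)
    then show ?thesis
      unfolding Suc grad_inner_power[OF assms] by cases (auto simp: fun_eq_iff algebra_simps)
  qed
  finally show ?case by simp
qed simp

lemma dird_norm2: "dird v (\<lambda>x::'a::euclidean_space. x \<bullet> x) = (\<lambda>x. 2 * (v \<bullet> x))"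
  by (rule ext, rule trans[OF dird_eqI]) (auto intro!: derivative_eq_intros simp: inner_commute)

lemma grad_inner_norm2:
  assumes "rpoly f" "homog p f"
  shows "grad_inner (\<lambda>x. x \<bullet> x) f = (\<lambda>x. 2 * real p * f x)"
proof
  fix x
  have "grad_inner (\<lambda>x. x \<bullet> x) f x = 2 * (\<Sum>b\<in>Basis. (x \<bullet> b) * dird b f x)"
    unfolding grad_inner_def dird_norm2 by (simp add: sum_distrib_left mult_ac inner_commute)
  then show "grad_inner (\<lambda>x. x \<bullet> x) f x = 2 * real p * f x"
    using dird_euclidean[OF assms(1), of x x] euler_homog[OF assms, of x] by simp
qed

lemma lap_norm2: "lap (\<lambda>x::'a::euclidean_space. x \<bullet> x) = (\<lambda>x. 2 * real DIM('a))"
  unfolding lap_def[abs_def] dird_norm2 by (auto simp: fun_eq_iff dird_cmult)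

text \<open>The gradient of \<open>x \<bullet> x\<close> is \<open>2 x\<close>, so the cross term of
  the product rule is an Euler derivative and contributes the degree \<open>p\<close>.\<close>

lemma lap_norm2_power_mult:
  fixes f :: "'a::euclidean_space \<Rightarrow> real"
  assumes "rpoly f" "homog p f"
  shows "lap (\<lambda>x. (x \<bullet> x) ^ i * f x) = (\<lambda>x. (x \<bullet> x) ^ i * lap f x +
     2 * real i * (2 * real i + real DIM('a) - 2 + 2 * real p) * ((x \<bullet> x) ^ (i - 1) * f x))"
proof -
  have R: "rpoly (\<lambda>x::'a. x \<bullet> x)" by simp
  have g: "grad_inner (\<lambda>x. (x \<bullet> x) ^ i) f = (\<lambda>x. real i * (x \<bullet> x) ^ (i - 1) * (2 * real p * f x))"
    unfolding grad_inner_commute[of _ f] grad_inner_power[OF R]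
    using grad_inner_norm2[OF assms] by (simp add: grad_inner_commute[of f])
  have l: "lap (\<lambda>x::'a. (x \<bullet> x) ^ i) = (\<lambda>x. 2 * real i * (2 * real i + real DIM('a) - 2) * (x \<bullet> x) ^ (i - 1))"
  proof -
    consider "i = 0" | "i = 1" | k where "i = Suc (Suc k)" by (metis One_nat_def not0_implies_Suc)
    then show ?thesis
      unfolding lap_power[OF R] lap_norm2 grad_inner_norm2[OF R homog_norm2]
      by cases (auto simp: fun_eq_iff algebra_simps)
  qed
  show ?thesis
    by (subst lap_mult) (use assms(1) in \<open>auto simp: g l fun_eq_iff algebra_simps\<close>)
qed


section \<open>Derivatives along linear vector fields tangent to the sphere\<close>

definition vderiv :: "('a::euclidean_space \<Rightarrow> 'a) \<Rightarrow> ('a \<Rightarrow> real) \<Rightarrow> 'a \<Rightarrow> real" where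
  "vderiv T f x = dird (T x) f x"

lemma vderiv_add: "rpoly f \<Longrightarrow> rpoly g \<Longrightarrow> vderiv T (\<lambda>x. f x + g x) = (\<lambda>x. vderiv T f x + vderiv T g x)"
  by (simp add: vderiv_def[abs_def] dird_add)

lemma vderiv_diff: "rpoly f \<Longrightarrow> rpoly g \<Longrightarrow> vderiv T (\<lambda>x. f x - g x) = (\<lambda>x. vderiv T f x - vderiv T g x)"
  by (simp add: vderiv_def[abs_def] dird_diff)

lemma vderiv_mult: "rpoly f \<Longrightarrow> rpoly g \<Longrightarrow>
    vderiv T (\<lambda>x. f x * g x) = (\<lambda>x. f x * vderiv T g x + vderiv T f x * g x)"
  by (simp add: vderiv_def[abs_def] dird_mult)

lemma vderiv_const [simp]: "vderiv T (\<lambda>x. c) = (\<lambda>x. 0)"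
  by (simp add: vderiv_def[abs_def])

lemma vderiv_cmult: "rpoly f \<Longrightarrow> vderiv T (\<lambda>x. c * f x) = (\<lambda>x. c * vderiv T f x)"
  by (simp add: vderiv_def[abs_def] dird_cmult)

lemma vderiv_sum:
  assumes "finite I" "\<And>i. i \<in> I \<Longrightarrow> rpoly (f i)"
  shows "vderiv T (\<lambda>x. \<Sum>i\<in>I. f i x) = (\<lambda>x. \<Sum>i\<in>I. vderiv T (f i) x)"
  using dird_sum[OF assms] by (simp add: vderiv_def[abs_def])

lemma vderiv_linear [simp]: "vderiv T (\<lambda>x. a \<bullet> x) = (\<lambda>x. a \<bullet> T x)"
  by (simp add: vderiv_def[abs_def])

lemma vderiv_euclidean: "rpoly f \<Longrightarrow> vderiv T f = (\<lambda>x. \<Sum>b\<in>Basis. (T x \<bullet> b) * dird b f x)"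
  unfolding vderiv_def by (rule ext) (rule dird_euclidean)

lemma rpoly_linear_inner: "linear T \<Longrightarrow> rpoly (\<lambda>x::'a::euclidean_space. T x \<bullet> (b::'a))"
  by (intro rpoly_linear bounded_linear_inner_left_comp linear_conv_bounded_linear[THEN iffD1])

lemma rpoly_vderiv: assumes "linear T" "rpoly f" shows "rpoly (vderiv T f)"
  unfolding vderiv_euclidean[OF assms(2)]
  by (intro rpoly_sum rpoly_mult rpoly_dird assms rpoly_linear_inner) auto

lemma homog_vderiv:
  assumes "linear T" "rpoly f" "homog p f" shows "homog p (vderiv T f)"
proof (cases p)
  case 0
  then show ?thesis using assms dird_homog_0[of f] by (simp add: vderiv_def[abs_def] homog_const)
next
  case (Suc q)
  have "homog 1 (\<lambda>x. T x \<bullet> b)" for b using assms(1) by (simp add: homog_def linear_cmul)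
  from homog_mult[OF this homog_dird[of f q]] have "homog p (\<lambda>x. (T x \<bullet> b) * dird c f x)" for b c
    using assms Suc by simp
  then show ?thesis unfolding vderiv_euclidean[OF assms(2)] by (intro homog_sum)
qed

text \<open>A skew field is divergence free, because \<open>T b \<bullet> b = 0\<close>; hence
  \<open>vderiv T w\<close> is a sum of derivatives of \<open>(T x \<bullet> b) * w x\<close>. The
  divergence theorem turns it into the integral of \<open>(T x \<bullet> x) * w x\<close>, which is
  0 by tangency.\<close>

lemma sphere_integral_vderiv:
  fixes w :: "'a::euclidean_space \<Rightarrow> real"
  assumes T: "linear T" "\<And>x. T x \<bullet> x = 0" and w: "rpoly w" "homog p w"
  shows "(LINT x|sphere_volume. vderiv T w x) = 0"
proof -
  have pT: "rpoly (\<lambda>x. (T x \<bullet> b) * w x)" for b by (intro rpoly_mult rpoly_linear_inner T w)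
  have hT: "homog (1 + p) (\<lambda>x. (T x \<bullet> b) * w x)" for b
    using T(1) by (intro homog_mult w(2)) (simp add: homog_def linear_cmul)
  have "dird b (\<lambda>x. T x \<bullet> b) = (\<lambda>x. 0)" for b
    using T(2)[of b] T(1) by (subst dird_linear)
      (auto intro: bounded_linear_inner_left_comp simp: linear_conv_bounded_linear)
  then have "vderiv T w = (\<lambda>x. \<Sum>b\<in>Basis. dird b (\<lambda>x. (T x \<bullet> b) * w x) x)"
    unfolding vderiv_euclidean[OF w(1)] by (simp add: dird_mult rpoly_linear_inner T w)
  then have "(LINT x|sphere_volume. vderiv T w x) =
     (\<Sum>b\<in>Basis. LINT x|sphere_volume. dird b (\<lambda>x. (T x \<bullet> b) * w x) x)"
    by (simp add: sphere_integral_sum rpoly_continuous rpoly_dird pT)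
  also have "\<dots> = (\<Sum>b\<in>Basis. (real (1 + p) + real DIM('a) - 1) * (LINT x|sphere_volume. (b \<bullet> x) * ((T x \<bullet> b) * w x)))"
    by (intro sum.cong refl sphere_integral_dird pT hT)
  also have "\<dots> = (real (1 + p) + real DIM('a) - 1) *
      (LINT x|sphere_volume. (\<Sum>b\<in>Basis. (b \<bullet> x) * ((T x \<bullet> b) * w x)))"
    unfolding sum_distrib_left[symmetric]
    by (subst sphere_integral_sum) (auto intro!: rpoly_continuous rpoly_mult pT)
  also have "(\<lambda>x. \<Sum>b\<in>Basis. (b \<bullet> x) * ((T x \<bullet> b) * w x)) = (\<lambda>x. (T x \<bullet> x) * w x)"
  proof
    fix x
    show "(\<Sum>b\<in>Basis. (b \<bullet> x) * ((T x \<bullet> b) * w x)) = (T x \<bullet> x) * w x"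
    proof -
      have "(\<Sum>b\<in>Basis. (b \<bullet> x) * ((T x \<bullet> b) * w x)) = (\<Sum>b\<in>Basis. (T x \<bullet> b) * (x \<bullet> b)) * w x"
        unfolding sum_distrib_right by (intro sum.cong refl) (simp add: inner_commute)
      then show ?thesis by (simp only: euclidean_inner[of "T x" x, symmetric])
    qed
  qed
  finally show ?thesis using T(2) by simp
qed

text \<open>Green's identity: \<open>u * vderiv T v - vderiv T u * v\<close> is differentiated once
  more along \<open>T\<close>, and the mixed first-order products cancel.\<close>

lemma sphere_integral_vderiv_symmetric:
  fixes u v :: "'a::euclidean_space \<Rightarrow> real"
  assumes T: "linear T" "\<And>x. T x \<bullet> x = 0" and u: "rpoly u" "homog p u" and v: "rpoly v" "homog q v"
  shows "(LINT x|sphere_volume. u x * vderiv T (vderiv T v) x) = (LINT x|sphere_volume. vderiv T (vderiv T u) x * v x)"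
proof -
  let ?w = "\<lambda>x. u x * vderiv T v x - vderiv T u x * v x"
  note pv = rpoly_vderiv[OF T(1)]
  have "rpoly ?w" by (intro rpoly_diff rpoly_mult u v pv)
  moreover have "homog (p + q) ?w" by (intro homog_diff homog_mult homog_vderiv T u v)
  ultimately have "(LINT x|sphere_volume. vderiv T ?w x) = 0" by (rule sphere_integral_vderiv[OF T])
  also have "vderiv T ?w = (\<lambda>x. u x * vderiv T (vderiv T v) x - vderiv T (vderiv T u) x * v x)"
    by (simp add: vderiv_diff vderiv_mult u v pv rpoly_mult) 
  also have "(LINT x|sphere_volume. u x * vderiv T (vderiv T v) x - vderiv T (vderiv T u) x * v x) =
     (LINT x|sphere_volume. u x * vderiv T (vderiv T v) x) - (LINT x|sphere_volume. vderiv T (vderiv T u) x * v x)"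
    by (intro sphere_integral_diff rpoly_continuous rpoly_mult u v pv)
  finally show ?thesis by simp
qed


text \<open>\<open>cheb k x s\<close> is \<open>s\<^bsup>k/2\<^esup> U\<^sub>k (x / \<surd>s)\<close>, with \<open>U\<^sub>k\<close> the Chebyshev polynomial of the second kind.\<close>

fun cheb :: "nat \<Rightarrow> real \<Rightarrow> real \<Rightarrow> real" where
  "cheb 0 x s = 1"
| "cheb (Suc 0) x s = 2 * x"
| "cheb (Suc (Suc k)) x s = 2 * x * cheb (Suc k) x s - s * cheb k x s"

text \<open>The product of the \<open>i\<close>-th Gegenbauer coefficient and the ballot number that
  expands \<open>(2 * x) ^ (m - 2 * i)\<close> in the polynomials \<open>cheb\<close>; the factorial
  of \<open>m - 2 * i\<close> cancels.\<close>

definition zonal_coeff :: "real \<Rightarrow> nat \<Rightarrow> nat \<Rightarrow> nat \<Rightarrow> real" where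
  "zonal_coeff l m h i = (-1) ^ i * pochhammer l (m - i) * real (m - 2 * h + 1) /
     (fact i * fact (h - i) * fact (h - i + (m - 2 * h) + 1))"

text \<open>The component of the degree \<open>m\<close> zonal harmonic that transforms under \<open>SU(2)\<close> by the
  representation of dimension \<open>m - 2 h + 1\<close>, as a function of \<open>x = a \<bullet> y\<close>, of the squared length
  \<open>s\<close> of the quaternionic inner product of \<open>a\<close> and \<open>y\<close>, and of \<open>r = y \<bullet> y\<close>.\<close>

definition zonal_part :: "real \<Rightarrow> nat \<Rightarrow> nat \<Rightarrow> real \<Rightarrow> real \<Rightarrow> real \<Rightarrow> real" where
  "zonal_part l m h x s r =
    (\<Sum>i\<le>h. zonal_coeff l m h i * (r ^ i * (s ^ (h - i) * cheb (m - 2 * h) x s)))"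

text \<open>Precisely the relation between neighbouring coefficients that makes the Laplacian of the
  zonal component vanish.\<close>

lemma zonal_coeff_rec:
  assumes "i < h" "2 * h \<le> m"
  shows "zonal_coeff l m h (Suc i) * (real (Suc i) * (real m - real (Suc i) + l)) =
     - (zonal_coeff l m h i * (real (h - i) * (real (h - i) + real (m - 2 * h) + 1)))"
proof -
  obtain j where j: "h = Suc (i + j)" using assms(1) less_imp_Suc_add by blast
  have mi: "m - i = Suc (m - Suc i)" using assms j by auto
  have p: "pochhammer l (m - i) = pochhammer l (m - Suc i) * (l + (real m - real (Suc i)))"
    unfolding mi pochhammer_Suc using assms j by (simp add: of_nat_diff)
  define k where "k = m - 2 * h"
  define Q where "Q = pochhammer l (m - Suc i)"
  define c where "c = l + (real m - real (Suc i))"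
  have e: "h - i = Suc j" "h - Suc i = j" using j by auto
  have z1: "zonal_coeff l m h (Suc i) = - ((-1) ^ i) * Q * real (k + 1) / (real (Suc i) * fact i * fact j * fact (j + k + 1))"
    unfolding zonal_coeff_def e Q_def k_def by simp
  have z2: "zonal_coeff l m h i = (-1) ^ i * (Q * c) * real (k + 1) /
     (fact i * (real (Suc j) * fact j) * (real (Suc j + k + 1) * fact (j + k + 1)))"
    unfolding zonal_coeff_def e p Q_def k_def c_def by simp
  have z3: "real m - real (Suc i) + l = c" "real (h - i) * (real (h - i) + real (m - 2 * h) + 1) = real (Suc j) * real (Suc j + k + 1)"
    unfolding c_def e k_def by simp_all
  show ?thesis unfolding z3 z1 z2 by (simp del: of_nat_Suc of_nat_add)
qed

text \<open>Abstracts left multiplication by the three imaginary units. The vertical calculus needs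
  only skewness and the multiplication table, not coordinates; \<open>skew\<close> is oriented so
  that simplification moves all operators to the left argument.\<close>

locale quaternionic_structure =
  fixes I J K :: "'a::euclidean_space \<Rightarrow> 'a"
  assumes lin: "linear I" "linear J" "linear K"
    and skew: "\<And>x y. x \<bullet> I y = - (I x \<bullet> y)" "\<And>x y. x \<bullet> J y = - (J x \<bullet> y)" "\<And>x y. x \<bullet> K y = - (K x \<bullet> y)"
    and quat: "\<And>x. I (I x) = - x" "\<And>x. J (J x) = - x" "\<And>x. K (K x) = - x"
      "\<And>x. I (J x) = K x" "\<And>x. J (I x) = - K x" "\<And>x. J (K x) = I x" "\<And>x. K (J x) = - I x"
      "\<And>x. K (I x) = J x" "\<And>x. I (K x) = - J x"
begin

text \<open>For a unit vector \<open>a\<close> this is the squared length of the orthogonal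
  projection of \<open>y\<close> to the quaternionic line spanned by \<open>a\<close>,
  \<open>I a\<close>, \<open>J a\<close>, \<open>K a\<close>.\<close>

definition hnorm2 :: "'a \<Rightarrow> 'a \<Rightarrow> real" where
  "hnorm2 a y = (a \<bullet> y) * (a \<bullet> y) + (I a \<bullet> y) * (I a \<bullet> y) + (J a \<bullet> y) * (J a \<bullet> y) + (K a \<bullet> y) * (K a \<bullet> y)"

definition vlap :: "('a \<Rightarrow> real) \<Rightarrow> 'a \<Rightarrow> real" where
  "vlap f x = vderiv I (vderiv I f) x + vderiv J (vderiv J f) x + vderiv K (vderiv K f) x"

definition vinner :: "('a \<Rightarrow> real) \<Rightarrow> ('a \<Rightarrow> real) \<Rightarrow> 'a \<Rightarrow> real" where
  "vinner f g x = vderiv I f x * vderiv I g x + vderiv J f x * vderiv J g x + vderiv K f x * vderiv K g x"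

lemma skew0: "I x \<bullet> x = 0" "J x \<bullet> x = 0" "K x \<bullet> x = 0"
  using skew(1)[of x x] skew(2)[of x x] skew(3)[of x x] by (simp_all add: inner_commute)

lemma rpoly_hnorm2 [intro, simp]: "rpoly (hnorm2 a)"
  unfolding hnorm2_def[abs_def] by (intro rpoly_add rpoly_mult rpoly_inner_left)

lemma homog_hnorm2: "homog 2 (hnorm2 a)"
  by (simp add: homog_def hnorm2_def power2_eq_square algebra_simps)

text \<open>Up to sign, each of the three fields permutes the four linear forms whose squares are
  summed, so the derivatives cancel in pairs. Thus \<open>hnorm2 a\<close> is constant along the
  fibres.\<close>

lemma vderiv_hnorm2: "vderiv I (hnorm2 a) = (\<lambda>x. 0)" "vderiv J (hnorm2 a) = (\<lambda>x. 0)" "vderiv K (hnorm2 a) = (\<lambda>x. 0)"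
  unfolding hnorm2_def[abs_def]
  by (simp_all add: vderiv_add vderiv_mult rpoly_add rpoly_mult skew quat algebra_simps)

lemma vderiv_norm2: "vderiv I (\<lambda>x. x \<bullet> x) = (\<lambda>x. 0)" "vderiv J (\<lambda>x. x \<bullet> x) = (\<lambda>x. 0)" "vderiv K (\<lambda>x. x \<bullet> x) = (\<lambda>x. 0)"
  unfolding vderiv_def[abs_def] dird_norm2 by (simp_all add: skew0)

lemma vlap_mult:
  assumes "rpoly f" "rpoly g"
  shows "vlap (\<lambda>x. f x * g x) = (\<lambda>x. f x * vlap g x + vlap f x * g x + 2 * vinner f g x)"
  unfolding vlap_def vinner_def
  by (rule ext) (simp add: vderiv_mult vderiv_add rpoly_mult rpoly_vderiv lin assms algebra_simps)

lemma vlap_diff: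
  assumes "rpoly f" "rpoly g"
  shows "vlap (\<lambda>x. f x - g x) = (\<lambda>x. vlap f x - vlap g x)"
  unfolding vlap_def
  by (rule ext) (simp add: vderiv_diff rpoly_vderiv lin assms)

lemma vlap_cmult: "rpoly f \<Longrightarrow> vlap (\<lambda>x. c * f x) = (\<lambda>x. c * vlap f x)"
  unfolding vlap_def
  by (rule ext) (simp add: vderiv_cmult rpoly_vderiv lin algebra_simps)

lemma vlap_sum:
  assumes "finite A" "\<And>i. i \<in> A \<Longrightarrow> rpoly (f i)"
  shows "vlap (\<lambda>x. \<Sum>i\<in>A. f i x) = (\<lambda>x. \<Sum>i\<in>A. vlap (f i) x)"
  unfolding vlap_def
  by (rule ext) (simp add: vderiv_sum rpoly_vderiv lin assms sum.distrib)

lemma sphere_integral_vlap_symmetric: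
  assumes "rpoly u" "homog p u" "rpoly v" "homog q v"
  shows "(LINT x|sphere_volume. u x * vlap v x) = (LINT x|sphere_volume. vlap u x * v x)"
proof -
  note sym = sphere_integral_vderiv_symmetric[OF lin(1) skew0(1) assms]
    sphere_integral_vderiv_symmetric[OF lin(2) skew0(2) assms]
    sphere_integral_vderiv_symmetric[OF lin(3) skew0(3) assms]
  have c: "continuous_on (sphere 0 1) (\<lambda>x. f x * vderiv I (vderiv I g) x)"
      "continuous_on (sphere 0 1) (\<lambda>x. f x * vderiv J (vderiv J g) x)"
      "continuous_on (sphere 0 1) (\<lambda>x. f x * vderiv K (vderiv K g) x)" if "rpoly f" "rpoly g" for f g
    using that by (auto intro!: rpoly_continuous rpoly_mult rpoly_vderiv lin)
  have "(LINT x|sphere_volume. f x * vlap g x) = (LINT x|sphere_volume. f x * vderiv I (vderiv I g) x)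
     + (LINT x|sphere_volume. f x * vderiv J (vderiv J g) x) + (LINT x|sphere_volume. f x * vderiv K (vderiv K g) x)"
    if "rpoly f" "rpoly g" for f g
    unfolding vlap_def distrib_left
    by (subst sphere_integral_add; (intro continuous_on_add c that)?)+ simp
  from this[OF assms(1,3)] this[OF assms(3,1)] show ?thesis
    unfolding sym by (simp add: mult.commute)
qed

context
  fixes a :: 'a
  assumes a: "norm a = 1"
begin

abbreviation (input) X :: "'a \<Rightarrow> real" where "X \<equiv> \<lambda>y. a \<bullet> y"

definition chebf :: "nat \<Rightarrow> 'a \<Rightarrow> real" where "chebf k y = cheb k (a \<bullet> y) (hnorm2 a y)"

lemma chebf_rec: "chebf 0 = (\<lambda>y. 1)" "chebf (Suc 0) = (\<lambda>y. 2 * X y)"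
  "chebf (Suc (Suc k)) = (\<lambda>y. 2 * (X y * chebf (Suc k) y) - hnorm2 a y * chebf k y)"
  by (simp_all add: chebf_def fun_eq_iff)

lemma a_inner: "a \<bullet> a = 1" "I a \<bullet> I a = 1" "J a \<bullet> J a = 1" "K a \<bullet> K a = 1"
  "a \<bullet> I a = 0" "a \<bullet> J a = 0" "a \<bullet> K a = 0" "I a \<bullet> a = 0" "J a \<bullet> a = 0" "K a \<bullet> a = 0"
  "I a \<bullet> J a = 0" "I a \<bullet> K a = 0" "J a \<bullet> I a = 0" "J a \<bullet> K a = 0" "K a \<bullet> I a = 0" "K a \<bullet> J a = 0"
  using a by (simp_all add: skew quat skew0 norm_eq_1)

lemma rpoly_chebf [simp, intro]: "rpoly (chebf k)"
  by (induction k rule: induct_nat_012) (auto simp: chebf_rec intro!: rpoly_diff rpoly_cmult rpoly_mult)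

lemma homog_chebf: "homog k (chebf k)"
proof (induction k rule: induct_nat_012)
  case (ge2 k)
  have "homog (Suc (Suc k)) (\<lambda>y. X y * chebf (Suc k) y)"
    using homog_mult[OF homog_inner_left(2) ge2(2), of a] by simp
  moreover have "homog (Suc (Suc k)) (\<lambda>y. hnorm2 a y * chebf k y)"
    using homog_mult[OF homog_hnorm2 ge2(1), of a] by simp
  ultimately show ?case unfolding chebf_rec by (intro homog_diff homog_cmult)
qed (auto simp: chebf_rec homog_const intro: homog_cmult)

lemma grad_hnorm2:
  "grad_inner X (hnorm2 a) = (\<lambda>y. 2 * X y)"
  "grad_inner (hnorm2 a) (hnorm2 a) = (\<lambda>y. 4 * hnorm2 a y)"
  "lap (hnorm2 a) = (\<lambda>y. 8)"
  unfolding hnorm2_def[abs_def]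
  by (simp_all add: grad_inner_add grad_inner_mult grad_inner_left lap_add lap_mult rpoly_add rpoly_mult a_inner algebra_simps)

lemma grad_X_chebf: "grad_inner X (chebf (Suc k)) = (\<lambda>y. real (k + 2) * chebf k y)"
proof (induction k rule: induct_nat_012)
  case 0
  show ?case by (simp add: chebf_rec grad_inner_cmult a_inner)
next
  case 1
  show ?case by (simp add: chebf_rec grad_inner_diff grad_inner_cmult grad_inner_mult a_inner rpoly_mult rpoly_cmult grad_hnorm2)
next
  case (ge2 k)
  show ?case
    unfolding chebf_rec(3)[of "Suc k"]
    by (simp add: grad_inner_diff grad_inner_cmult grad_inner_mult rpoly_mult rpoly_cmult a_inner grad_hnorm2 ge2)
      (simp add: chebf_rec fun_eq_iff algebra_simps)
qed

text \<open>\<open>chebf k\<close> is homogeneous of degree \<open>k\<close> in the four coordinates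
  whose squares make up \<open>hnorm2 a\<close>, so this is Euler's identity on the quaternionic
  line.\<close>

lemma grad_hnorm2_chebf: "grad_inner (hnorm2 a) (chebf k) = (\<lambda>y. 2 * real k * chebf k y)"
proof (induction k rule: induct_nat_012)
  case (ge2 k)
  have "grad_inner (hnorm2 a) X = (\<lambda>y. 2 * X y)" using grad_hnorm2(1) by (simp add: grad_inner_commute)
  then show ?case
    unfolding chebf_rec(3)
    by (simp add: grad_inner_diff grad_inner_cmult grad_inner_mult rpoly_mult rpoly_cmult grad_hnorm2 ge2)
      (simp add: fun_eq_iff algebra_simps)
qed (use grad_hnorm2(1) in \<open>simp_all add: chebf_rec grad_inner_cmult grad_inner_commute\<close>)

text \<open>In the recursion the contribution \<open>4 (k + 2)\<close> of the cross term with
  \<open>a \<bullet> y\<close> cancels the contributions \<open>8\<close> and \<open>4 k\<close> of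
  \<open>hnorm2 a\<close>, all multiplying \<open>chebf k\<close>.\<close>

lemma lap_chebf: "lap (chebf k) = (\<lambda>y. 0)"
proof (induction k rule: induct_nat_012)
  case (ge2 k)
  show ?case
    unfolding chebf_rec(3)
    by (simp add: lap_diff lap_cmult lap_mult rpoly_mult rpoly_cmult grad_hnorm2 ge2 grad_X_chebf grad_hnorm2_chebf)
      (simp add: fun_eq_iff algebra_simps)
qed (simp_all add: chebf_rec lap_cmult)

lemma vinner_X_X: "vinner X X = (\<lambda>y. hnorm2 a y - X y * X y)"
  by (simp add: vinner_def[abs_def] hnorm2_def skew fun_eq_iff)

lemma vlap_X: "vlap X = (\<lambda>y. - 3 * X y)"
proof -
  have "(\<lambda>x. a \<bullet> I x) = (\<lambda>x. - 1 * (I a \<bullet> x))" "(\<lambda>x. a \<bullet> J x) = (\<lambda>x. - 1 * (J a \<bullet> x))"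
    "(\<lambda>x. a \<bullet> K x) = (\<lambda>x. - 1 * (K a \<bullet> x))" by (simp_all add: skew)
  then show ?thesis
    by (simp add: vlap_def[abs_def] vderiv_cmult[OF rpoly_inner_left, of _ "-1", simplified] skew quat)
qed

lemma vinner_const: "vinner X (\<lambda>y. c) = (\<lambda>y. 0)"
  by (simp add: vinner_def[abs_def])

lemma vertical_hnorm2: "vinner (hnorm2 a) f = (\<lambda>y. 0)" "vinner f (hnorm2 a) = (\<lambda>y. 0)" "vlap (hnorm2 a) = (\<lambda>y. 0)"
  by (simp_all add: vinner_def[abs_def] vlap_def[abs_def] vderiv_hnorm2)

lemma vinner_rules:
  assumes "rpoly f" "rpoly g"
  shows "vinner X (\<lambda>y. f y - g y) = (\<lambda>y. vinner X f y - vinner X g y)"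
    "vinner X (\<lambda>y. c * f y) = (\<lambda>y. c * vinner X f y)"
    "vinner X (\<lambda>y. f y * g y) = (\<lambda>y. f y * vinner X g y + vinner X f y * g y)"
    "vinner X (\<lambda>y. hnorm2 a y * f y) = (\<lambda>y. hnorm2 a y * vinner X f y)"
  using assms by (simp_all add: vinner_def[abs_def] vlap_def[abs_def] vderiv_diff vderiv_cmult vderiv_mult vderiv_hnorm2 algebra_simps)

lemma vinner_X_chebf:
  "vinner X (chebf (Suc k)) = (\<lambda>y. real (k + 2) * hnorm2 a y * chebf k y - real (k + 1) * (X y * chebf (Suc k) y))"
proof (induction k rule: induct_nat_012)
  case 0
  show ?case by (simp add: chebf_rec vinner_rules vinner_const vertical_hnorm2 vinner_X_X fun_eq_iff algebra_simps)
next
  case 1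
  show ?case
    by (simp add: chebf_rec vinner_rules vinner_const vertical_hnorm2 rpoly_mult rpoly_cmult vinner_X_X) (simp add: fun_eq_iff algebra_simps)
next
  case (ge2 k)
  show ?case
    unfolding chebf_rec(3)[of "Suc k"]
    by (simp add: vinner_rules vinner_const vertical_hnorm2 rpoly_mult rpoly_cmult vinner_X_X ge2)
      (simp add: chebf_rec fun_eq_iff algebra_simps)
qed

text \<open>The fibres are three-spheres, and \<open>- k (k + 2)\<close> is the eigenvalue of the
  Laplacian of the unit three-sphere in degree \<open>k\<close>. In the recursion
  \<open>hnorm2 a\<close> behaves as a constant, and the cross term is given by
  \<open>vinner_X_chebf\<close>.\<close>

lemma vlap_chebf: "vlap (chebf k) = (\<lambda>y. - real (k * (k + 2)) * chebf k y)"
proof (induction k rule: induct_nat_012)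
  case 0
  show ?case by (simp add: chebf_rec vlap_def[abs_def])
next
  case 1
  show ?case by (simp add: chebf_rec vlap_cmult vlap_X)
next
  case (ge2 k)
  show ?case
    unfolding chebf_rec(3)
    by (simp add: vlap_diff vlap_cmult vlap_mult rpoly_mult rpoly_cmult vlap_X ge2 vinner_X_chebf vertical_hnorm2)
      (simp add: fun_eq_iff algebra_simps)
qed

definition zonal_term :: "nat \<Rightarrow> nat \<Rightarrow> nat \<Rightarrow> 'a \<Rightarrow> real" where
  "zonal_term k j i y = (y \<bullet> y) ^ i * (hnorm2 a y ^ j * chebf k y)"

lemma rpoly_zonal_term [intro, simp]: "rpoly (zonal_term k j i)"
  unfolding zonal_term_def[abs_def] by (intro rpoly_mult rpoly_power) auto

lemma homog_zonal_term: "homog (k + 2 * j + 2 * i) (zonal_term k j i)"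
  using homog_mult[OF homog_power[OF homog_norm2, where n=i] homog_mult[OF homog_power[OF homog_hnorm2, where n=j] homog_chebf[of k]]]
  unfolding zonal_term_def[abs_def] by (simp add: algebra_simps)

text \<open>The formula of \<open>lap_norm2_power_mult\<close> in dimension 4, with
  \<open>hnorm2 a\<close> in the role of the squared norm and the harmonic function
  \<open>chebf k\<close>.\<close>

lemma lap_hnorm2_power_chebf:
  "lap (\<lambda>y. hnorm2 a y ^ j * chebf k y) = (\<lambda>y. 4 * real j * (real j + real k + 1) * (hnorm2 a y ^ (j - 1) * chebf k y))"
proof -
  have g: "grad_inner (\<lambda>y. hnorm2 a y ^ j) (chebf k) = (\<lambda>y. real j * hnorm2 a y ^ (j - 1) * (2 * real k * chebf k y))"
    unfolding grad_inner_commute[of _ "chebf k"] grad_inner_power[OF rpoly_hnorm2]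
    using grad_hnorm2_chebf[of k] by (simp add: grad_inner_commute[of "chebf k"])
  have l: "lap (\<lambda>y. hnorm2 a y ^ j) = (\<lambda>y. 4 * real j * (real j + 1) * hnorm2 a y ^ (j - 1))"
  proof -
    consider "j = 0" | "j = 1" | i where "j = Suc (Suc i)" by (metis One_nat_def not0_implies_Suc)
    then show ?thesis
      unfolding lap_power[OF rpoly_hnorm2] grad_hnorm2
      by cases (auto simp: fun_eq_iff algebra_simps)
  qed
  show ?thesis
    by (subst lap_mult) (auto simp: g l lap_chebf fun_eq_iff algebra_simps)
qed

lemma lap_zonal_term:
  "lap (zonal_term k j i) = (\<lambda>y. 4 * real j * (real j + real k + 1) * zonal_term k (j - 1) i y +
     2 * real i * (2 * real i + real DIM('a) - 2 + 2 * real (k + 2 * j)) * zonal_term k j (i - 1) y)"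
proof -
  have h: "homog (k + 2 * j) (\<lambda>y. hnorm2 a y ^ j * chebf k y)"
    using homog_mult[OF homog_power[OF homog_hnorm2, where n=j] homog_chebf[of k]] by (simp add: algebra_simps)
  have r: "rpoly (\<lambda>y. hnorm2 a y ^ j * chebf k y)" by (intro rpoly_mult rpoly_power) auto
  show ?thesis
    unfolding zonal_term_def[abs_def] lap_norm2_power_mult[OF r h] lap_hnorm2_power_chebf by (simp add: mult_ac)
qed

definition zonalf :: "real \<Rightarrow> nat \<Rightarrow> nat \<Rightarrow> 'a \<Rightarrow> real" where
  "zonalf l m h y = zonal_part l m h (a \<bullet> y) (hnorm2 a y) (y \<bullet> y)"

lemma zonalf_eq: "zonalf l m h = (\<lambda>y. \<Sum>i\<le>h. zonal_coeff l m h i * zonal_term (m - 2 * h) (h - i) i y)"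
  by (simp add: zonalf_def[abs_def] zonal_part_def zonal_term_def chebf_def)

lemma rpoly_zonalf [intro, simp]: "rpoly (zonalf l m h)"
  unfolding zonalf_eq by (intro rpoly_sum rpoly_cmult) auto

lemma homog_zonalf:
  assumes "2 * h \<le> m" shows "homog m (zonalf l m h)"
  unfolding zonalf_eq
proof (intro homog_sum homog_cmult)
  fix i assume "i \<in> {..h}"
  then have "m - 2 * h + 2 * (h - i) + 2 * i = m" using assms by auto
  then show "homog m (zonal_term (m - 2 * h) (h - i) i)" using homog_zonal_term by metis
qed

text \<open>The squared norm and \<open>hnorm2 a\<close> are constant along the fibres, so
  \<open>vlap\<close> sees only the factor \<open>chebf (m - 2 * h)\<close>, which is common to all
  summands.\<close>

lemma vlap_zonalf: "vlap (zonalf l m h) = (\<lambda>y. - real ((m - 2 * h) * (m - 2 * h + 2)) * zonalf l m h y)"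
proof -
  have mul: "vlap (\<lambda>y. f y * g y) = (\<lambda>y. f y * vlap g y)"
    if "rpoly f" "rpoly g" "vderiv I f = (\<lambda>y. 0)" "vderiv J f = (\<lambda>y. 0)" "vderiv K f = (\<lambda>y. 0)" for f g
  proof -
    have "vlap f = (\<lambda>y. 0)" "vinner f g = (\<lambda>y. 0)"
      using that(3-5) by (simp_all add: vlap_def[abs_def] vinner_def[abs_def])
    then show ?thesis unfolding vlap_mult[OF that(1,2)] by simp
  qed
  have pow: "vderiv T (\<lambda>y. f y ^ n) = (\<lambda>y. 0)" if "rpoly f" "vderiv T f = (\<lambda>y. 0)" for T n and f :: "'a \<Rightarrow> real"
    by (induction n) (use that in \<open>simp_all add: vderiv_mult rpoly_power\<close>)
  have "vlap (zonal_term k j i) = (\<lambda>y. - real (k * (k + 2)) * zonal_term k j i y)" for k j i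
    unfolding zonal_term_def[abs_def]
    by (simp add: mul pow rpoly_power rpoly_mult vderiv_hnorm2 vderiv_norm2 vlap_chebf) (simp only: mult_ac)
  then show ?thesis
    unfolding zonalf_eq by (simp add: vlap_sum vlap_cmult rpoly_cmult) (simp add: sum_distrib_left sum_distrib_right mult_ac)
qed

text \<open>The Laplacian of a term lowers either the power of \<open>hnorm2 a\<close> or the power
  of \<open>y \<bullet> y\<close> by one; consecutive summands then cancel by
  \<open>zonal_coeff_rec\<close>.\<close>

lemma lap_zonalf:
  assumes "2 * h \<le> m" "real DIM('a) = 2 * l + 2"
  shows "lap (zonalf l m h) = (\<lambda>y. 0)"
proof
  fix y
  let ?k = "m - 2 * h"
  let ?z = "\<lambda>i. zonal_term ?k (h - Suc i) i y"
  have "lap (zonalf l m h) y = (\<Sum>i\<le>h. zonal_coeff l m h i * lap (zonal_term ?k (h - i) i) y)"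
    unfolding zonalf_eq by (simp add: lap_sum lap_cmult rpoly_cmult)
  also have "\<dots> = (\<Sum>i\<le>h. 4 * (zonal_coeff l m h i * (real (h - i) * (real (h - i) + real ?k + 1))) * ?z i)
     + (\<Sum>i\<le>h. 4 * (zonal_coeff l m h i * (real i * (real m - real i + l))) * zonal_term ?k (h - i) (i - 1) y)"
    unfolding sum.distrib[symmetric]
  proof (rule sum.cong[OF refl])
    fix i assume i: "i \<in> {..h}"
    have e: "2 * real i * (2 * real i + real DIM('a) - 2 + 2 * real (?k + 2 * (h - i))) = 4 * (real i * (real m - real i + l))"
      using i assms by (simp add: of_nat_diff algebra_simps)
    show "zonal_coeff l m h i * lap (zonal_term ?k (h - i) i) y =
      4 * (zonal_coeff l m h i * (real (h - i) * (real (h - i) + real ?k + 1))) * ?z i +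
      4 * (zonal_coeff l m h i * (real i * (real m - real i + l))) * zonal_term ?k (h - i) (i - 1) y"
      by (simp only: lap_zonal_term e diff_Suc_eq_diff_pred[symmetric] diff_diff_left Suc_eq_plus1, simp only: distrib_left mult_ac)
  qed
  \<comment> \<open>The summand with \<open>i = 0\<close> vanishes; after the index shift both sums
    run over the same terms.\<close>
  also have "(\<Sum>i\<le>h. 4 * (zonal_coeff l m h i * (real i * (real m - real i + l))) * zonal_term ?k (h - i) (i - 1) y) =
     (\<Sum>i<h. 4 * (zonal_coeff l m h (Suc i) * (real (Suc i) * (real m - real (Suc i) + l))) * ?z i)"
    by (simp add: sum.atMost_shift del: of_nat_Suc)
  also have "\<dots> = (\<Sum>i<h. - (4 * (zonal_coeff l m h i * (real (h - i) * (real (h - i) + real ?k + 1))) * ?z i))"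
    using zonal_coeff_rec[OF _ assms(1), of _ l] by (intro sum.cong refl) (simp del: of_nat_Suc)
  also have "(\<Sum>i\<le>h. 4 * (zonal_coeff l m h i * (real (h - i) * (real (h - i) + real ?k + 1))) * ?z i) =
     (\<Sum>i<h. 4 * (zonal_coeff l m h i * (real (h - i) * (real (h - i) + real ?k + 1))) * ?z i)"
    unfolding lessThan_Suc_atMost[symmetric] by simp
  finally show "lap (zonalf l m h) y = 0" by (simp add: sum_negf)
qed

lemma harmonic_zonalf:
  assumes "2 * h \<le> m" "real DIM('a) = 2 * l + 2"
  shows "harmonic_poly m (zonalf l m h)"
  unfolding harmonic_poly_def using homog_zonalf[OF assms(1)] lap_zonalf[OF assms] by simp

end

end

section \<open>Fourier expansion of Gegenbauer polynomials\<close>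

text \<open>Ballot numbers: for \<open>2 * j \<le> p\<close>, the multiplicity of the representation
  of dimension \<open>p - 2 * j + 1\<close> in the \<open>p\<close>-th tensor power of the standard
  representation of \<open>SU(2)\<close>. The guard is needed because \<open>j - 1\<close> is
  truncated to 0 at \<open>j = 0\<close>.\<close>

definition ballot :: "nat \<Rightarrow> nat \<Rightarrow> real" where
  "ballot p j = real (p choose j) - (if j = 0 then 0 else real (p choose (j - 1)))"

text \<open>The value 0 beyond \<open>2 * j = p\<close> lets sums over \<open>j\<close> run up to
  \<open>p\<close>, which suits the index shifts of the induction.\<close>

definition cheb_term :: "real \<Rightarrow> real \<Rightarrow> nat \<Rightarrow> nat \<Rightarrow> real" where
  "cheb_term x s p j = (if 2 * j \<le> p then s ^ j * cheb (p - 2 * j) x s else 0)"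

lemma cheb_mult: "2 * x * cheb (Suc k) x s = cheb (Suc (Suc k)) x s + s * cheb k x s"
  by simp

text \<open>The three-term recursion of \<open>cheb\<close>. The factor \<open>ballot p j\<close>
  cannot be dropped: for \<open>2 * j = Suc p\<close> the two sides agree only because the ballot
  number is 0 there.\<close>

lemma cheb_term_mult:
  "ballot p j * (2 * x * cheb_term x s p j) = ballot p j * (cheb_term x s (Suc p) j + cheb_term x s (Suc p) (Suc j))"
proof -
  consider "2 * j = p" | "2 * j < p" | "2 * j = Suc p" | "2 * j > Suc p" by linarith
  then show ?thesis
  proof cases
    case 1
    then show ?thesis by (auto simp: cheb_term_def)
  next
    case 2
    then obtain k where k: "p = 2 * j + Suc k" using less_imp_Suc_add by auto
    have e: "p - 2 * j = Suc k" "Suc p - 2 * j = Suc (Suc k)" "Suc p - 2 * Suc j = k" using k by auto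
    have "2 * x * cheb_term x s p j = s ^ j * (2 * x * cheb (Suc k) x s)"
      using 2 unfolding cheb_term_def e by simp
    also have "\<dots> = cheb_term x s (Suc p) j + cheb_term x s (Suc p) (Suc j)"
      unfolding cheb_mult cheb_term_def e using k by (simp add: distrib_left del: cheb.simps)
    finally show ?thesis by simp
  next
    case 3
    then have "j \<le> p" "p - j = j - 1" by auto
    then have "p choose (j - 1) = p choose j" using binomial_symmetric[of j p] by simp
    then have "ballot p j = 0" using 3 by (auto simp: ballot_def)
    then show ?thesis by simp
  next
    case 4
    then show ?thesis by (simp add: cheb_term_def)
  qed
qed

text \<open>Multiplication by \<open>2 * x\<close> sends index \<open>j\<close> to \<open>j\<close>
  and \<open>Suc j\<close>, and ballot numbers obey Pascal's rule.\<close>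

lemma power_cheb: "(2 * x) ^ p = (\<Sum>j\<le>p. ballot p j * cheb_term x s p j)"
proof (induction p)
  case 0
  show ?case by (simp add: ballot_def cheb_term_def)
next
  case (Suc p)
  let ?T = "cheb_term x s (Suc p)"
  have "(2 * x) ^ Suc p = (\<Sum>j\<le>p. ballot p j * (2 * x * cheb_term x s p j))"
    unfolding power_Suc Suc sum_distrib_left by (simp add: mult_ac)
  also have "\<dots> = (\<Sum>j\<le>p. ballot p j * ?T j) + (\<Sum>j\<le>p. ballot p j * ?T (Suc j))"
    unfolding cheb_term_mult distrib_left sum.distrib ..
  also have "(\<Sum>j\<le>p. ballot p j * ?T j) = (\<Sum>j\<le>Suc p. ballot p j * ?T j)"
    by (simp add: cheb_term_def)
  also have "\<dots> = ballot p 0 * ?T 0 + (\<Sum>j\<le>p. ballot p (Suc j) * ?T (Suc j))"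
    by (rule sum.atMost_Suc_shift)
  also have "\<dots> + (\<Sum>j\<le>p. ballot p j * ?T (Suc j)) =
     ballot (Suc p) 0 * ?T 0 + (\<Sum>j\<le>p. ballot (Suc p) (Suc j) * ?T (Suc j))"
  proof -
    have b: "ballot (Suc p) 0 = ballot p 0" "ballot (Suc p) (Suc j) = ballot p (Suc j) + ballot p j" for j
      by (cases j; simp add: ballot_def)+
    show ?thesis unfolding b distrib_right sum.distrib by simp
  qed
  also have "\<dots> = (\<Sum>j\<le>Suc p. ballot (Suc p) j * ?T j)"
    by (rule sum.atMost_Suc_shift[symmetric])
  finally show ?case .
qed

lemma ballot_eq:
  assumes "2 * j \<le> p"
  shows "ballot p j = fact p * real (p - 2 * j + 1) / (fact j * fact (p - j + 1))"
proof (cases j)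
  case 0
  then show ?thesis by (simp add: ballot_def)
next
  case (Suc i)
  define q where "q = p - j"
  have p: "p = q + j" using assms by (simp add: q_def)
  have 1: "real (p choose j) = fact p / (fact j * fact q)"
    using binomial_fact[of j p] assms by (simp add: q_def)
  have 2: "real (p choose i) = fact p / (fact i * fact (q + 1))"
    using binomial_fact[of i p] assms Suc by (simp add: q_def Suc_diff_Suc)
  have 3: "real (p - 2 * j + 1) = real (q + 1) - real j" using assms p by (simp add: of_nat_diff)
  have f: "(fact j :: real) = real j * fact i" "(fact (q + 1) :: real) = real (q + 1) * fact q" using Suc by simp_all
  have "ballot p j = fact p / (real j * fact i * fact q) - fact p / (fact i * (real (q + 1) * fact q))"
    unfolding f[symmetric] 1[symmetric] 2[symmetric] ballot_def using Suc by simp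
  also have "\<dots> = fact p * (real (q + 1) - real j) / (real j * fact i * (real (q + 1) * fact q))"
    using Suc by (simp add: field_simps del: of_nat_Suc of_nat_add fact_Suc)
  finally show ?thesis unfolding 3 q_def[symmetric] f .
qed

text \<open>Every power of \<open>2 * x\<close> is expanded by \<open>power_cheb\<close>, and the
  pairs \<open>(i, j)\<close> are collected according to \<open>h = i + j\<close>. The variable
  \<open>s\<close> is free: it enters the single components but not their sum.\<close>

lemma gegenbauer_zonal_parts:
  "gegenbauer l m x = (\<Sum>h\<le>m div 2. zonal_part l m h x s 1)"
proof -
  define g where "g i = (-1) ^ i * pochhammer l (m - i) / (fact i * fact (m - 2 * i))" for i
  have pw: "(2 * x) ^ p = (\<Sum>j\<le>p div 2. ballot p j * (s ^ j * cheb (p - 2 * j) x s))" for p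
  proof -
    have "(2 * x) ^ p = (\<Sum>j\<le>p. ballot p j * cheb_term x s p j)" by (rule power_cheb)
    also have "\<dots> = (\<Sum>j\<le>p div 2. ballot p j * (s ^ j * cheb (p - 2 * j) x s))"
      by (rule sum.mono_neutral_cong_right) (auto simp: cheb_term_def)
    finally show ?thesis .
  qed
  have "gegenbauer l m x = (\<Sum>i\<le>m div 2. g i * (\<Sum>j\<le>(m - 2 * i) div 2. ballot (m - 2 * i) j * (s ^ j * cheb (m - 2 * i - 2 * j) x s)))"
    unfolding gegenbauer_def g_def pw[symmetric] by simp
  also have "\<dots> = (\<Sum>i\<le>m div 2. \<Sum>j\<le>(m - 2 * i) div 2. g i * (ballot (m - 2 * i) j * (s ^ j * cheb (m - 2 * i - 2 * j) x s)))"
    by (simp only: sum_distrib_left)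
  also have "\<dots> = (\<Sum>(i, j)\<in>(SIGMA i:{..m div 2}. {..(m - 2 * i) div 2}). g i * (ballot (m - 2 * i) j * (s ^ j * cheb (m - 2 * i - 2 * j) x s)))"
    by (rule sum.Sigma) auto
  also have "\<dots> = (\<Sum>(h, i)\<in>(SIGMA h:{..m div 2}. {..h}). zonal_coeff l m h i * (s ^ (h - i) * cheb (m - 2 * h) x s))"
  proof (rule sum.reindex_bij_witness[where j="\<lambda>(i, j). (i + j, i)" and i="\<lambda>(h, i). (i, h - i)"])
    fix p assume "p \<in> (SIGMA i:{..m div 2}. {..(m - 2 * i) div 2})"
    then obtain i j where p: "p = (i, j)" "i \<le> m div 2" "j \<le> (m - 2 * i) div 2" by auto
    then have ij: "2 * i + 2 * j \<le> m" by auto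
    have e: "m - 2 * (i + j) = m - 2 * i - 2 * j" "i + j - i = j" "j + (m - 2 * i - 2 * j) + 1 = m - 2 * i - j + 1"
      using ij by auto
    have "g i * ballot (m - 2 * i) j = zonal_coeff l m (i + j) i"
      unfolding zonal_coeff_def e g_def using ij by (subst ballot_eq) (auto simp del: of_nat_Suc of_nat_add fact_Suc)
    then show "(case case p of (i, j) \<Rightarrow> (i + j, i) of (h, i) \<Rightarrow> zonal_coeff l m h i * (s ^ (h - i) * cheb (m - 2 * h) x s)) =
       (case p of (i, j) \<Rightarrow> g i * (ballot (m - 2 * i) j * (s ^ j * cheb (m - 2 * i - 2 * j) x s)))"
      unfolding p(1) by (simp only: prod.case e mult.assoc[symmetric])
  qed auto
  also have "\<dots> = (\<Sum>h\<le>m div 2. \<Sum>i\<le>h. zonal_coeff l m h i * (s ^ (h - i) * cheb (m - 2 * h) x s))"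
    by (rule sum.Sigma[symmetric]) auto
  finally show ?thesis unfolding zonal_part_def by simp
qed

text \<open>With \<open>k = m - 2 * h\<close>, \<open>\<rho> = cos r\<close> and
  \<open>s = \<rho>\<^sup>2\<close>, this times \<open>\<rho> ^ k\<close> is the amplitude
  \<open>a\<^sub>k(r)\<close> of the overview.\<close>

definition zonal_amplitude :: "real \<Rightarrow> nat \<Rightarrow> nat \<Rightarrow> real \<Rightarrow> real" where
  "zonal_amplitude l m h s = (\<Sum>i\<le>h. zonal_coeff l m h i * s ^ (h - i))"

lemma zonal_part_amplitude: "zonal_part l m h x s 1 = zonal_amplitude l m h s * cheb (m - 2 * h) x s"
  by (simp add: zonal_part_def zonal_amplitude_def sum_distrib_left sum_distrib_right mult_ac)

section \<open>Trigonometric and hyperbolic forms, and growth bounds\<close>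

lemma cheb_sin: "cheb k (\<rho> * cos \<eta>) (\<rho>\<^sup>2) * sin \<eta> = \<rho> ^ k * sin (real (k + 1) * \<eta>)"
proof (induction k rule: induct_nat_012)
  case (ge2 k)
  have s: "sin (real (Suc (Suc k) + 1) * \<eta>) = 2 * cos \<eta> * sin (real (Suc k + 1) * \<eta>) - sin (real (k + 1) * \<eta>)"
  proof -
    have "real (Suc (Suc k) + 1) * \<eta> = real (Suc k + 1) * \<eta> + \<eta>" "real (k + 1) * \<eta> = real (Suc k + 1) * \<eta> - \<eta>"
      by (simp_all add: algebra_simps)
    then show ?thesis by (simp add: sin_add sin_diff)
  qed
  have c: "cheb (Suc (Suc k)) (\<rho> * cos \<eta>) (\<rho>\<^sup>2) * sin \<eta> =
      2 * \<rho> * cos \<eta> * (cheb (Suc k) (\<rho> * cos \<eta>) (\<rho>\<^sup>2) * sin \<eta>) - \<rho>\<^sup>2 * (cheb k (\<rho> * cos \<eta>) (\<rho>\<^sup>2) * sin \<eta>)"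
    by (simp add: algebra_simps)
  show ?case unfolding c s ge2 by (simp add: algebra_simps power2_eq_square)
qed (simp_all add: sin_double)

text \<open>The identity \<open>cheb_sin\<close> at an imaginary angle. It is what links the heat
  kernel series beyond 1 with the angular components.\<close>

lemma cheb_sinh: "cheb k (\<rho> * cosh y) (\<rho>\<^sup>2) * sinh y = \<rho> ^ k * sinh (real (k + 1) * (y::real))"
proof (induction k rule: induct_nat_012)
  case (ge2 k)
  have s: "sinh (real (Suc (Suc k) + 1) * y) = 2 * cosh y * sinh (real (Suc k + 1) * y) - sinh (real (k + 1) * y)"
  proof -
    have "real (Suc (Suc k) + 1) * y = real (Suc k + 1) * y + y" "real (k + 1) * y = real (Suc k + 1) * y - y"
      by (simp_all add: algebra_simps)
    then show ?thesis by (simp add: sinh_add sinh_diff)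
  qed
  have c: "cheb (Suc (Suc k)) (\<rho> * cosh y) (\<rho>\<^sup>2) * sinh y =
      2 * \<rho> * cosh y * (cheb (Suc k) (\<rho> * cosh y) (\<rho>\<^sup>2) * sinh y) - \<rho>\<^sup>2 * (cheb k (\<rho> * cosh y) (\<rho>\<^sup>2) * sinh y)"
    by (simp add: algebra_simps)
  show ?case unfolding c s ge2 by (simp add: algebra_simps power2_eq_square)
qed (simp_all add: sinh_double)

lemma abs_sin_multiple_le: "\<bar>sin (real k * \<eta>)\<bar> \<le> real k * \<bar>sin \<eta>\<bar>"
proof (induction k)
  case (Suc k)
  have "sin (real (Suc k) * \<eta>) = sin (real k * \<eta>) * cos \<eta> + cos (real k * \<eta>) * sin \<eta>"
  proof -
    have "real (Suc k) * \<eta> = real k * \<eta> + \<eta>" by (simp add: algebra_simps)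
    then show ?thesis by (simp only: sin_add)
  qed
  also have "\<bar>\<dots>\<bar> \<le> \<bar>sin (real k * \<eta>)\<bar> * \<bar>cos \<eta>\<bar> + \<bar>cos (real k * \<eta>)\<bar> * \<bar>sin \<eta>\<bar>"
    by (rule order_trans[OF abs_triangle_ineq]) (simp add: abs_mult)
  also have "\<dots> \<le> (real k * \<bar>sin \<eta>\<bar>) * 1 + 1 * \<bar>sin \<eta>\<bar>"
    using Suc by (intro add_mono mult_mono) auto
  finally show ?case by (simp add: algebra_simps)
qed simp

lemma cheb_sqrt: "cheb k \<rho> (\<rho>\<^sup>2) = real (k + 1) * \<rho> ^ k"
  by (induction k rule: induct_nat_012) (simp_all add: algebra_simps power2_eq_square)

text \<open>Where \<open>sin \<eta>\<close> vanishes, \<open>cheb_sin\<close> cannot be divided by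
  it; there the argument is \<open>\<rho>\<close> or \<open>- \<rho>\<close>, and
  \<open>cheb_sqrt\<close> gives equality.\<close>

lemma abs_cheb_le:
  assumes "\<rho> \<ge> 0" shows "\<bar>cheb k (\<rho> * cos \<eta>) (\<rho>\<^sup>2)\<bar> \<le> real (k + 1) * \<rho> ^ k"
proof (cases "sin \<eta> = 0")
  case True
  then have "cos \<eta> = 1 \<or> cos \<eta> = -1" using sin_zero_abs_cos_one by fastforce
  then have "\<rho>\<^sup>2 = (\<rho> * cos \<eta>)\<^sup>2" by auto
  then have "cheb k (\<rho> * cos \<eta>) (\<rho>\<^sup>2) = real (k + 1) * (\<rho> * cos \<eta>) ^ k" using cheb_sqrt by metis
  moreover have "\<bar>cos \<eta>\<bar> = 1" using \<open>cos \<eta> = 1 \<or> cos \<eta> = -1\<close> by auto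
  ultimately show ?thesis using assms by (simp add: abs_mult power_abs)
next
  case False
  have "\<bar>cheb k (\<rho> * cos \<eta>) (\<rho>\<^sup>2)\<bar> * \<bar>sin \<eta>\<bar> = \<rho> ^ k * \<bar>sin (real (k + 1) * \<eta>)\<bar>"
    using cheb_sin[of k \<rho> \<eta>] assms by (metis abs_mult abs_of_nonneg zero_le_power)
  also have "\<dots> \<le> \<rho> ^ k * (real (k + 1) * \<bar>sin \<eta>\<bar>)"
    using assms by (intro mult_left_mono abs_sin_multiple_le) auto
  finally show ?thesis using False by (simp add: mult_ac)
qed

lemma sinh_multiple_le:
  assumes "(z::real) \<ge> 0" shows "sinh (real (Suc k) * z) \<le> real (Suc k) * (exp (real k * z) * sinh z)"
proof (induction k)
  case (Suc k)
  have ch: "cosh u \<le> exp u" if "u \<ge> 0" for u :: real using that by (simp add: cosh_def)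
  have s: "sinh z \<ge> 0" using assms by simp
  have "sinh (real (Suc (Suc k)) * z) = sinh (real (Suc k) * z) * cosh z + cosh (real (Suc k) * z) * sinh z"
  proof -
    have "real (Suc (Suc k)) * z = real (Suc k) * z + z" by (simp add: algebra_simps)
    then show ?thesis by (simp only: sinh_add)
  qed
  also have "\<dots> \<le> real (Suc k) * (exp (real k * z) * sinh z) * exp z + exp (real (Suc k) * z) * sinh z"
    using assms s by (intro add_mono mult_mono Suc ch) (auto intro: mult_nonneg_nonneg)
  also have "\<dots> = real (Suc (Suc k)) * (exp (real (Suc k) * z) * sinh z)"
    by (simp add: exp_add algebra_simps)
  finally show ?case .
qed simp

text \<open>The argument is a cosine when \<open>x \<le> 1\<close>, and otherwise
  \<open>cosh z\<close> with \<open>0 < z \<le> y\<close>.\<close>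

lemma abs_cheb_exp_le:
  assumes "-1 \<le> x" "x \<le> cosh y" "y \<ge> 0"
  shows "\<bar>cheb k x 1\<bar> \<le> real (k + 1) * exp (real k * y)"
proof (cases "x \<le> 1")
  case True
  have "\<bar>cheb k x 1\<bar> \<le> real (k + 1)"
    using abs_cheb_le[of 1 k "arccos x"] assms True by (simp add: cos_arccos)
  also have "\<dots> \<le> real (k + 1) * exp (real k * y)" using mult_left_mono[of 1 "exp (real k * y)" "real (k + 1)"] assms(3) by simp
  finally show ?thesis .
next
  case False
  define z where "z = arcosh x"
  have z: "cosh z = x" "z > 0" using False by (auto simp: z_def)
  have zy: "z \<le> y" using assms z by (metis cosh_real_nonneg_le_iff less_imp_le)
  have s: "sinh z > 0" using z by simp
  have c: "cheb k x 1 * sinh z = sinh (real (k + 1) * z)" using cheb_sinh[of k 1 z] z by simp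
  then have "cheb k x 1 * sinh z \<ge> 0" using z by simp
  then have "cheb k x 1 \<ge> 0" using s by (simp add: zero_le_mult_iff)
  moreover have "cheb k x 1 * sinh z \<le> real (Suc k) * exp (real k * z) * sinh z"
    unfolding c using sinh_multiple_le[of z k] z by (simp add: mult_ac)
  ultimately have "\<bar>cheb k x 1\<bar> \<le> real (Suc k) * exp (real k * z)" using s by simp
  also have "\<dots> \<le> real (Suc k) * exp (real k * y)" using zy by (intro mult_left_mono) (auto intro: mult_left_mono)
  finally show ?thesis by simp
qed

lemma gegenbauer_0: "gegenbauer 0 m x = (if m = 0 then 1 else 0)"
proof (cases m)
  case (Suc k)
  have "pochhammer (0::real) (m - i) = 0" if "i \<le> m div 2" for i
  proof -
    have "m - i \<noteq> 0" using that Suc by auto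
    then show ?thesis by (simp add: pochhammer_0_left)
  qed
  then show ?thesis unfolding gegenbauer_def using Suc by simp
qed (simp add: gegenbauer_def)

text \<open>Coefficientwise form of multiplying the generating function \<open>(1 - 2 x z + z\<^sup>2) powr (- \<nu> - 1)\<close> by \<open>1 - 2 x z + z\<^sup>2\<close>.\<close>

lemma gegenbauer_contiguous:
  "gegenbauer (\<nu> + 1) (Suc (Suc m)) x - 2 * x * gegenbauer (\<nu> + 1) (Suc m) x + gegenbauer (\<nu> + 1) m x
     = gegenbauer \<nu> (Suc (Suc m)) x"
  "gegenbauer (\<nu> + 1) 1 x - 2 * x * gegenbauer (\<nu> + 1) 0 x = gegenbauer \<nu> 1 x"
  "gegenbauer (\<nu> + 1) 0 x = gegenbauer \<nu> 0 x"
proof -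
  let ?M = "Suc (Suc m)"
  define c where "c \<nu> M k = (if 2 * k \<le> M then (-1) ^ k * pochhammer \<nu> (M - k) / (fact k * fact (M - 2 * k)) else 0)" for \<nu> :: real and M k :: nat
  have g: "gegenbauer \<nu> M x = (\<Sum>k\<le>N. c \<nu> M k * (2 * x) ^ (M - 2 * k))" if "M div 2 \<le> N" for \<nu> M N
    unfolding gegenbauer_def by (rule sum.mono_neutral_cong_left) (use that in \<open>auto simp: c_def\<close>)
  have g2: "gegenbauer (\<nu> + 1) m x = (\<Sum>k\<le>?M. (if k = 0 then 0 else c (\<nu> + 1) m (k - 1)) * (2 * x) ^ (?M - 2 * k))"
    by (subst sum.atMost_Suc_shift) (simp add: g[of m "Suc m"])
  have gs: "gegenbauer (\<nu> + 1) (Suc m) x = (\<Sum>k\<le>?M. c (\<nu> + 1) (Suc m) k * (2 * x) ^ (Suc m - 2 * k))"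
    by (rule g) simp
  have g1: "2 * x * gegenbauer (\<nu> + 1) (Suc m) x = (\<Sum>k\<le>?M. c (\<nu> + 1) (Suc m) k * (2 * x) ^ (?M - 2 * k))"
    unfolding gs sum_distrib_left
  proof (rule sum.cong[OF refl])
    fix k
    show "2 * x * (c (\<nu> + 1) (Suc m) k * (2 * x) ^ (Suc m - 2 * k)) = c (\<nu> + 1) (Suc m) k * (2 * x) ^ (?M - 2 * k)"
    proof (cases "2 * k \<le> Suc m")
      case True
      then have "?M - 2 * k = Suc (Suc m - 2 * k)" by auto
      then show ?thesis by simp
    qed (simp add: c_def)
  qed
  have g0: "gegenbauer (\<nu> + 1) ?M x = (\<Sum>k\<le>?M. c (\<nu> + 1) ?M k * (2 * x) ^ (?M - 2 * k))"
    by (rule g) simp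
  have coeff: "c (\<nu> + 1) ?M k - c (\<nu> + 1) (Suc m) k + (if k = 0 then 0 else c (\<nu> + 1) m (k - 1)) = c \<nu> ?M k" for k
  proof (cases "2 * k \<le> ?M")
    case False
    then show ?thesis by (auto simp: c_def)
  next
    case True
    define q where "q = Suc m - k"
    define r where "r = ?M - 2 * k"
    have q: "?M - k = Suc q" "Suc m - k = q" using True by (auto simp: q_def)
    define D where "D = (-1) ^ k * pochhammer (\<nu> + 1) q / (fact k * fact r)"
    have 1: "c (\<nu> + 1) ?M k = D * (\<nu> + 1 + real q)"
      unfolding c_def q using True by (simp add: pochhammer_Suc D_def r_def)
    have 2: "c (\<nu> + 1) (Suc m) k = D * real r"
    proof (cases "2 * k \<le> Suc m")
      case True
      then have "r = Suc (Suc m - 2 * k)" by (auto simp: r_def)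
      then show ?thesis using True unfolding c_def q D_def by simp
    next
      case False
      then have "r = 0" using True by (auto simp: r_def)
      then show ?thesis using False by (simp add: c_def)
    qed
    have 3: "(if k = 0 then 0 else c (\<nu> + 1) m (k - 1)) = - (D * real k)"
    proof (cases k)
      case (Suc j)
      have "m - j = q" "m - 2 * j = r" using Suc by (auto simp: q_def r_def)
      then show ?thesis using Suc True unfolding c_def D_def by simp
    qed simp
    have 4: "c \<nu> ?M k = D * \<nu>"
      unfolding c_def q using True by (simp add: pochhammer_rec D_def r_def)
    have e: "real q = real r + real k - 1" using True by (auto simp: q_def r_def)
    show ?thesis unfolding 1 2 3 4 e by (simp add: algebra_simps)
  qed
  have "gegenbauer (\<nu> + 1) ?M x - 2 * x * gegenbauer (\<nu> + 1) (Suc m) x + gegenbauer (\<nu> + 1) m x =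
    (\<Sum>k\<le>?M. (c (\<nu> + 1) ?M k - c (\<nu> + 1) (Suc m) k + (if k = 0 then 0 else c (\<nu> + 1) m (k - 1))) * (2 * x) ^ (?M - 2 * k))"
    unfolding g0 g1 g2 sum_subtractf[symmetric] sum.distrib[symmetric] by (simp only: left_diff_distrib distrib_right)
  also have "\<dots> = gegenbauer \<nu> ?M x" unfolding coeff by (rule g[symmetric]) simp
  finally show "gegenbauer (\<nu> + 1) ?M x - 2 * x * gegenbauer (\<nu> + 1) (Suc m) x + gegenbauer (\<nu> + 1) m x
     = gegenbauer \<nu> ?M x" .
qed (simp_all add: gegenbauer_def algebra_simps)

text \<open>The coefficientwise product of the generating function with exponent
  \<open>- \<nu>\<close> and the generating function \<open>1 / (1 - 2 x z + z^2)\<close> of the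
  Chebyshev polynomials.\<close>

lemma gegenbauer_convolution:
  "gegenbauer (\<nu> + 1) m x = (\<Sum>j\<le>m. cheb j x 1 * gegenbauer \<nu> (m - j) x)"
proof (induction m rule: induct_nat_012)
  case 0
  show ?case by (simp add: gegenbauer_contiguous(3))
next
  case 1
  show ?case using gegenbauer_contiguous(2)[of \<nu> x] by (simp add: gegenbauer_contiguous(3))
next
  case (ge2 m)
  let ?g = "\<lambda>j. gegenbauer \<nu> j x" and ?C = "\<lambda>j. cheb j x 1"
  have "(\<Sum>j\<le>Suc (Suc m). ?C j * ?g (Suc (Suc m) - j)) =
     ?g (Suc (Suc m)) + (2 * x * ?g (Suc m) + (\<Sum>j\<le>m. ?C (Suc (Suc j)) * ?g (m - j)))"
    by (subst sum.atMost_Suc_shift, subst sum.atMost_Suc_shift) simp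
  also have "(\<Sum>j\<le>m. ?C (Suc (Suc j)) * ?g (m - j)) = 2 * x * (\<Sum>j\<le>m. ?C (Suc j) * ?g (m - j)) - (\<Sum>j\<le>m. ?C j * ?g (m - j))"
    unfolding sum_distrib_left sum_subtractf[symmetric] by (intro sum.cong refl) (simp add: algebra_simps)
  also have "?g (Suc (Suc m)) + (2 * x * ?g (Suc m) + (2 * x * (\<Sum>j\<le>m. ?C (Suc j) * ?g (m - j)) - (\<Sum>j\<le>m. ?C j * ?g (m - j)))) =
     ?g (Suc (Suc m)) + 2 * x * (\<Sum>j\<le>Suc m. ?C j * ?g (Suc m - j)) - (\<Sum>j\<le>m. ?C j * ?g (m - j))"
  proof -
    have "(\<Sum>j\<le>Suc m. ?C j * ?g (Suc m - j)) = ?g (Suc m) + (\<Sum>j\<le>m. ?C (Suc j) * ?g (m - j))"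
      by (subst sum.atMost_Suc_shift) simp
    then show ?thesis by (simp only:) (simp add: algebra_simps del: cheb.simps)
  qed
  also have "\<dots> = ?g (Suc (Suc m)) + 2 * x * gegenbauer (\<nu> + 1) (Suc m) x - gegenbauer (\<nu> + 1) m x"
    unfolding ge2 ..
  also have "\<dots> = gegenbauer (\<nu> + 1) (Suc (Suc m)) x" using gegenbauer_contiguous(1)[of \<nu> m x] by linarith
  finally show ?case ..
qed

text \<open>Each unit of \<open>l\<close> costs one convolution: \<open>m + 1\<close> summands, with
  a Chebyshev factor of at most \<open>m + 1\<close> times an exponential. Hence the exponent
  \<open>2 * l\<close>.\<close>

lemma abs_gegenbauer_le:
  assumes "-1 \<le> x" "x \<le> cosh y" "y \<ge> 0"
  shows "\<bar>gegenbauer (real l) m x\<bar> \<le> real (m + 1) ^ (2 * l) * exp (real m * y)"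
proof (induction l arbitrary: m)
  case 0
  show ?case using assms by (simp add: gegenbauer_0)
next
  case (Suc l)
  have "\<bar>gegenbauer (real (Suc l)) m x\<bar> = \<bar>\<Sum>j\<le>m. cheb j x 1 * gegenbauer (real l) (m - j) x\<bar>"
    using gegenbauer_convolution[of "real l" m x] by (simp add: add.commute)
  also have "\<dots> \<le> (\<Sum>j\<le>m. \<bar>cheb j x 1\<bar> * \<bar>gegenbauer (real l) (m - j) x\<bar>)"
    by (rule order_trans[OF sum_abs]) (simp add: abs_mult)
  also have "\<dots> \<le> (\<Sum>j\<le>m. real (m + 1) * real (m + 1) ^ (2 * l) * exp (real m * y))"
  proof (rule sum_mono)
    fix j assume j: "j \<in> {..m}"
    have "\<bar>cheb j x 1\<bar> * \<bar>gegenbauer (real l) (m - j) x\<bar> \<le>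
       (real (j + 1) * exp (real j * y)) * (real (m - j + 1) ^ (2 * l) * exp (real (m - j) * y))"
      by (intro mult_mono abs_cheb_exp_le assms Suc) auto
    also have "\<dots> = real (j + 1) * real (m - j + 1) ^ (2 * l) * exp (real m * y)"
    proof -
      have "exp (real j * y) * exp (real (m - j) * y) = exp (real m * y)"
        using j by (simp add: exp_add[symmetric] of_nat_diff algebra_simps)
      then show ?thesis by (simp only: mult_ac) (simp only: mult.assoc[symmetric])
    qed
    also have "\<dots> \<le> real (m + 1) * real (m + 1) ^ (2 * l) * exp (real m * y)"
      using j by (intro mult_mono power_mono) auto
    finally show "\<bar>cheb j x 1\<bar> * \<bar>gegenbauer (real l) (m - j) x\<bar> \<le> real (m + 1) * real (m + 1) ^ (2 * l) * exp (real m * y)" .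
  qed
  also have "\<dots> = real (m + 1) ^ (2 * Suc l) * exp (real m * y)" by (simp add: mult_ac)
  finally show ?case .
qed

section \<open>Sine orthogonality and bounds for the single components\<close>

lemma integral_cos_multiple:
  assumes "(c::real) \<noteq> 0" "sin (c * pi) = 0"
  shows "((\<lambda>\<eta>. cos (c * \<eta>)) has_integral 0) {0..pi}"
proof -
  have "((\<lambda>\<eta>. cos (c * \<eta>)) has_integral (sin (c * pi) / c - sin (c * 0) / c)) {0..pi}"
    by (rule fundamental_theorem_of_calculus)
      (use assms(1) in \<open>auto intro!: derivative_eq_intros simp: has_real_derivative_iff_has_vector_derivative[symmetric]\<close>)
  then show ?thesis using assms by simp
qed

lemma integral_sin_sin:
  assumes "a > 0" "b > (0::nat)"
  shows "((\<lambda>\<eta>. sin (real a * \<eta>) * sin (real b * \<eta>)) has_integral (if a = b then pi / 2 else 0)) {0..pi}"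
proof -
  have eq: "sin (real a * \<eta>) * sin (real b * \<eta>) = (cos ((real a - real b) * \<eta>) - cos ((real a + real b) * \<eta>)) / 2" for \<eta>
    by (simp add: sin_times_sin algebra_simps)
  have s: "sin ((real a + real b) * pi) = 0" "sin ((real a - real b) * pi) = 0"
    by (simp_all add: algebra_simps sin_add sin_diff)
  have 1: "((\<lambda>\<eta>. cos ((real a + real b) * \<eta>)) has_integral 0) {0..pi}"
    using assms by (intro integral_cos_multiple s) auto
  have 2: "((\<lambda>\<eta>. cos ((real a - real b) * \<eta>)) has_integral (if a = b then pi else 0)) {0..pi}"
    using integral_cos_multiple[OF _ s(2)] has_integral_const_real[of "1::real" 0 pi] by auto
  show ?thesis unfolding eq
    using has_integral_divide[OF has_integral_diff[OF 2 1], of 2] by (simp split: if_splits)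
qed

text \<open>The coefficients alternate in sign, which makes a direct estimate poor. But the quantity
  is a sine coefficient of \<open>gegenbauer (real l) m (\<rho> * cos \<eta>) * sin \<eta>\<close>,
  so it inherits the bound for the full polynomial.\<close>

lemma zonal_amplitude_bound:
  assumes "0 \<le> \<rho>" "\<rho> \<le> 1" "2 * h \<le> m"
  shows "\<bar>zonal_amplitude (real l) m h (\<rho>\<^sup>2) * \<rho> ^ (m - 2 * h)\<bar> \<le> 2 * real (m + 1) ^ (2 * l)"
proof -
  define A where "A i = zonal_amplitude (real l) m i (\<rho>\<^sup>2) * \<rho> ^ (m - 2 * i)" for i
  define F where "F \<eta> = gegenbauer (real l) m (\<rho> * cos \<eta>) * sin \<eta> * sin (real (m - 2 * h + 1) * \<eta>)" for \<eta>
  have F: "F \<eta> = (\<Sum>i\<le>m div 2. A i * (sin (real (m - 2 * i + 1) * \<eta>) * sin (real (m - 2 * h + 1) * \<eta>)))" for \<eta>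
  proof -
    have "gegenbauer (real l) m (\<rho> * cos \<eta>) * sin \<eta> =
       (\<Sum>i\<le>m div 2. zonal_amplitude (real l) m i (\<rho>\<^sup>2) * (cheb (m - 2 * i) (\<rho> * cos \<eta>) (\<rho>\<^sup>2) * sin \<eta>))"
      unfolding gegenbauer_zonal_parts[of _ _ _ "\<rho>\<^sup>2"] zonal_part_amplitude by (simp add: sum_distrib_right mult.assoc)
    also have "\<dots> = (\<Sum>i\<le>m div 2. A i * sin (real (m - 2 * i + 1) * \<eta>))"
      unfolding cheb_sin A_def by (simp add: mult.assoc)
    finally show ?thesis unfolding F_def by (simp add: sum_distrib_right mult.assoc)
  qed
  have "(F has_integral (\<Sum>i\<le>m div 2. A i * (if m - 2 * i + 1 = m - 2 * h + 1 then pi / 2 else 0))) {0..pi}"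
    unfolding F by (intro has_integral_sum has_integral_mult_right integral_sin_sin) auto
  also have "(\<Sum>i\<le>m div 2. A i * (if m - 2 * i + 1 = m - 2 * h + 1 then pi / 2 else 0)) =
      (\<Sum>i\<le>m div 2. if i = h then A i * (pi / 2) else 0)"
    using assms(3) by (intro sum.cong refl) auto
  also have "\<dots> = A h * (pi / 2)" using assms(3) by simp
  finally have int: "(F has_integral A h * (pi / 2)) (cbox 0 pi)" by simp
  have "norm (F \<eta>) \<le> real (m + 1) ^ (2 * l)" for \<eta>
  proof -
    have c: "\<bar>\<rho> * cos \<eta>\<bar> \<le> 1" using assms by (simp add: abs_mult mult_le_one)
    have "\<bar>gegenbauer (real l) m (\<rho> * cos \<eta>)\<bar> \<le> real (m + 1) ^ (2 * l) * exp (real m * 0)"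
      by (rule abs_gegenbauer_le) (use c in auto)
    then have "\<bar>gegenbauer (real l) m (\<rho> * cos \<eta>)\<bar> * \<bar>sin \<eta>\<bar> * \<bar>sin (real (m - 2 * h + 1) * \<eta>)\<bar> \<le> real (m + 1) ^ (2 * l) * 1 * 1"
      by (intro mult_mono) auto
    then show ?thesis unfolding F_def by (simp add: abs_mult)
  qed
  \<comment> \<open>The interval has length \<open>pi\<close>, while the squared norm of the sine is
    \<open>pi / 2\<close>; this is the factor 2 of the claim.\<close>
  then have "norm (A h * (pi / 2)) \<le> real (m + 1) ^ (2 * l) * measure lborel (cbox 0 pi)"
    by (intro has_integral_bound[OF _ int]) auto
  then have "\<bar>A h\<bar> * (pi / 2) \<le> 2 * real (m + 1) ^ (2 * l) * (pi / 2)" by (simp add: abs_mult)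
  then show ?thesis unfolding A_def[symmetric] by (rule mult_right_le_imp_le) simp
qed

lemma zonal_part_bound:
  assumes "0 \<le> \<rho>" "\<rho> \<le> 1" "2 * h \<le> m"
  shows "\<bar>zonal_part (real l) m h (\<rho> * cos \<eta>) (\<rho>\<^sup>2) 1\<bar> \<le> 2 * real (m + 1) ^ (2 * l + 1)"
proof -
  have "\<bar>zonal_part (real l) m h (\<rho> * cos \<eta>) (\<rho>\<^sup>2) 1\<bar> \<le>
     \<bar>zonal_amplitude (real l) m h (\<rho>\<^sup>2)\<bar> * (real (m - 2 * h + 1) * \<rho> ^ (m - 2 * h))"
    unfolding zonal_part_amplitude abs_mult by (intro mult_left_mono abs_cheb_le assms) auto
  also have "\<dots> = \<bar>zonal_amplitude (real l) m h (\<rho>\<^sup>2) * \<rho> ^ (m - 2 * h)\<bar> * real (m - 2 * h + 1)"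
    using assms by (simp add: abs_mult)
  also have "\<dots> \<le> (2 * real (m + 1) ^ (2 * l)) * real (m + 1)"
    by (intro mult_mono zonal_amplitude_bound assms) auto
  finally show ?thesis by (simp add: mult_ac)
qed

section \<open>Completeness of zonal polynomials\<close>

text \<open>If \<open>u y > 0\<close>, then \<open>u (sgn x)\<close> is positive on an open subset
  of the ball, which has positive Lebesgue measure.\<close>

lemma sphere_integral_zero_imp:
  fixes u :: "'a::euclidean_space \<Rightarrow> real"
  assumes c: "continuous_on (sphere 0 1) u" and nn: "\<And>y. norm y = 1 \<Longrightarrow> u y \<ge> 0"
    and z: "integral\<^sup>L sphere_volume u = 0" and y: "norm y = 1"
  shows "u y = 0"
proof (rule ccontr)
  assume "u y \<noteq> 0"
  then have pos: "u y > 0" using nn[OF y] by simp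
  let ?A = "cball 0 1 - {0} :: 'a set" and ?U = "ball 0 1 - {0} :: 'a set"
  have int: "integrable lborel (\<lambda>x. indicator ?A x *\<^sub>R u (sgn x))"
    using sphere_integral_eq(2)[OF c] unfolding set_integrable_def .
  have "(LINT x|lborel. indicator ?A x *\<^sub>R u (sgn x)) = 0"
    using sphere_integral_eq(1)[OF c] z unfolding set_lebesgue_integral_def by simp
  moreover have "AE x in lborel. 0 \<le> indicator ?A x *\<^sub>R u (sgn x)"
    by (auto simp: indicator_def norm_sgn intro!: nn)
  ultimately have ae: "AE x in lborel. indicator ?A x *\<^sub>R u (sgn x) = 0"
    using integral_nonneg_eq_0_iff_AE[OF int] by simp
  have cu: "continuous_on ?U (\<lambda>x. u (sgn x))"
    by (rule continuous_on_compose2[OF c]) (auto intro!: continuous_on_sgn continuous_on_id simp: norm_sgn split: if_splits)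
  have oU: "open ?U" by (intro open_Diff) auto
  define V where "V = (\<lambda>x. u (sgn x)) -` {0<..} \<inter> ?U"
  have oV: "open V"
    using continuous_openin_preimage_gen[OF cu open_greaterThan[of 0]] oU openin_open_eq[OF oU]
    by (auto simp: V_def Int_commute)
  \<comment> \<open>Halving \<open>y\<close> gives an interior point of the punctured ball on the
    same ray.\<close>
  have "(1/2) *\<^sub>R y \<in> V"
    using y pos by (auto simp: V_def sgn_scaleR sgn_div_norm)
  then obtain e where e: "e > 0" "ball ((1/2) *\<^sub>R y) e \<subseteq> V" using oV open_contains_ball by blast
  obtain N where N: "{x \<in> space lborel. \<not> indicator ?A x *\<^sub>R u (sgn x) = 0} \<subseteq> N" "emeasure lborel N = 0" "N \<in> sets lborel"
    using AE_E[OF ae] by blast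
  have "ball ((1/2) *\<^sub>R y) e \<subseteq> N"
  proof
    fix x assume "x \<in> ball ((1/2) *\<^sub>R y) e"
    then have "x \<in> V" using e by blast
    then have "indicator ?A x *\<^sub>R u (sgn x) \<noteq> 0" by (auto simp: V_def)
    then show "x \<in> N" using N(1) by auto
  qed
  then have "emeasure lborel (ball ((1/2) *\<^sub>R y) e) = 0"
    using emeasure_mono[of _ N lborel] N by (metis le_zero_eq)
  moreover have "emeasure lborel (ball ((1/2) *\<^sub>R y) e) > 0"
    using e(1) by (subst emeasure_ball) auto
  ultimately show False by simp
qed

lemma linear_form_inner:
  assumes "bounded_linear (f :: 'a::euclidean_space \<Rightarrow> real)"
  obtains c where "f = (\<lambda>y. c \<bullet> y)"
proof
  interpret bounded_linear f by fact
  show "f = (\<lambda>y. (\<Sum>b\<in>Basis. f b *\<^sub>R b) \<bullet> y)"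
  proof
    fix y
    have "f y = f (\<Sum>b\<in>Basis. (y \<bullet> b) *\<^sub>R b)" by (simp add: euclidean_representation)
    also have "\<dots> = (\<Sum>b\<in>Basis. (y \<bullet> b) * f b)" by (simp add: sum scaleR)
    also have "\<dots> = (\<Sum>b\<in>Basis. f b *\<^sub>R b) \<bullet> y" by (simp add: inner_sum_left inner_commute[of y] mult.commute)
    finally show "f y = (\<Sum>b\<in>Basis. f b *\<^sub>R b) \<bullet> y" .
  qed
qed

text \<open>Polarisation: powers of linear forms generate all polynomials, so \<open>g\<close> is
  orthogonal to every polynomial. By the Stone-Weierstrass theorem it is then orthogonal to
  itself.\<close>

lemma sphere_orthogonal_to_powers_imp_zero:
  fixes g :: "'a::euclidean_space \<Rightarrow> real"
  assumes g: "continuous_on (sphere 0 1) g"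
    and orth: "\<And>a j. (LINT y|sphere_volume. g y * (a \<bullet> y) ^ j) = 0"
    and y: "norm y = 1"
  shows "g y = 0"
proof -
  \<comment> \<open>Orthogonality to \<open>(a \<bullet> y) ^ j * f y\<close> for all
    \<open>a\<close> and \<open>j\<close> at once is what survives multiplication of
    \<open>f\<close> by a linear form.\<close>
  define W where "W f \<longleftrightarrow> rpoly f \<and> (\<forall>a j. (LINT y|sphere_volume. g y * ((a \<bullet> y) ^ j * f y)) = 0)" for f
  have cont: "continuous_on (sphere 0 1) (\<lambda>y. g y * f y)" if "rpoly f" for f
    by (intro continuous_intros g rpoly_continuous that)
  have W1: "W (\<lambda>y. 1)" using orth by (simp add: W_def)
  have Wlin: "W (\<lambda>y. (c \<bullet> y) * f y)" if f: "W f" for c f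
  proof -
    have pf: "rpoly f" using f by (simp add: W_def)
    have "(LINT y|sphere_volume. g y * ((a \<bullet> y) ^ j * ((c \<bullet> y) * f y))) = 0" for a j
    proof -
      \<comment> \<open>The coefficients, as a polynomial in \<open>s\<close>, of the integral
        against the power \<open>Suc j\<close> of the form \<open>s *\<^sub>R c + a\<close>. That
        integral vanishes for all \<open>s\<close>, so the linear coefficient \<open>b 1\<close> is
        0, and it contains exactly one factor \<open>c \<bullet> y\<close>.\<close>
      define b where "b i = real (Suc j choose i) * (LINT y|sphere_volume. g y * ((c \<bullet> y) ^ i * (a \<bullet> y) ^ (Suc j - i) * f y))" for i
      have "(\<Sum>i\<le>Suc j. b i * s ^ i) = 0" for s
      proof -
        have "(\<Sum>i\<le>Suc j. b i * s ^ i) =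
          (\<Sum>i\<le>Suc j. LINT y|sphere_volume. g y * (real (Suc j choose i) * s ^ i * ((c \<bullet> y) ^ i * (a \<bullet> y) ^ (Suc j - i) * f y)))"
        proof (intro sum.cong refl)
          fix i
          have e: "(LINT y|sphere_volume. g y * (k * F y)) = k * (LINT y|sphere_volume. g y * F y)" for k and F :: "'a \<Rightarrow> real"
            by (subst mult.left_commute) simp
          show "b i * s ^ i = (LINT y|sphere_volume. g y * (real (Suc j choose i) * s ^ i * ((c \<bullet> y) ^ i * (a \<bullet> y) ^ (Suc j - i) * f y)))"
            unfolding b_def e by simp
        qed
        also have "\<dots> = (LINT y|sphere_volume. (\<Sum>i\<le>Suc j. g y * (real (Suc j choose i) * s ^ i * ((c \<bullet> y) ^ i * (a \<bullet> y) ^ (Suc j - i) * f y))))"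
          by (rule sphere_integral_sum[symmetric], rule cont) (intro rpoly_cmult rpoly_mult rpoly_power rpoly_inner_left pf)
        also have "\<dots> = (LINT y|sphere_volume. g y * (((s *\<^sub>R c + a) \<bullet> y) ^ Suc j * f y))"
        proof (rule Bochner_Integration.integral_cong[OF refl])
          fix y
          have "((s *\<^sub>R c + a) \<bullet> y) ^ Suc j = (\<Sum>i\<le>Suc j. real (Suc j choose i) * (s * (c \<bullet> y)) ^ i * (a \<bullet> y) ^ (Suc j - i))"
            unfolding inner_add_left inner_scaleR_left by (rule binomial_ring)
          then show "(\<Sum>i\<le>Suc j. g y * (real (Suc j choose i) * s ^ i * ((c \<bullet> y) ^ i * (a \<bullet> y) ^ (Suc j - i) * f y))) =
             g y * (((s *\<^sub>R c + a) \<bullet> y) ^ Suc j * f y)"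
            by (simp only: sum_distrib_left sum_distrib_right power_mult_distrib mult_ac)
        qed
        also have "\<dots> = 0" using f unfolding W_def by blast
        finally show ?thesis .
      qed
      then have "b 1 = 0" using polyfun_eq_0[of b "Suc j"] by auto
      then show ?thesis by (simp add: b_def mult_ac)
    qed
    then show ?thesis using pf by (auto simp: W_def)
  qed
  have Wp: "W (\<lambda>y. p y * f y)" if "rpoly p" "W f" for p f
    using that
  proof (induction arbitrary: f rule: real_polynomial_function.induct)
    case (linear p)
    then show ?case using Wlin linear_form_inner by metis
  next
    case (const c)
    have "(LINT y|sphere_volume. g y * ((a \<bullet> y) ^ j * (c * f y))) = c * (LINT y|sphere_volume. g y * ((a \<bullet> y) ^ j * f y))" for a j
      by (simp add: mult_ac flip: Bochner_Integration.integral_mult_right_zero)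
    then show ?case using const by (auto simp: W_def)
  next
    case (add p q)
    have "(LINT y|sphere_volume. g y * ((a \<bullet> y) ^ j * ((p y + q y) * f y))) =
       (LINT y|sphere_volume. g y * ((a \<bullet> y) ^ j * (p y * f y))) + (LINT y|sphere_volume. g y * ((a \<bullet> y) ^ j * (q y * f y)))" for a j
    proof -
      have f: "rpoly f" using add.prems by (simp add: W_def)
      have "(LINT y|sphere_volume. g y * ((a \<bullet> y) ^ j * ((p y + q y) * f y))) =
        (LINT y|sphere_volume. g y * ((a \<bullet> y) ^ j * (p y * f y)) + g y * ((a \<bullet> y) ^ j * (q y * f y)))"
        by (simp only: distrib_left distrib_right)
      also have "\<dots> = (LINT y|sphere_volume. g y * ((a \<bullet> y) ^ j * (p y * f y))) + (LINT y|sphere_volume. g y * ((a \<bullet> y) ^ j * (q y * f y)))"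
        by (intro sphere_integral_add cont rpoly_mult rpoly_power rpoly_inner_left add.hyps f)
      finally show ?thesis .
    qed
    then show ?case using add by (auto simp: W_def)
  next
    case (mult p q)
    then show ?case using mult.IH(1)[OF mult.IH(2)[OF mult.prems]] by (simp add: mult.assoc)
  qed
  have poly0: "(LINT y|sphere_volume. g y * p y) = 0" if "rpoly p" for p
  proof -
    have "W (\<lambda>y. p y * 1)" by (rule Wp[OF that W1])
    then show ?thesis unfolding W_def by (auto dest!: spec[of _ 0])
  qed
  define D where "D = (LINT y|sphere_volume. \<bar>g y\<bar>)"
  have D: "D \<ge> 0" unfolding D_def by (rule Bochner_Integration.integral_nonneg) simp
  have "(LINT y|sphere_volume. g y * g y) \<le> 0"
  proof (rule field_le_epsilon)
    fix e :: real assume e: "e > 0"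
    have e': "e / (D + 1) > 0" using e D by simp
    obtain p where p: "rpoly p" "\<And>y. y \<in> sphere 0 1 \<Longrightarrow> \<bar>g y - p y\<bar> < e / (D + 1)"
      using Stone_Weierstrass_real_polynomial_function[OF compact_sphere g e'] by blast
    have "(LINT y|sphere_volume. g y * g y) = (LINT y|sphere_volume. g y * g y) - (LINT y|sphere_volume. g y * p y)"
      using poly0[OF p(1)] by simp
    also have "\<dots> = (LINT y|sphere_volume. g y * g y - g y * p y)"
      by (rule sphere_integral_diff[symmetric]) (intro continuous_intros g cont p)+
    also have "\<dots> \<le> (LINT y|sphere_volume. e / (D + 1) * \<bar>g y\<bar>)"
    proof (rule integral_mono)
      show "integrable sphere_volume (\<lambda>y. g y * g y - g y * p y)"
        by (intro sphere_integrable continuous_intros g cont p)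
      show "integrable sphere_volume (\<lambda>y. e / (D + 1) * \<bar>g y\<bar>)"
        by (intro sphere_integrable continuous_intros g)
      fix y assume "y \<in> space (sphere_volume :: 'a measure)"
      then have y: "y \<in> sphere 0 1" by (simp add: space_sphere_volume)
      have "g y * g y - g y * p y \<le> \<bar>g y\<bar> * \<bar>g y - p y\<bar>"
        unfolding right_diff_distrib[symmetric] abs_mult[symmetric] by simp
      also have "\<dots> \<le> \<bar>g y\<bar> * (e / (D + 1))" using p(2)[OF y] by (intro mult_left_mono) auto
      finally show "g y * g y - g y * p y \<le> e / (D + 1) * \<bar>g y\<bar>" by (simp only: mult.commute)
    qed
    also have "\<dots> = e / (D + 1) * D" by (simp add: D_def)
    also have "\<dots> \<le> e" using e D by (simp add: field_simps)
    finally show "(LINT y|sphere_volume. g y * g y) \<le> 0 + e" by simp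
  qed
  moreover have "(LINT y|sphere_volume. g y * g y) \<ge> 0" by (rule Bochner_Integration.integral_nonneg) simp
  ultimately have "(LINT y|sphere_volume. g y * g y) = 0" by simp
  then have "g y * g y = 0"
    by (intro sphere_integral_zero_imp[OF _ _ _ y, of "\<lambda>y. g y * g y"] continuous_intros g) auto
  then show ?thesis by simp
qed

text \<open>For \<open>\<nu> > 0\<close> the leading coefficient of the polynomial of degree
  \<open>j\<close> is nonzero, so the powers follow by induction from the lower ones. Homogeneity
  removes the restriction to unit vectors.\<close>

lemma sphere_orthogonal_to_gegenbauer_imp_zero:
  fixes g :: "'a::euclidean_space \<Rightarrow> real"
  assumes g: "continuous_on (sphere 0 1) g" and \<nu>: "\<nu> > 0"
    and orth: "\<And>a m. norm a = 1 \<Longrightarrow> (LINT y|sphere_volume. g y * gegenbauer \<nu> m (a \<bullet> y)) = 0"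
    and y: "norm y = 1"
  shows "g y = 0"
proof (rule sphere_orthogonal_to_powers_imp_zero[OF g _ y])
  have unit: "(LINT y|sphere_volume. g y * (a \<bullet> y) ^ j) = 0" if a: "norm a = 1" for a j
  proof (induction j rule: less_induct)
    case (less j)
    define c where "c k = (-1) ^ k * pochhammer \<nu> (j - k) / (fact k * fact (j - 2 * k)) * 2 ^ (j - 2 * k)" for k
    have cont: "continuous_on (sphere 0 1) (\<lambda>y. c k * (g y * (a \<bullet> y) ^ i))" for i k by (intro continuous_intros g)
    have "0 = (LINT y|sphere_volume. g y * gegenbauer \<nu> j (a \<bullet> y))" using orth[OF a] by simp
    also have "\<dots> = (LINT y|sphere_volume. (\<Sum>k\<le>j div 2. c k * (g y * (a \<bullet> y) ^ (j - 2 * k))))"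
      unfolding gegenbauer_def c_def by (simp add: sum_distrib_left power_mult_distrib mult_ac)
    also have "\<dots> = (\<Sum>k\<le>j div 2. LINT y|sphere_volume. c k * (g y * (a \<bullet> y) ^ (j - 2 * k)))"
      by (rule sphere_integral_sum) (rule cont)
    also have "\<dots> = (\<Sum>k\<le>j div 2. if k = 0 then c 0 * (LINT y|sphere_volume. g y * (a \<bullet> y) ^ j) else 0)"
    proof (rule sum.cong[OF refl])
      fix k assume "k \<in> {..j div 2}"
      then show "(LINT y|sphere_volume. c k * (g y * (a \<bullet> y) ^ (j - 2 * k))) =
          (if k = 0 then c 0 * (LINT y|sphere_volume. g y * (a \<bullet> y) ^ j) else 0)"
        using less.IH[of "j - 2 * k"] by auto
    qed
    also have "\<dots> = c 0 * (LINT y|sphere_volume. g y * (a \<bullet> y) ^ j)" by simp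
    finally have "c 0 * (LINT y|sphere_volume. g y * (a \<bullet> y) ^ j) = 0" by simp
    moreover have "c 0 \<noteq> 0" using pochhammer_pos[OF \<nu>, of j] by (simp add: c_def)
    ultimately show ?case by simp
  qed
  fix a :: 'a and j
  show "(LINT y|sphere_volume. g y * (a \<bullet> y) ^ j) = 0"
  proof (cases "a = 0")
    case True
    show ?thesis using unit[OF y, of 0] True by (cases j) auto
  next
    case False
    have "g z * (a \<bullet> z) ^ j = norm a ^ j * (g z * (sgn a \<bullet> z) ^ j)" for z
    proof -
      have "a \<bullet> z = norm a * (sgn a \<bullet> z)" using False by (simp add: sgn_div_norm)
      then show ?thesis by (simp add: power_mult_distrib)
    qed
    then have "(LINT y|sphere_volume. g y * (a \<bullet> y) ^ j) = (LINT y|sphere_volume. norm a ^ j * (g y * (sgn a \<bullet> y) ^ j))"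
      by (rule Bochner_Integration.integral_cong[OF refl])
    also have "\<dots> = norm a ^ j * (LINT y|sphere_volume. g y * (sgn a \<bullet> y) ^ j)" by simp
    also have "\<dots> = 0" using unit[of "sgn a" j] False by (simp add: norm_sgn)
    finally show ?thesis .
  qed
qed

section \<open>The quaternionic Hopf fibration\<close>

lemma vector_4:
  "(vector [x, y, z, w] :: ('a::zero)^4) $ 1 = x" "(vector [x, y, z, w] :: ('a::zero)^4) $ 2 = y"
  "(vector [x, y, z, w] :: ('a::zero)^4) $ 3 = z" "(vector [x, y, z, w] :: ('a::zero)^4) $ 4 = w"
  unfolding vector_def by simp_all

lemma quat_mult_nth:
  "quat_mult p q $ 1 = p$1 * q$1 - p$2 * q$2 - p$3 * q$3 - p$4 * q$4"
  "quat_mult p q $ 2 = p$1 * q$2 + p$2 * q$1 + p$3 * q$4 - p$4 * q$3"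
  "quat_mult p q $ 3 = p$1 * q$3 - p$2 * q$4 + p$3 * q$1 + p$4 * q$2"
  "quat_mult p q $ 4 = p$1 * q$4 + p$2 * q$3 - p$3 * q$2 + p$4 * q$1"
  unfolding quat_mult_def vector_4 by simp_all

lemma quat_unit_nth:
  "quat_one $ 1 = 1" "quat_one $ 2 = 0" "quat_one $ 3 = 0" "quat_one $ 4 = 0"
  "quat_I $ 1 = 0" "quat_I $ 2 = 1" "quat_I $ 3 = 0" "quat_I $ 4 = 0"
  "quat_J $ 1 = 0" "quat_J $ 2 = 0" "quat_J $ 3 = 1" "quat_J $ 4 = 0"
  "quat_K $ 1 = 0" "quat_K $ 2 = 0" "quat_K $ 3 = 0" "quat_K $ 4 = 1"
  by (simp_all add: quat_one_def quat_I_def quat_J_def quat_K_def axis_def)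

lemma quat_eq_iff: "(p::quat) = q \<longleftrightarrow> p$1 = q$1 \<and> p$2 = q$2 \<and> p$3 = q$3 \<and> p$4 = q$4"
  by (simp add: vec_eq_iff forall_4)

lemma quat_inner: "(p::quat) \<bullet> q = p$1 * q$1 + p$2 * q$2 + p$3 * q$3 + p$4 * q$4"
  by (simp add: inner_vec_def sum_4)

lemma quat_act_nth: "quat_act g q $ i = quat_mult g (q $ i)"
  by (simp add: quat_act_def)

lemma linear_quat_act: "linear (quat_act g)"
  by (rule linearI) (simp_all add: vec_eq_iff[where 'b="'a option"] quat_act_nth quat_eq_iff quat_mult_nth algebra_simps)

lemma quaternionic_structure_quat_act:
  "quaternionic_structure (quat_act quat_I :: quat^'n::finite option \<Rightarrow> quat^'n option) (quat_act quat_J) (quat_act quat_K)"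
proof (rule quaternionic_structure.intro)
  fix x y :: "quat^'n option"
  show "x \<bullet> quat_act quat_I y = - (quat_act quat_I x \<bullet> y)"
    "x \<bullet> quat_act quat_J y = - (quat_act quat_J x \<bullet> y)"
    "x \<bullet> quat_act quat_K y = - (quat_act quat_K x \<bullet> y)"
    unfolding inner_vec_def[of x] inner_vec_def[of "quat_act _ x"] sum_negf[symmetric]
    by (intro sum.cong refl; simp add: quat_act_nth quat_inner quat_mult_nth quat_unit_nth)+
qed (simp_all add: linear_quat_act vec_eq_iff[of _ "_ :: quat^'n option"] quat_act_nth quat_eq_iff quat_mult_nth quat_unit_nth)

interpretation hopf: quaternionic_structure
  "quat_act quat_I :: quat^'n::finite option \<Rightarrow> quat^'n option" "quat_act quat_J" "quat_act quat_K"
  by (rule quaternionic_structure_quat_act)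

lemma quat_act_cis: "quat_act (quat_cis S \<theta>) q = cos \<theta> *\<^sub>R q + sin \<theta> *\<^sub>R quat_act S q"
  by (simp add: vec_eq_iff[of _ "_ :: quat^'a option"] quat_act_nth quat_eq_iff quat_mult_nth quat_unit_nth quat_cis_def algebra_simps)

lemma fibre_deriv_rpoly:
  assumes "rpoly f" shows "fibre_deriv S f = vderiv (quat_act S) f"
proof
  fix q :: "quat^'a option"
  have "((\<lambda>\<theta>. cos \<theta> *\<^sub>R q + sin \<theta> *\<^sub>R quat_act S q) has_vector_derivative quat_act S q) (at 0)"
    unfolding has_vector_derivative_def by (auto intro!: derivative_eq_intros)
  from rpoly_compose_derivative[OF assms this]
  have "((\<lambda>\<theta>. f (quat_act (quat_cis S \<theta>) q)) has_field_derivative dird (quat_act S q) f q) (at 0)"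
    by (simp add: quat_act_cis)
  then show "fibre_deriv S f q = vderiv (quat_act S) f q"
    unfolding fibre_deriv_def vderiv_def by (rule DERIV_imp_deriv)
qed

lemma sub_laplacian_homog:
  fixes f :: "quat^'n::finite option \<Rightarrow> real"
  assumes "rpoly f" "homog m f" "norm q = 1"
  shows "sub_laplacian f q = lap f q - real (m * (m + 4 * CARD('n) + 2)) * f q - hopf.vlap f q"
proof -
  have f2: "fibre_deriv S (fibre_deriv S f) q = vderiv (quat_act S) (vderiv (quat_act S) f) q" for S
    by (simp add: fibre_deriv_rpoly assms rpoly_vderiv linear_quat_act)
  \<comment> \<open>The sum in \<open>sub_laplacian\<close> ranges over a set, so it has three
    summands only because the units are distinct.\<close>
  have d: "quat_I \<noteq> quat_J" "quat_I \<noteq> quat_K" "quat_J \<noteq> quat_K"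
    by (simp_all add: quat_eq_iff quat_unit_nth)
  have "DIM(quat^'n option) = 4 * (CARD('n) + 1)"
    by simp
  then have "real m * (real m + real DIM(quat^'n option) - 2) = real (m * (m + 4 * CARD('n) + 2))"
    by (simp only:) (simp add: algebra_simps)
  then show ?thesis
    unfolding sub_laplacian_def laplace_beltrami_homog[OF assms] f2 hopf.vlap_def using d by simp
qed

lemma DIM_quat_option: "DIM(quat^'n::finite option) = 2 * Suc (2 * CARD('n) + 1)"
  by simp

text \<open>Harmonicity gives the eigenvalue of the Laplace-Beltrami operator and
  \<open>vlap_zonalf\<close> that of the fibre part. Smoothness of polynomials makes the generator
  hypothesis applicable.\<close>

lemma zonalf_eigenfunction:
  fixes a :: "quat^'n::finite option"
  assumes P: "subelliptic_semigroup P" and a: "norm a = 1" and h: "2 * h \<le> m" and t: "t \<ge> 0" and x: "norm x = 1"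
  defines "f \<equiv> hopf.zonalf a (real (2 * CARD('n) + 1)) m h"
  shows "P t f x = exp (- (real (m * (m + 4 * CARD('n) + 2)) - real ((m - 2 * h) * (m - 2 * h + 2))) * t) * f x"
proof (rule C0_semigroup_eigenfunction[of "sphere 0 1" P f "sub_laplacian f"])
  have "real DIM(quat^'n option) = 2 * real (2 * CARD('n) + 1) + 2" unfolding DIM_quat_option by simp
  then have H: "harmonic_poly m f" unfolding f_def by (rule hopf.harmonic_zonalf[OF a h])
  note H' = harmonic_polyD[OF H]
  show "C0_semigroup_on (sphere 0 1) P" "in_generator (sphere 0 1) P f (sub_laplacian f)"
    using P rpoly_smooth_on_sphere[OF H'(1)] unfolding subelliptic_semigroup_def by auto
  show "continuous_on (sphere 0 1) f" by (rule rpoly_continuous[OF H'(1)])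
  fix y :: "quat^'n option" assume "y \<in> sphere 0 1"
  then have "sub_laplacian f y = lap f y - real (m * (m + 4 * CARD('n) + 2)) * f y - hopf.vlap f y"
    by (intro sub_laplacian_homog H') auto
  also have "hopf.vlap f = (\<lambda>y. - real ((m - 2 * h) * (m - 2 * h + 2)) * f y)"
    unfolding f_def by (rule hopf.vlap_zonalf[OF a])
  finally show "sub_laplacian f y = - (real (m * (m + 4 * CARD('n) + 2)) - real ((m - 2 * h) * (m - 2 * h + 2))) * f y"
    unfolding H'(3) by (simp add: algebra_simps)
qed (use t x in \<open>auto simp: compact_sphere\<close>)

lemma quat_act_axis: "quat_act g (axis i p) = axis i (quat_mult g p)"
  by (simp add: vec_eq_iff[of _ "_ :: quat^'a option"] quat_act_nth quat_eq_iff quat_mult_nth axis_def)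

lemma norm_north: "norm (north :: quat^'n::finite option) = 1"
  by (simp add: north_def norm_eq_1 inner_axis' quat_inner quat_unit_nth)

lemma inner_north: "north \<bullet> q = q $ None $ 1"
  by (simp add: north_def inner_axis' quat_inner quat_unit_nth)

lemma hnorm2_north: "hopf.hnorm2 north q = (norm (q $ None))\<^sup>2"
  by (simp add: hopf.hnorm2_def north_def quat_act_axis inner_axis' quat_inner quat_mult_nth quat_unit_nth
      power2_norm_eq_inner)

section \<open>Spectral expansion of the subelliptic kernel\<close>

lemma power_le_fact_exp:
  assumes "(x::real) \<ge> 0" shows "x ^ p \<le> fact p * exp x"
proof -
  have "(\<Sum>n\<in>{p}. x ^ n /\<^sub>R fact n) \<le> (\<Sum>n. x ^ n /\<^sub>R fact n)"
    by (rule sum_le_suminf[OF summable_exp_generic]) (use assms in auto)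
  then show ?thesis unfolding exp_def by (simp add: field_simps)
qed

text \<open>Half of the exponential decay absorbs the polynomial factor; the other half leaves a
  geometric series.\<close>

lemma summable_polynomial_exp:
  assumes "(a::real) > 0" shows "summable (\<lambda>m. real (m + 1) ^ p * exp (- (a * real m)))"
proof (rule summable_comparison_test_ev)
  define b where "b = a / 2"
  have b: "b > 0" using assms by (simp add: b_def)
  have bd: "real (m + 1) ^ p * exp (- (a * real m)) \<le> fact p * exp b / b ^ p * exp (- b) ^ m" for m
  proof -
    have "(b * real (m + 1)) ^ p \<le> fact p * exp (b * real (m + 1))" using b by (intro power_le_fact_exp) simp
    then have "real (m + 1) ^ p \<le> fact p * exp (b * real (m + 1)) / b ^ p"
      using b by (simp only: power_mult_distrib pos_le_divide_eq zero_less_power mult.commute[of "real (m + 1) ^ p"])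
    then have "real (m + 1) ^ p * exp (- (a * real m)) \<le> fact p * exp (b * real (m + 1)) / b ^ p * exp (- (a * real m))"
      by (intro mult_right_mono) auto
    also have "\<dots> = fact p / b ^ p * (exp (b * real (m + 1)) * exp (- (a * real m)))" by simp
    also have "exp (b * real (m + 1)) * exp (- (a * real m)) = exp b * exp (real m * (- b))"
      unfolding exp_add[symmetric] b_def by (simp add: field_simps)
    also have "exp (real m * (- b)) = exp (- b) ^ m" by (rule exp_of_nat_mult)
    finally show ?thesis by simp
  qed
  show "\<forall>\<^sub>F m in sequentially. norm (real (m + 1) ^ p * exp (- (a * real m))) \<le> fact p * exp b / b ^ p * exp (- b) ^ m"
    using bd by (intro always_eventually) (simp add: abs_mult)
  show "summable (\<lambda>m. fact p * exp b / b ^ p * exp (- b) ^ m)"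
    using b by (intro summable_mult summable_geometric) simp
qed

definition sub_exponent :: "nat \<Rightarrow> nat \<Rightarrow> nat \<Rightarrow> real" where
  "sub_exponent n m h = real (m * (m + 4 * n + 2)) - real ((m - 2 * h) * (m - 2 * h + 2))"

text \<open>The reciprocal of the constant in \<open>gegenbauer_reproducing\<close> at
  \<open>l = 2 * n + 1\<close>; it is also the normalisation in the series for the Riemannian heat
  kernel, as \<open>Gamma (2 n + 1) = fact (2 n)\<close>.\<close>

definition sphere_coeff :: "nat \<Rightarrow> nat \<Rightarrow> real" where
  "sphere_coeff n m = fact (2 * n) / (2 * pi ^ (2 * n + 2)) * real (m + 2 * n + 1)"

definition sub_kernel_term :: "nat \<Rightarrow> real \<Rightarrow> nat \<Rightarrow> real \<Rightarrow> real \<Rightarrow> real" where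
  "sub_kernel_term n t m x s =
    (\<Sum>h\<le>m div 2. sphere_coeff n m * exp (- sub_exponent n m h * t) * zonal_part (real (2 * n + 1)) m h x s 1)"

definition sub_kernel :: "nat \<Rightarrow> real \<Rightarrow> real \<Rightarrow> real \<Rightarrow> real" where
  "sub_kernel n t x s = (\<Sum>m. sub_kernel_term n t m x s)"

text \<open>The exponent \<open>4 * n + 5\<close> collects one factor from
  \<open>sphere_coeff\<close>, one from the number of components, and
  \<open>2 * (2 * n + 1) + 1\<close> from \<open>zonal_part_bound\<close>; the decay is that of
  \<open>sub_exponent_ge\<close>.\<close>

definition sub_kernel_bound :: "nat \<Rightarrow> real \<Rightarrow> nat \<Rightarrow> real" where
  "sub_kernel_bound n t m = fact (2 * n) / (2 * pi ^ (2 * n + 2)) * (2 * real (2 * n + 1)) *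
     (real (m + 1) ^ (4 * n + 5) * exp (- (4 * real n * t * real m)))"

lemma sphere_coeff_pos: "sphere_coeff n m > 0"
  by (simp add: sphere_coeff_def)

lemma sub_exponent_ge: "sub_exponent n m h \<ge> 4 * real n * real m"
proof -
  have "real ((m - 2 * h) * (m - 2 * h + 2)) \<le> real (m * (m + 2))"
    unfolding of_nat_le_iff by (intro mult_mono) auto
  then show ?thesis unfolding sub_exponent_def by (simp add: algebra_simps)
qed

lemma sphere_coeff_le: "sphere_coeff n m \<le> fact (2 * n) / (2 * pi ^ (2 * n + 2)) * (real (2 * n + 1) * real (m + 1))"
  unfolding sphere_coeff_def by (intro mult_left_mono) (auto simp: algebra_simps)

lemma sub_kernel_term_bound:
  assumes "t > 0" "0 \<le> \<rho>" "\<rho> \<le> 1"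
  shows "\<bar>sub_kernel_term n t m (\<rho> * cos \<eta>) (\<rho>\<^sup>2)\<bar> \<le> sub_kernel_bound n t m"
proof -
  have "\<bar>sub_kernel_term n t m (\<rho> * cos \<eta>) (\<rho>\<^sup>2)\<bar> \<le>
     (\<Sum>h\<le>m div 2. \<bar>sphere_coeff n m * exp (- sub_exponent n m h * t) * zonal_part (real (2 * n + 1)) m h (\<rho> * cos \<eta>) (\<rho>\<^sup>2) 1\<bar>)"
    unfolding sub_kernel_term_def by (rule sum_abs)
  also have "\<dots> \<le> (\<Sum>h\<le>m div 2. (fact (2 * n) / (2 * pi ^ (2 * n + 2)) * (real (2 * n + 1) * real (m + 1))) *
      exp (- (4 * real n * t * real m)) * (2 * real (m + 1) ^ (2 * (2 * n + 1) + 1)))"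
  proof (rule sum_mono)
    fix h assume h: "h \<in> {..m div 2}"
    have e: "exp (- sub_exponent n m h * t) \<le> exp (- (4 * real n * t * real m))"
      using mult_right_mono[OF sub_exponent_ge[of n m h], of t] assms(1) by (simp add: mult_ac)
    show "\<bar>sphere_coeff n m * exp (- sub_exponent n m h * t) * zonal_part (real (2 * n + 1)) m h (\<rho> * cos \<eta>) (\<rho>\<^sup>2) 1\<bar> \<le>
      (fact (2 * n) / (2 * pi ^ (2 * n + 2)) * (real (2 * n + 1) * real (m + 1))) *
      exp (- (4 * real n * t * real m)) * (2 * real (m + 1) ^ (2 * (2 * n + 1) + 1))"
      unfolding abs_mult abs_exp_cancel abs_of_pos[OF sphere_coeff_pos]
      by (intro mult_mono sphere_coeff_le e zonal_part_bound assms) (use h in auto)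
  qed
  also have "\<dots> = real (m div 2 + 1) * ((fact (2 * n) / (2 * pi ^ (2 * n + 2)) * (real (2 * n + 1) * real (m + 1))) *
      exp (- (4 * real n * t * real m)) * (2 * real (m + 1) ^ (2 * (2 * n + 1) + 1)))" by simp
  also have "\<dots> \<le> real (m + 1) * ((fact (2 * n) / (2 * pi ^ (2 * n + 2)) * (real (2 * n + 1) * real (m + 1))) *
      exp (- (4 * real n * t * real m)) * (2 * real (m + 1) ^ (2 * (2 * n + 1) + 1)))"
    by (intro mult_right_mono) auto
  also have "\<dots> = sub_kernel_bound n t m"
  proof -
    have "real (m + 1) ^ (4 * n + 5) = real (m + 1) * real (m + 1) * real (m + 1) ^ (2 * (2 * n + 1) + 1)"
      by (simp add: power_add power_mult eval_nat_numeral mult_ac)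
    then show ?thesis unfolding sub_kernel_bound_def by (simp only:) (simp only: mult_ac)
  qed
  finally show ?thesis .
qed

lemma summable_sub_kernel_bound: "n > 0 \<Longrightarrow> t > 0 \<Longrightarrow> summable (sub_kernel_bound n t)"
  unfolding sub_kernel_bound_def by (intro summable_mult summable_polynomial_exp) simp

lemma continuous_on_zonal_part:
  assumes "continuous_on S f" "continuous_on S g"
  shows "continuous_on S (\<lambda>y. zonal_part l m h (f y) (g y) 1)"
proof -
  have "continuous_on S (\<lambda>y. cheb k (f y) (g y))" for k
    by (induction k rule: induct_nat_012) (auto intro!: continuous_intros assms)
  then show ?thesis unfolding zonal_part_def by (intro continuous_intros assms)
qed

text \<open>The dominating series is available only for arguments \<open>\<rho> * cos \<eta>\<close>
  and \<open>\<rho>\<^sup>2\<close> with \<open>0 \<le> \<rho> \<le> 1\<close>, which is the purpose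
  of \<open>dom\<close>.\<close>

lemma continuous_on_sub_kernel:
  assumes n: "n > 0" and t: "t > 0" and c: "continuous_on S f" "continuous_on S g"
    and dom: "\<And>y. y \<in> S \<Longrightarrow> \<exists>\<rho> \<eta>. 0 \<le> \<rho> \<and> \<rho> \<le> 1 \<and> f y = \<rho> * cos \<eta> \<and> g y = \<rho>\<^sup>2"
  shows "continuous_on S (\<lambda>y. sub_kernel n t (f y) (g y))"
proof -
  have "uniform_limit S (\<lambda>N y. \<Sum>m<N. sub_kernel_term n t m (f y) (g y)) (\<lambda>y. \<Sum>m. sub_kernel_term n t m (f y) (g y)) sequentially"
  proof (rule Weierstrass_m_test[OF _ summable_sub_kernel_bound[OF n t]])
    fix m y assume "y \<in> S"
    then show "norm (sub_kernel_term n t m (f y) (g y)) \<le> sub_kernel_bound n t m"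
      using dom[of y] sub_kernel_term_bound[OF t] by fastforce
  qed
  then show ?thesis unfolding sub_kernel_def
    by (rule uniform_limit_theorem[rotated])
      (auto intro!: always_eventually continuous_intros continuous_on_zonal_part c simp: sub_kernel_term_def)
qed

lemma sphere_polar:
  fixes q :: "quat^'n::finite option"
  assumes "norm q = 1"
  shows "\<exists>\<rho> \<eta>. 0 \<le> \<rho> \<and> \<rho> \<le> 1 \<and> q $ None $ 1 = \<rho> * cos \<eta> \<and> (norm (q $ None))\<^sup>2 = \<rho>\<^sup>2"
proof -
  define \<rho> where "\<rho> = norm (q $ None)"
  have "\<rho> \<le> 1" using Finite_Cartesian_Product.norm_nth_le[of q None] assms by (simp add: \<rho>_def)
  moreover have "\<bar>q $ None $ 1\<bar> \<le> \<rho>" unfolding \<rho>_def by (metis component_le_norm_cart)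
  moreover have "\<exists>\<eta>. q $ None $ 1 = \<rho> * cos \<eta>"
  proof (cases "\<rho> = 0")
    case True
    then show ?thesis using \<open>\<bar>q $ None $ 1\<bar> \<le> \<rho>\<close> by auto
  next
    case False
    then have "\<rho> > 0" by (simp add: \<rho>_def)
    then have "-1 \<le> q $ None $ 1 / \<rho>" "q $ None $ 1 / \<rho> \<le> 1"
      using \<open>\<bar>q $ None $ 1\<bar> \<le> \<rho>\<close> by (auto simp: field_simps abs_le_iff)
    then have "\<rho> * cos (arccos (q $ None $ 1 / \<rho>)) = q $ None $ 1" using False by (simp add: cos_arccos)
    then show ?thesis by metis
  qed
  ultimately show ?thesis unfolding \<rho>_def by (metis norm_ge_zero)
qed

definition pole_kernel :: "real \<Rightarrow> quat^'n::finite option \<Rightarrow> real" where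
  "pole_kernel t q = sub_kernel CARD('n) t (q $ None $ 1) ((norm (q $ None))\<^sup>2)"

lemma continuous_on_pole_kernel:
  assumes "t > 0" shows "continuous_on (sphere 0 1) (pole_kernel t :: quat^'n::finite option \<Rightarrow> real)"
  unfolding pole_kernel_def
proof (rule continuous_on_sub_kernel[OF zero_less_card_finite assms])
  fix q :: "quat^'n option" assume "q \<in> sphere 0 1"
  then show "\<exists>\<rho> \<eta>. 0 \<le> \<rho> \<and> \<rho> \<le> 1 \<and> q $ None $ 1 = \<rho> * cos \<eta> \<and> (norm (q $ None))\<^sup>2 = \<rho>\<^sup>2"
    by (intro sphere_polar) simp
qed (intro continuous_intros)+

lemma zonal_part_north:
  fixes q :: "quat^'n::finite option"
  assumes "norm q = 1"
  shows "zonal_part l m h (q $ None $ 1) ((norm (q $ None))\<^sup>2) 1 = hopf.zonalf north l m h q"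
  using assms unfolding hopf.zonalf_def[OF norm_north] by (simp add: inner_north hnorm2_north norm_eq_1)

lemma gegenbauer_zonalf:
  fixes a q :: "quat^'n::finite option"
  assumes "norm a = 1" "norm q = 1"
  shows "gegenbauer l m (a \<bullet> q) = (\<Sum>h\<le>m div 2. hopf.zonalf a l m h q)"
  using assms(2) unfolding hopf.zonalf_def[OF assms(1)] gegenbauer_zonal_parts[of _ _ _ "hopf.hnorm2 a q"] by (simp add: norm_eq_1)

text \<open>Components with different fibre eigenvalues are orthogonal by the symmetry of
  \<open>vlap\<close>. In the reproducing identity for the whole zonal harmonic only one component
  can therefore contribute.\<close>

lemma zonalf_reproducing:
  fixes a :: "quat^'n::finite option"
  assumes a: "norm a = 1" and h: "2 * h \<le> m" and h': "2 * h' \<le> M"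
  defines "l \<equiv> real (2 * CARD('n) + 1)"
  shows "(LINT y|sphere_volume. hopf.zonalf north l M h' y * hopf.zonalf a l m h y) =
    (if M = m \<and> h' = h then hopf.zonalf a l m h north / sphere_coeff CARD('n) m else 0)"
proof -
  let ?f = "hopf.zonalf a l m h" and ?Z = "\<lambda>i. hopf.zonalf (north :: quat^'n option) l M i"
  let ?I = "\<lambda>i. LINT y|sphere_volume. ?Z i y * ?f y"
  note pf = hopf.rpoly_zonalf[OF a, of l m h] hopf.homog_zonalf[OF a h, of l]
  note pZ = hopf.rpoly_zonalf[OF norm_north, of l M]
  have zero: "?I i = 0" if i: "2 * i \<le> M" and ne: "M - 2 * i \<noteq> m - 2 * h" for i
  proof -
    let ?ev = "\<lambda>k::nat. real (k * (k + 2))"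
    have "(LINT y|sphere_volume. ?Z i y * hopf.vlap ?f y) = (LINT y|sphere_volume. hopf.vlap (?Z i) y * ?f y)"
      by (rule hopf.sphere_integral_vlap_symmetric[OF pZ hopf.homog_zonalf[OF norm_north i] pf])
    then have "(LINT y|sphere_volume. - ?ev (m - 2 * h) * (?Z i y * ?f y)) = (LINT y|sphere_volume. - ?ev (M - 2 * i) * (?Z i y * ?f y))"
      unfolding hopf.vlap_zonalf[OF a] hopf.vlap_zonalf[OF norm_north] by (simp only: mult_ac)
    then have "?ev (m - 2 * h) * ?I i = ?ev (M - 2 * i) * ?I i"
      by (simp only: Bochner_Integration.integral_mult_right_zero Bochner_Integration.integral_minus mult_minus_left neg_equal_iff_equal)
    moreover have "?ev (m - 2 * h) \<noteq> ?ev (M - 2 * i)"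
    proof -
      have "j * (j + 2) < k * (k + 2)" if "j < k" for j k :: nat
        using that by (intro mult_strict_mono) auto
      then show ?thesis using ne unfolding of_nat_eq_iff by (metis nat_neq_iff)
    qed
    ultimately show ?thesis by simp
  qed
  have "(LINT y|sphere_volume. gegenbauer l M (north \<bullet> y) * ?f y) = (LINT y|sphere_volume. (\<Sum>i\<le>M div 2. ?Z i y * ?f y))"
    by (rule sphere_integral_cong) (simp add: gegenbauer_zonalf[OF norm_north] sum_distrib_right)
  also have "\<dots> = (\<Sum>i\<le>M div 2. ?I i)"
    by (rule sphere_integral_sum) (intro rpoly_continuous rpoly_mult pf pZ)
  finally have sum: "(\<Sum>i\<le>M div 2. ?I i) = (LINT y|sphere_volume. gegenbauer l M (north \<bullet> y) * ?f y)" ..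
  have "real DIM(quat^'n option) = 2 * l + 2" unfolding DIM_quat_option l_def by simp
  then have H: "harmonic_poly m ?f" by (rule hopf.harmonic_zonalf[OF a h])
  have "(LINT y|sphere_volume. gegenbauer (real (2 * CARD('n) + 1)) M (north \<bullet> y) * ?f y) =
     (if M = m then 2 * pi ^ Suc (2 * CARD('n) + 1) / (fact (2 * CARD('n) + 1 - 1) * real (m + (2 * CARD('n) + 1))) * ?f north else 0)"
    by (rule gegenbauer_reproducing[OF H DIM_quat_option]) (simp_all add: norm_north)
  also have "2 * pi ^ Suc (2 * CARD('n) + 1) / (fact (2 * CARD('n) + 1 - 1) * real (m + (2 * CARD('n) + 1))) = 1 / sphere_coeff CARD('n) m"
    by (simp add: sphere_coeff_def add.assoc)
  finally have "(LINT y|sphere_volume. gegenbauer l M (north \<bullet> y) * ?f y) =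
      (if M = m then 1 / sphere_coeff CARD('n) m * ?f north else 0)"
    unfolding l_def .
  then have R: "(\<Sum>i\<le>M div 2. ?I i) = (if M = m then ?f north / sphere_coeff CARD('n) m else 0)"
    unfolding sum by simp
  show ?thesis
  proof (cases "M - 2 * h' = m - 2 * h")
    case False
    then show ?thesis using zero[OF h' False] by auto
  next
    case True
    have "(\<Sum>i\<le>M div 2. ?I i) = (\<Sum>i\<le>M div 2. if i = h' then ?I h' else 0)"
    proof (rule sum.cong[OF refl])
      fix i assume "i \<in> {..M div 2}"
      then have "2 * i \<le> M" by auto
      moreover have "M - 2 * i \<noteq> m - 2 * h" if "i \<noteq> h'" using that True h' \<open>2 * i \<le> M\<close> by auto
      ultimately show "?I i = (if i = h' then ?I h' else 0)" using zero by auto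
    qed
    also have "\<dots> = ?I h'" using h' by auto
    finally show ?thesis using R True h h' by (auto split: if_splits)
  qed
qed

text \<open>The uniform bound on the terms and the finite volume allow termwise integration; only
  the term with the same \<open>m\<close> and \<open>h\<close> survives, and its
  \<open>sphere_coeff\<close> cancels the reproducing constant.\<close>

lemma sphere_integral_pole_kernel_zonalf:
  fixes a :: "quat^'n::finite option"
  assumes t: "t > 0" and a: "norm a = 1" and h: "2 * h \<le> m"
  defines "l \<equiv> real (2 * CARD('n) + 1)"
  shows "(LINT y|sphere_volume. pole_kernel t y * hopf.zonalf a l m h y) =
     exp (- sub_exponent CARD('n) m h * t) * hopf.zonalf a l m h north"
proof -
  let ?n = "CARD('n)" and ?f = "hopf.zonalf a l m h"
  let ?T = "\<lambda>M (y::quat^'n option). sub_kernel_term ?n t M (y $ None $ 1) ((norm (y $ None))\<^sup>2)"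
  note pf = hopf.rpoly_zonalf[OF a, of l m h]
  have cT: "continuous_on (sphere 0 1) (?T M)" for M
    unfolding sub_kernel_term_def by (intro continuous_intros continuous_on_zonal_part)
  have cf: "continuous_on (sphere 0 1) ?f" by (rule rpoly_continuous[OF pf])
  obtain B where B: "B > 0" "\<And>y. y \<in> sphere 0 1 \<Longrightarrow> \<bar>?f y\<bar> \<le> B" using sphere_bounded[OF cf] by blast
  have bound: "\<bar>?T M y * ?f y\<bar> \<le> sub_kernel_bound ?n t M * B" if y: "y \<in> sphere 0 1" for M y
  proof -
    have "\<bar>?T M y\<bar> \<le> sub_kernel_bound ?n t M"
      using sphere_polar[of y] y sub_kernel_term_bound[OF t] by fastforce
    then show ?thesis using B y unfolding abs_mult by (intro mult_mono) auto
  qed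
  have sb: "summable (\<lambda>M. sub_kernel_bound ?n t M * B)"
    by (intro summable_mult2 summable_sub_kernel_bound zero_less_card_finite t)
  have int: "integrable sphere_volume (\<lambda>y. ?T M y * ?f y)" for M
    by (intro sphere_integrable continuous_intros cT cf)
  define V where "V = (LINT y|(sphere_volume :: (quat^'n option) measure). (1::real))"
  have "(LINT y|sphere_volume. pole_kernel t y * ?f y) = (LINT y|sphere_volume. (\<Sum>M. ?T M y * ?f y))"
  proof (rule sphere_integral_cong)
    fix y :: "quat^'n option" assume "norm y = 1"
    then have "summable (\<lambda>M. ?T M y)"
      using sphere_polar[of y] sub_kernel_term_bound[OF t]
      by (intro summable_comparison_test'[OF summable_sub_kernel_bound[OF zero_less_card_finite t], of 0]) fastforce
    then show "pole_kernel t y * ?f y = (\<Sum>M. ?T M y * ?f y)"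
      unfolding pole_kernel_def sub_kernel_def by (rule suminf_mult2)
  qed
  also have "\<dots> = (\<Sum>M. LINT y|sphere_volume. ?T M y * ?f y)"
  proof (rule integral_suminf[OF int])
    show "AE y in sphere_volume. summable (\<lambda>M. norm (?T M y * ?f y))"
      by (rule AE_I2) (rule summable_comparison_test'[OF sb, of 0], use bound in \<open>auto simp: space_sphere_volume\<close>)
    show "summable (\<lambda>M. LINT y|sphere_volume. norm (?T M y * ?f y))"
    proof (rule summable_comparison_test'[of "\<lambda>M. sub_kernel_bound ?n t M * B * V" 0])
      show "summable (\<lambda>M. sub_kernel_bound ?n t M * B * V)" by (intro summable_mult2 sb)
      fix M
      have "(LINT y|sphere_volume. norm (?T M y * ?f y)) \<le> (LINT y|(sphere_volume :: (quat^'n option) measure). sub_kernel_bound ?n t M * B * 1)"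
        by (intro integral_mono sphere_integrable continuous_intros cT cf) (use bound in \<open>auto simp: space_sphere_volume\<close>)
      then show "norm (LINT y|sphere_volume. norm (?T M y * ?f y)) \<le> sub_kernel_bound ?n t M * B * V"
        unfolding V_def Bochner_Integration.integral_mult_right_zero by simp
    qed
  qed
  also have "\<dots> = (\<Sum>M. if M = m then exp (- sub_exponent ?n m h * t) * ?f north else 0)"
  proof (rule suminf_cong)
    fix M
    let ?k = "\<lambda>i. sphere_coeff ?n M * exp (- sub_exponent ?n M i * t)"
    have "(LINT y|sphere_volume. ?T M y * ?f y) = (LINT y|sphere_volume. (\<Sum>i\<le>M div 2. ?k i * (hopf.zonalf north l M i y * ?f y)))"
      by (rule sphere_integral_cong) (simp add: sub_kernel_term_def zonal_part_north l_def sum_distrib_right mult.assoc)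
    also have "\<dots> = (\<Sum>i\<le>M div 2. LINT y|sphere_volume. ?k i * (hopf.zonalf north l M i y * ?f y))"
      by (rule sphere_integral_sum) (intro rpoly_continuous rpoly_cmult rpoly_mult pf hopf.rpoly_zonalf[OF norm_north])
    also have "\<dots> = (\<Sum>i\<le>M div 2. if M = m \<and> i = h then exp (- sub_exponent ?n m h * t) * ?f north else 0)"
    proof (rule sum.cong[OF refl])
      fix i assume "i \<in> {..M div 2}"
      then have "2 * i \<le> M" by auto
      from zonalf_reproducing[OF a h this] show "(LINT y|sphere_volume. ?k i * (hopf.zonalf north l M i y * ?f y)) =
         (if M = m \<and> i = h then exp (- sub_exponent ?n m h * t) * ?f north else 0)"
        unfolding l_def Bochner_Integration.integral_mult_right_zero using sphere_coeff_pos[of ?n m] by auto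
    qed
    also have "\<dots> = (if M = m then exp (- sub_exponent ?n m h * t) * ?f north else 0)"
      using h by (cases "M = m") auto
    finally show "(LINT y|sphere_volume. ?T M y * ?f y) = (if M = m then exp (- sub_exponent ?n m h * t) * ?f north else 0)" .
  qed
  also have "\<dots> = exp (- sub_exponent ?n m h * t) * ?f north"
    using sums_unique[OF sums_single[of m "\<lambda>_. exp (- sub_exponent ?n m h * t) * ?f north"]] by simp
  finally show ?thesis .
qed

text \<open>Both kernels integrate every component \<open>zonalf a l m h\<close>, for every unit
  vector \<open>a\<close>, to its value at the north pole times the same scalar. Summing over
  \<open>h\<close> gives orthogonality of the difference to all zonal polynomials, hence
  equality.\<close>

lemma subelliptic_kernel_series:
  fixes P :: "real \<Rightarrow> (quat^'n::finite option \<Rightarrow> real) \<Rightarrow> quat^'n option \<Rightarrow> real"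
  assumes P: "subelliptic_semigroup P" and p: "kernel_from north P p" and t: "t > 0" and q: "norm q = 1"
  shows "p t q = pole_kernel t q"
proof -
  let ?l = "real (2 * CARD('n) + 1)" and ?g = "\<lambda>y. p t y - pole_kernel t y"
  have cp: "continuous_on (sphere 0 1) (p t)"
    and pe: "\<And>f. continuous_on (sphere 0 1) f \<Longrightarrow> P t f north = (LINT y|sphere_volume. p t y * f y)"
    using p t unfolding kernel_from_def by blast+
  have cg: "continuous_on (sphere 0 1) ?g" by (intro continuous_intros cp continuous_on_pole_kernel t)
  have "?g q = 0"
  proof (rule sphere_orthogonal_to_gegenbauer_imp_zero[OF cg _ _ q])
    show "?l > 0" by simp
    fix a :: "quat^'n option" and m assume a: "norm a = 1"
    let ?f = "\<lambda>h. hopf.zonalf a ?l m h"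
    have cf: "continuous_on (sphere 0 1) (?f h)" for h by (rule rpoly_continuous[OF hopf.rpoly_zonalf[OF a]])
    have zero: "(LINT y|sphere_volume. ?g y * ?f h y) = 0" if h: "2 * h \<le> m" for h
    proof -
      have "(LINT y|sphere_volume. ?g y * ?f h y) = (LINT y|sphere_volume. p t y * ?f h y) - (LINT y|sphere_volume. pole_kernel t y * ?f h y)"
        unfolding left_diff_distrib by (intro sphere_integral_diff continuous_intros cp cf continuous_on_pole_kernel t)
      also have "(LINT y|sphere_volume. p t y * ?f h y) = exp (- sub_exponent CARD('n) m h * t) * ?f h north"
        unfolding pe[OF cf, symmetric] sub_exponent_def
        using zonalf_eigenfunction[OF P a h, of t north] t norm_north by simp
      also have "(LINT y|sphere_volume. pole_kernel t y * ?f h y) = exp (- sub_exponent CARD('n) m h * t) * ?f h north"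
        by (rule sphere_integral_pole_kernel_zonalf[OF t a h])
      finally show ?thesis by simp
    qed
    have "(LINT y|sphere_volume. ?g y * gegenbauer ?l m (a \<bullet> y)) = (LINT y|sphere_volume. (\<Sum>h\<le>m div 2. ?g y * ?f h y))"
      by (rule sphere_integral_cong) (simp only: gegenbauer_zonalf[OF a] sum_distrib_left)
    also have "\<dots> = (\<Sum>h\<le>m div 2. LINT y|sphere_volume. ?g y * ?f h y)"
      by (rule sphere_integral_sum) (intro continuous_intros cg cf)
    also have "\<dots> = 0" by (intro sum.neutral ballI zero) auto
    finally show "(LINT y|sphere_volume. ?g y * gegenbauer ?l m (a \<bullet> y)) = 0" .
  qed
  then show ?thesis by simp
qed

section \<open>Gaussian integrals\<close>

lemma gaussian_integral:
  assumes "t > 0"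
  shows "integrable lborel (\<lambda>y::real. exp (- y\<^sup>2 / (4 * t)))"
    and "(LINT y|lborel. exp (- y\<^sup>2 / (4 * t))) = sqrt (4 * pi * t)"
proof -
  have s: "sqrt (2 * t) > 0" using assms by simp
  have eq: "exp (- y\<^sup>2 / (4 * t)) = sqrt (4 * pi * t) * normal_density 0 (sqrt (2 * t)) y" for y
  proof -
    have "(sqrt (2 * t))\<^sup>2 = 2 * t" using assms by simp
    then show ?thesis using assms by (simp add: normal_density_def mult_ac)
  qed
  show "integrable lborel (\<lambda>y::real. exp (- y\<^sup>2 / (4 * t)))"
    unfolding eq using integrable_normal_density[OF s, of 0] by simp
  show "(LINT y|lborel. exp (- y\<^sup>2 / (4 * t))) = sqrt (4 * pi * t)"
    unfolding eq using integral_normal_density[OF s, of 0] by simp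
qed

text \<open>The real part of the characteristic function of the standard normal distribution,
  rescaled by the standard deviation \<open>sqrt (2 * t)\<close>.\<close>

lemma integral_gaussian_cos:
  assumes t: "t > 0"
  shows "(LINT y|lborel. exp (- y\<^sup>2 / (4 * t)) * cos (\<beta> * y)) = sqrt (4 * pi * t) * exp (- t * \<beta>\<^sup>2)"
proof -
  define \<sigma> where "\<sigma> = sqrt (2 * t)"
  have \<sigma>: "\<sigma> > 0" using t by (simp add: \<sigma>_def)
  have nd: "normal_density 0 1 y = exp (- y\<^sup>2 / 2) / sqrt (2 * pi)" for y by (simp add: std_normal_density_def)
  have "complex_of_real (exp (- (\<sigma> * \<beta>)\<^sup>2 / 2)) = (CLINT x|std_normal_distribution. iexp (\<sigma> * \<beta> * x))"
    using fun_cong[OF char_std_normal_distribution, of "\<sigma> * \<beta>"] by (simp add: char_def)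
  also have "\<dots> = (CLINT x|lborel. normal_density 0 1 x *\<^sub>R iexp (\<sigma> * \<beta> * x))"
    by (subst integral_density) auto
  finally have c: "complex_of_real (exp (- (\<sigma> * \<beta>)\<^sup>2 / 2)) = (CLINT x|lborel. normal_density 0 1 x *\<^sub>R iexp (\<sigma> * \<beta> * x))" .
  have int: "complex_integrable lborel (\<lambda>x. normal_density 0 1 x *\<^sub>R iexp (\<sigma> * \<beta> * x))"
    by (rule Bochner_Integration.integrable_bound[of _ "normal_density 0 1"])
      (auto intro!: integrable_normal_density simp: normal_density_nonneg)
  have "exp (- (\<sigma> * \<beta>)\<^sup>2 / 2) = Re (CLINT x|lborel. normal_density 0 1 x *\<^sub>R iexp (\<sigma> * \<beta> * x))"
    unfolding c[symmetric] by simp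
  also have "\<dots> = (LINT x|lborel. Re (normal_density 0 1 x *\<^sub>R iexp (\<sigma> * \<beta> * x)))"
    by (rule integral_Re[symmetric, OF int])
  also have "\<dots> = (LINT x|lborel. normal_density 0 1 x * cos (\<sigma> * \<beta> * x))"
    by (simp add: Re_exp)
  finally have 1: "(LINT x|lborel. normal_density 0 1 x * cos (\<sigma> * \<beta> * x)) = exp (- (\<sigma> * \<beta>)\<^sup>2 / 2)" ..
  have "(LINT y|lborel. exp (- y\<^sup>2 / (4 * t)) * cos (\<beta> * y)) =
      \<bar>\<sigma>\<bar> *\<^sub>R (LINT x|lborel. exp (- (0 + \<sigma> * x)\<^sup>2 / (4 * t)) * cos (\<beta> * (0 + \<sigma> * x)))"
    by (rule lborel_integral_real_affine) (use \<sigma> in simp)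
  also have "(\<lambda>x. exp (- (0 + \<sigma> * x)\<^sup>2 / (4 * t)) * cos (\<beta> * (0 + \<sigma> * x))) =
     (\<lambda>x. sqrt (2 * pi) * (normal_density 0 1 x * cos (\<sigma> * \<beta> * x)))"
  proof
    fix x
    have "(\<sigma> * x)\<^sup>2 / (4 * t) = x\<^sup>2 / 2" using t by (simp add: \<sigma>_def power_mult_distrib)
    then have "- (\<sigma> * x)\<^sup>2 / (4 * t) = - x\<^sup>2 / 2" by simp
    then show "exp (- (0 + \<sigma> * x)\<^sup>2 / (4 * t)) * cos (\<beta> * (0 + \<sigma> * x)) = sqrt (2 * pi) * (normal_density 0 1 x * cos (\<sigma> * \<beta> * x))"
      unfolding nd by (simp add: mult_ac)
  qed
  also have "\<bar>\<sigma>\<bar> *\<^sub>R (LINT x|lborel. sqrt (2 * pi) * (normal_density 0 1 x * cos (\<sigma> * \<beta> * x))) =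
     \<sigma> * (sqrt (2 * pi) * exp (- (\<sigma> * \<beta>)\<^sup>2 / 2))" using \<sigma> 1 by simp
  also have "(\<sigma> * \<beta>)\<^sup>2 = 2 * (t * \<beta>\<^sup>2)" using t by (simp add: \<sigma>_def power_mult_distrib)
  also have "\<sigma> * (sqrt (2 * pi) * exp (- (2 * (t * \<beta>\<^sup>2)) / 2)) = sqrt (4 * pi * t) * exp (- t * \<beta>\<^sup>2)"
    by (simp add: \<sigma>_def real_sqrt_mult[symmetric] mult.assoc[symmetric])
  finally show ?thesis .
qed

text \<open>Completing the square moves the centre of the Gaussian to
  \<open>2 * t * \<kappa>\<close>.\<close>

lemma integral_exp_gaussian_shift:
  fixes f :: "real \<Rightarrow> real"
  assumes t: "t > 0" and f: "f \<in> borel_measurable borel" "\<And>y. \<bar>f y\<bar> \<le> 1"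
  shows "integrable lborel (\<lambda>y. exp (\<kappa> * y) * (f y * exp (- y\<^sup>2 / (4 * t))))"
    and "(LINT y|lborel. exp (\<kappa> * y) * (f y * exp (- y\<^sup>2 / (4 * t)))) =
      exp (t * \<kappa>\<^sup>2) * (LINT y|lborel. f (2 * t * \<kappa> + y) * exp (- y\<^sup>2 / (4 * t)))"
proof -
  have eq: "exp (\<kappa> * (2 * t * \<kappa> + y)) * (f (2 * t * \<kappa> + y) * exp (- (2 * t * \<kappa> + y)\<^sup>2 / (4 * t))) =
     exp (t * \<kappa>\<^sup>2) * (f (2 * t * \<kappa> + y) * exp (- y\<^sup>2 / (4 * t)))" for y
  proof -
    have "\<kappa> * (2 * t * \<kappa> + y) + - (2 * t * \<kappa> + y)\<^sup>2 / (4 * t) = t * \<kappa>\<^sup>2 + - y\<^sup>2 / (4 * t)"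
      using t by (simp add: field_simps power2_eq_square)
    then have "exp (\<kappa> * (2 * t * \<kappa> + y)) * exp (- (2 * t * \<kappa> + y)\<^sup>2 / (4 * t)) = exp (t * \<kappa>\<^sup>2) * exp (- y\<^sup>2 / (4 * t))"
      unfolding exp_add[symmetric] by simp
    then show ?thesis by (simp add: mult_ac)
  qed
  have int: "integrable lborel (\<lambda>y. f (2 * t * \<kappa> + y) * exp (- y\<^sup>2 / (4 * t)))"
    by (rule Bochner_Integration.integrable_bound[OF gaussian_integral(1)[OF t]])
      (use f in \<open>auto simp: abs_mult mult_left_le_one_le\<close>)
  have "integrable lborel (\<lambda>y. exp (\<kappa> * (2 * t * \<kappa> + 1 * y)) * (f (2 * t * \<kappa> + 1 * y) * exp (- (2 * t * \<kappa> + 1 * y)\<^sup>2 / (4 * t))))"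
    unfolding mult_1 eq by (intro integrable_mult_right int)
  then show "integrable lborel (\<lambda>y. exp (\<kappa> * y) * (f y * exp (- y\<^sup>2 / (4 * t))))"
    by (subst (asm) lborel_integrable_real_affine_iff) auto
  show "(LINT y|lborel. exp (\<kappa> * y) * (f y * exp (- y\<^sup>2 / (4 * t)))) =
      exp (t * \<kappa>\<^sup>2) * (LINT y|lborel. f (2 * t * \<kappa> + y) * exp (- y\<^sup>2 / (4 * t)))"
    by (subst lborel_integral_real_affine[where c=1 and t="2 * t * \<kappa>"]) (simp_all only: mult_1 eq one_neq_zero simp_thms abs_one scaleR_one
        Bochner_Integration.integral_mult_right_zero)
qed

text \<open>After the shift the addition theorem splits the sine: the cosine part is
  \<open>integral_gaussian_cos\<close>, and the sine part is odd and integrates to 0.\<close>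

lemma integral_exp_sin_gaussian:
  assumes t: "t > 0"
  shows "(LINT y|lborel. exp (\<kappa> * y) * (sin (\<beta> * y) * exp (- y\<^sup>2 / (4 * t)))) =
    sqrt (4 * pi * t) * exp (t * \<kappa>\<^sup>2 - t * \<beta>\<^sup>2) * sin (2 * t * \<kappa> * \<beta>)"
proof -
  have ic: "integrable lborel (\<lambda>y. exp (- y\<^sup>2 / (4 * t)) * cos (\<beta> * y))"
    and isin: "integrable lborel (\<lambda>y. exp (- y\<^sup>2 / (4 * t)) * sin (\<beta> * y))"
    by (rule Bochner_Integration.integrable_bound[OF gaussian_integral(1)[OF t]], simp, simp add: abs_mult mult_left_le)+
  have odd: "(LINT y|lborel. exp (- y\<^sup>2 / (4 * t)) * sin (\<beta> * y)) = 0"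
  proof -
    have "(LINT y|lborel. exp (- y\<^sup>2 / (4 * t)) * sin (\<beta> * y)) = (LINT y|lborel. - (exp (- y\<^sup>2 / (4 * t)) * sin (\<beta> * y)))"
      by (subst lborel_integral_real_affine[where c="-1" and t=0]) simp_all
    then show ?thesis by simp
  qed
  have "(LINT y|lborel. exp (\<kappa> * y) * (sin (\<beta> * y) * exp (- y\<^sup>2 / (4 * t)))) =
     exp (t * \<kappa>\<^sup>2) * (LINT y|lborel. sin (\<beta> * (2 * t * \<kappa> + y)) * exp (- y\<^sup>2 / (4 * t)))"
    by (rule integral_exp_gaussian_shift(2)[OF t, of "\<lambda>y. sin (\<beta> * y)"]) auto
  also have "(LINT y|lborel. sin (\<beta> * (2 * t * \<kappa> + y)) * exp (- y\<^sup>2 / (4 * t))) =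
     (LINT y|lborel. sin (2 * t * \<kappa> * \<beta>) * (exp (- y\<^sup>2 / (4 * t)) * cos (\<beta> * y))
        + cos (2 * t * \<kappa> * \<beta>) * (exp (- y\<^sup>2 / (4 * t)) * sin (\<beta> * y)))"
    by (simp add: distrib_left sin_add algebra_simps)
  also have "\<dots> = sin (2 * t * \<kappa> * \<beta>) * (LINT y|lborel. exp (- y\<^sup>2 / (4 * t)) * cos (\<beta> * y))
        + cos (2 * t * \<kappa> * \<beta>) * (LINT y|lborel. exp (- y\<^sup>2 / (4 * t)) * sin (\<beta> * y))"
    using ic isin by (subst Bochner_Integration.integral_add) auto
  also have "\<dots> = sin (2 * t * \<kappa> * \<beta>) * (sqrt (4 * pi * t) * exp (- t * \<beta>\<^sup>2))"
    unfolding odd integral_gaussian_cos[OF t] by simp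
  finally show ?thesis by (simp add: exp_diff exp_minus field_simps)
qed

text \<open>The integrand is even, so the half line carries half of the full integral; this turns
  \<open>sqrt (4 * pi * t)\<close> into \<open>sqrt (pi * t)\<close>.\<close>

lemma integral_sinh_sin_gaussian:
  assumes t: "t > 0"
  shows "set_integrable lborel {0..} (\<lambda>y. sinh (\<kappa> * y) * (sin (\<beta> * y) * exp (- y\<^sup>2 / (4 * t))))"
    and "(LBINT y:{0..}. sinh (\<kappa> * y) * (sin (\<beta> * y) * exp (- y\<^sup>2 / (4 * t)))) =
      sqrt (pi * t) * exp (t * \<kappa>\<^sup>2 - t * \<beta>\<^sup>2) * sin (2 * t * \<kappa> * \<beta>)"
proof -
  let ?F = "\<lambda>\<kappa> y. exp (\<kappa> * y) * (sin (\<beta> * y) * exp (- y\<^sup>2 / (4 * t)))"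
  let ?G = "\<lambda>y. sinh (\<kappa> * y) * (sin (\<beta> * y) * exp (- y\<^sup>2 / (4 * t)))"
  have iF: "integrable lborel (?F \<kappa>)" for \<kappa>
    by (rule integral_exp_gaussian_shift(1)[OF t, of "\<lambda>y. sin (\<beta> * y)"]) auto
  have G: "?G = (\<lambda>y. (?F \<kappa> y - ?F (- \<kappa>) y) / 2)"
    by (auto simp: fun_eq_iff sinh_def algebra_simps)
  have iG: "integrable lborel ?G" unfolding G using iF by (intro integrable_divide Bochner_Integration.integrable_diff)
  show si: "set_integrable lborel {0..} ?G"
    unfolding set_integrable_def by (rule integrable_mult_indicator[OF _ iG]) simp
  have "(LINT y|lborel. ?G y) = ((LINT y|lborel. ?F \<kappa> y) - (LINT y|lborel. ?F (- \<kappa>) y)) / 2"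
    unfolding G using iF[of \<kappa>] iF[of "- \<kappa>"] by simp
  also have "\<dots> = sqrt (4 * pi * t) * exp (t * \<kappa>\<^sup>2 - t * \<beta>\<^sup>2) * sin (2 * t * \<kappa> * \<beta>)"
    unfolding integral_exp_sin_gaussian[OF t] by simp
  also have "sqrt (4 * pi * t) = 2 * sqrt (pi * t)" by (simp add: real_sqrt_mult)
  finally have 1: "(LINT y|lborel. ?G y) = 2 * (sqrt (pi * t) * exp (t * \<kappa>\<^sup>2 - t * \<beta>\<^sup>2) * sin (2 * t * \<kappa> * \<beta>))" by simp
  have si': "set_integrable lborel {..<0} ?G"
    unfolding set_integrable_def by (rule integrable_mult_indicator[OF _ iG]) simp
  have "(LINT y|lborel. ?G y) = (LINT y:{..<0} \<union> {0..}|lborel. ?G y)"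
  proof -
    have "{..<0} \<union> {0..} = (UNIV :: real set)" by auto
    then show ?thesis unfolding set_lebesgue_integral_def by simp
  qed
  also have "\<dots> = (LBINT y:{..<0}. ?G y) + (LBINT y:{0..}. ?G y)"
    by (rule set_integral_Un[OF _ si' si]) auto
  also have "(LBINT y:{..<0}. ?G y) = (LBINT y:{0..}. ?G y)"
  proof -
    have "(LBINT y:{..<0}. ?G y) = (LINT y|lborel. indicator {..<0} (- y) *\<^sub>R ?G (- y))"
      unfolding set_lebesgue_integral_def
      by (subst lborel_integral_real_affine[where c="-1" and t=0]) simp_all
    \<comment> \<open>Reflection maps the open half line to an open one; the missing point 0 is a
      null set.\<close>
    also have "\<dots> = (LINT y|lborel. indicator {0..} y *\<^sub>R ?G y)"
    proof (rule integral_cong_AE)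
      have m: "?G \<in> borel_measurable borel" using borel_measurable_integrable[OF iG] by simp
      then show "(\<lambda>y. indicator {0..} y *\<^sub>R ?G y) \<in> borel_measurable lborel" by simp
      have "(\<lambda>y. - y) \<in> borel_measurable (borel :: real measure)" by simp
      from measurable_compose[OF this m] have "(\<lambda>y. ?G (- y)) \<in> borel_measurable borel" .
      then show "(\<lambda>y. indicator {..<0} (- y) *\<^sub>R ?G (- y)) \<in> borel_measurable lborel" by measurable
      show "AE y in lborel. indicator {..<0} (- y) *\<^sub>R ?G (- y) = indicator {0..} y *\<^sub>R ?G y"
        using AE_lborel_singleton[of 0] by eventually_elim (auto simp: indicator_def)
    qed
    finally show ?thesis unfolding set_lebesgue_integral_def .
  qed
  finally have "(LINT y|lborel. ?G y) = 2 * (LBINT y:{0..}. ?G y)" by simp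
  with 1 show "(LBINT y:{0..}. ?G y) = sqrt (pi * t) * exp (t * \<kappa>\<^sup>2 - t * \<beta>\<^sup>2) * sin (2 * t * \<kappa> * \<beta>)" by simp
qed

section \<open>The integral representation\<close>

definition heat_term :: "nat \<Rightarrow> real \<Rightarrow> nat \<Rightarrow> real \<Rightarrow> real" where
  "heat_term n t m x =
     sphere_coeff n m * exp (- real (m * (m + 4 * n + 2)) * t) * gegenbauer (real (2 * n + 1)) m x"

lemma heat_term_bound:
  assumes x: "-1 \<le> x" "x \<le> cosh y" and y: "y \<ge> 0"
  shows "\<bar>heat_term n t m x\<bar> \<le>
    sphere_coeff n m * exp (- real (m * (m + 4 * n + 2)) * t) * (real (m + 1) ^ (4 * n + 2) * exp (real m * y))"
proof -
  have "\<bar>heat_term n t m x\<bar> =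
      sphere_coeff n m * exp (- real (m * (m + 4 * n + 2)) * t) * \<bar>gegenbauer (real (2 * n + 1)) m x\<bar>"
    using sphere_coeff_pos[of n m] by (simp add: heat_term_def abs_mult)
  also have "\<dots> \<le> sphere_coeff n m * exp (- real (m * (m + 4 * n + 2)) * t) * (real (m + 1) ^ (2 * (2 * n + 1)) * exp (real m * y))"
    using sphere_coeff_pos[of n m] by (intro mult_left_mono abs_gegenbauer_le x y) auto
  finally show ?thesis by simp
qed

text \<open>\<open>E\<close> is what remains of the heat factor after an exponential growth has been
  absorbed. The estimate serves both pointwise convergence and the integrals of the absolute
  values.\<close>

lemma heat_weight_bound:
  assumes "E \<le> C * exp (- (4 * real n * t * real m))" "E \<ge> 0"
  shows "sphere_coeff n m * (real (m + 1) ^ (4 * n + 2) * E) \<le>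
     fact (2 * n) / (2 * pi ^ (2 * n + 2)) * real (2 * n + 1) * C *
       (real (m + 1) ^ (4 * n + 3) * exp (- (4 * real n * t * real m)))"
proof -
  have "sphere_coeff n m * (real (m + 1) ^ (4 * n + 2) * E) \<le>
     fact (2 * n) / (2 * pi ^ (2 * n + 2)) * (real (2 * n + 1) * real (m + 1)) *
       (real (m + 1) ^ (4 * n + 2) * (C * exp (- (4 * real n * t * real m))))"
    using assms(2) by (intro mult_mono sphere_coeff_le assms(1)) auto
  also have "\<dots> = fact (2 * n) / (2 * pi ^ (2 * n + 2)) * real (2 * n + 1) * C *
       (real (m + 1) ^ (4 * n + 3) * exp (- (4 * real n * t * real m)))"
  proof -
    have "real (m + 1) ^ (4 * n + 3) = real (m + 1) * real (m + 1) ^ (4 * n + 2)" by (simp add: eval_nat_numeral)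
    then show ?thesis by (simp only: mult_ac)
  qed
  finally show ?thesis .
qed

text \<open>For arguments up to \<open>cosh y\<close> the polynomials grow like
  \<open>exp (m y)\<close>, which the quadratic exponent in \<open>m\<close> absorbs at the price of
  the constant \<open>exp (y\<^sup>2 / (4 * t))\<close>.\<close>

lemma riemannian_heat_kernel_sums:
  assumes n: "n > 0" and t: "t > 0" and x: "-1 \<le> x" "x \<le> cosh y" and y: "y \<ge> 0"
  shows "summable (\<lambda>m. \<bar>heat_term n t m x\<bar>)"
    and "riemannian_heat_kernel n t x = (\<Sum>m. heat_term n t m x)"
proof -
  let ?C = "fact (2 * n) / (2 * pi ^ (2 * n + 2)) * real (2 * n + 1) * exp (y\<^sup>2 / (4 * t))"
  let ?M = "\<lambda>m. ?C * (real (m + 1) ^ (4 * n + 3) * exp (- (4 * real n * t * real m)))"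
  have "\<bar>heat_term n t m x\<bar> \<le> ?M m" for m
  proof -
    have "exp (- real (m * (m + 4 * n + 2)) * t) * exp (real m * y) \<le> exp (y\<^sup>2 / (4 * t)) * exp (- (4 * real n * t * real m))"
    proof -
      \<comment> \<open>Young's inequality for \<open>real m * y\<close>, written as a
        square.\<close>
      have "0 \<le> (2 * t * real m - y)\<^sup>2 / (4 * t)" using t by simp
      also have "(2 * t * real m - y)\<^sup>2 / (4 * t) = t * (real m)\<^sup>2 - real m * y + y\<^sup>2 / (4 * t)"
        using t by (simp add: power2_eq_square field_simps)
      finally have "real m * y \<le> t * (real m)\<^sup>2 + y\<^sup>2 / (4 * t)" by simp
      moreover have "real (m * (m + 4 * n + 2)) * t = t * (real m)\<^sup>2 + 4 * real n * t * real m + 2 * real m * t"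
        by (simp add: algebra_simps power2_eq_square)
      moreover have "2 * real m * t \<ge> 0" using t by simp
      ultimately show ?thesis unfolding exp_add[symmetric] exp_le_cancel_iff by linarith
    qed
    note hw = heat_weight_bound[OF this]
    have "sphere_coeff n m * (real (m + 1) ^ (4 * n + 2) * (exp (- real (m * (m + 4 * n + 2)) * t) * exp (real m * y))) \<le> ?M m"
      by (rule hw) simp
    moreover have "A * B * (C * D) = A * (C * (B * D))" for A B C D :: real by simp
    ultimately show ?thesis by (intro order_trans[OF heat_term_bound[OF x y]]) (simp only:)
  qed
  then have bound: "norm \<bar>heat_term n t m x\<bar> \<le> ?M m" for m by (simp only: real_norm_def abs_abs)
  have "summable ?M"
    by (rule summable_mult, rule summable_polynomial_exp) (use n t in simp)
  then have s: "summable (\<lambda>m. \<bar>heat_term n t m x\<bar>)"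
    by (rule summable_comparison_test'[of _ 0]) (rule bound)
  then show "summable (\<lambda>m. \<bar>heat_term n t m x\<bar>)" .
  have G: "Gamma (real (2 * n + 1)) = fact (2 * n)"
    using Gamma_fact[of "2 * n", where 'a=real] by (simp add: add.commute)
  have c: "Gamma (real (2 * n + 1)) / (2 * pi ^ (2 * n + 2)) *
     (real (m + 2 * n + 1) * exp (- real (m * (m + 4 * n + 2)) * t) * gegenbauer (real (2 * n + 1)) m x) = heat_term n t m x" for m
    unfolding G by (simp add: heat_term_def sphere_coeff_def)
  have "summable (\<lambda>m. real (m + 2 * n + 1) * exp (- real (m * (m + 4 * n + 2)) * t) * gegenbauer (real (2 * n + 1)) m x)"
  proof (rule summable_mult_D)
    show "summable (\<lambda>m. Gamma (real (2 * n + 1)) / (2 * pi ^ (2 * n + 2)) *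
       (real (m + 2 * n + 1) * exp (- real (m * (m + 4 * n + 2)) * t) * gegenbauer (real (2 * n + 1)) m x))"
      unfolding c using s by (rule summable_rabs_cancel)
    show "Gamma (real (2 * n + 1)) / (2 * pi ^ (2 * n + 2)) \<noteq> 0"
      unfolding G by simp
  qed
  then show "riemannian_heat_kernel n t x = (\<Sum>m. heat_term n t m x)"
    unfolding riemannian_heat_kernel_def by (subst suminf_mult[symmetric]) (simp_all only: c)
qed

text \<open>The factor \<open>sinh y\<close> turns each Chebyshev factor at \<open>cosh y\<close>
  into \<open>sinh ((k + 1) y)\<close>; the Gaussian integral with \<open>\<kappa> = k + 1\<close>
  and \<open>\<beta> = \<alpha> / (2 * t)\<close> returns \<open>sin ((k + 1) \<alpha>)\<close>, and
  division by \<open>sin \<alpha>\<close> restores the Chebyshev factor at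
  \<open>cos \<alpha>\<close>.\<close>

lemma heat_term_integral:
  fixes t \<alpha> \<rho> :: real
  assumes n: "n > 0" and t: "t > 0" and \<alpha>: "0 < \<alpha>" "\<alpha> < pi"
  defines "T \<equiv> \<lambda>m y. sinh y * sin (\<alpha> * y / (2 * t)) / sin \<alpha> * exp (- (y\<^sup>2 - \<alpha>\<^sup>2) / (4 * t)) * heat_term n t m (\<rho> * cosh y)"
  shows "set_integrable lborel {0..} (T m)"
    and "(LBINT y:{0..}. T m y) = sqrt (pi * t) * exp t * sub_kernel_term n t m (\<rho> * cos \<alpha>) (\<rho>\<^sup>2)"
proof -
  define \<beta> where "\<beta> = \<alpha> / (2 * t)"
  let ?k = "\<lambda>h. m - 2 * h"
  let ?A = "\<lambda>h. zonal_amplitude (real (2 * n + 1)) m h (\<rho>\<^sup>2)"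
  define c where "c = exp (\<alpha>\<^sup>2 / (4 * t)) / sin \<alpha> * (sphere_coeff n m * exp (- real (m * (m + 4 * n + 2)) * t))"
  let ?S = "\<lambda>h y. sinh (real (?k h + 1) * y) * (sin (\<beta> * y) * exp (- y\<^sup>2 / (4 * t)))"
  have T: "T m = (\<lambda>y. \<Sum>h\<le>m div 2. c * ?A h * \<rho> ^ ?k h * ?S h y)"
  proof
    fix y
    have g: "gegenbauer (real (2 * n + 1)) m (\<rho> * cosh y) * sinh y = (\<Sum>h\<le>m div 2. ?A h * (\<rho> ^ ?k h * sinh (real (?k h + 1) * y)))"
      unfolding gegenbauer_zonal_parts[of _ _ _ "\<rho>\<^sup>2"] zonal_part_amplitude sum_distrib_right mult.assoc cheb_sinh ..
    have e: "exp (- (y\<^sup>2 - \<alpha>\<^sup>2) / (4 * t)) = exp (\<alpha>\<^sup>2 / (4 * t)) * exp (- y\<^sup>2 / (4 * t))"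
      unfolding exp_add[symmetric] by (simp add: diff_divide_distrib)
    have "T m y = c * (gegenbauer (real (2 * n + 1)) m (\<rho> * cosh y) * sinh y) * (sin (\<beta> * y) * exp (- y\<^sup>2 / (4 * t)))"
      unfolding T_def heat_term_def c_def e \<beta>_def by (simp add: mult_ac)
    then show "T m y = (\<Sum>h\<le>m div 2. c * ?A h * \<rho> ^ ?k h * ?S h y)"
      unfolding g by (simp only: sum_distrib_left sum_distrib_right mult_ac)
  qed
  have iS: "set_integrable lborel {0..} (\<lambda>y. c * ?A h * \<rho> ^ ?k h * ?S h y)" for h
    by (intro set_integrable_mult_right integral_sinh_sin_gaussian(1) t)
  show "set_integrable lborel {0..} (T m)"
    using iS unfolding T set_integrable_def scaleR_sum_right by (intro Bochner_Integration.integrable_sum)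
  have "(LBINT y:{0..}. T m y) = (\<Sum>h\<le>m div 2. LBINT y:{0..}. c * ?A h * \<rho> ^ ?k h * ?S h y)"
    using iS unfolding T set_integrable_def set_lebesgue_integral_def scaleR_sum_right
    by (intro Bochner_Integration.integral_sum)
  also have "\<dots> = (\<Sum>h\<le>m div 2. sqrt (pi * t) * exp t *
      (sphere_coeff n m * exp (- sub_exponent n m h * t) * zonal_part (real (2 * n + 1)) m h (\<rho> * cos \<alpha>) (\<rho>\<^sup>2) 1))"
  proof (rule sum.cong[OF refl])
    fix h
    let ?\<kappa> = "real (?k h + 1)"
    have b: "2 * t * ?\<kappa> * \<beta> = ?\<kappa> * \<alpha>" "t * \<beta>\<^sup>2 = \<alpha>\<^sup>2 / (4 * t)"
      using t by (simp_all add: \<beta>_def power2_eq_square)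
    \<comment> \<open>The Gaussian contributes \<open>exp (t (k + 1)^2)\<close>. Since
      \<open>(k + 1)^2 = k (k + 2) + 1\<close>, it changes the Riemannian exponent into the
      subelliptic one and leaves \<open>exp t\<close>; the terms in \<open>\<alpha>\<close>
      cancel.\<close>
    have e: "exp (\<alpha>\<^sup>2 / (4 * t)) * exp (- real (m * (m + 4 * n + 2)) * t) * exp (t * ?\<kappa>\<^sup>2 - \<alpha>\<^sup>2 / (4 * t)) =
       exp t * exp (- sub_exponent n m h * t)"
    proof -
      have k: "(real (j + 1))\<^sup>2 = real (j * (j + 2)) + 1" for j by (simp add: power2_eq_square algebra_simps)
      have "A + - B * t + (t * (C + 1) - A) = t + - (B - C) * t" for A B C by (simp add: algebra_simps)
      then show ?thesis unfolding exp_add[symmetric] sub_exponent_def k by (simp only:)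
    qed
    have s: "sin \<alpha> \<noteq> 0" using sin_gt_zero[OF \<alpha>] by simp
    have "(LBINT y:{0..}. c * ?A h * \<rho> ^ ?k h * ?S h y) =
       c * ?A h * \<rho> ^ ?k h * (sqrt (pi * t) * exp (t * ?\<kappa>\<^sup>2 - \<alpha>\<^sup>2 / (4 * t)) * sin (?\<kappa> * \<alpha>))"
      using integral_sinh_sin_gaussian(2)[OF t, of ?\<kappa> \<beta>] unfolding b by simp
    also have "\<dots> = sqrt (pi * t) * (exp (\<alpha>\<^sup>2 / (4 * t)) * exp (- real (m * (m + 4 * n + 2)) * t) * exp (t * ?\<kappa>\<^sup>2 - \<alpha>\<^sup>2 / (4 * t)))
       * sphere_coeff n m * ?A h * (\<rho> ^ ?k h * sin (?\<kappa> * \<alpha>)) / sin \<alpha>"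
      unfolding c_def by (simp add: mult_ac)
    also have "\<dots> = sqrt (pi * t) * (exp t * exp (- sub_exponent n m h * t))
       * sphere_coeff n m * ?A h * cheb (?k h) (\<rho> * cos \<alpha>) (\<rho>\<^sup>2)"
      unfolding e cheb_sin[symmetric] using s by simp
    finally show "(LBINT y:{0..}. c * ?A h * \<rho> ^ ?k h * ?S h y) = sqrt (pi * t) * exp t *
      (sphere_coeff n m * exp (- sub_exponent n m h * t) * zonal_part (real (2 * n + 1)) m h (\<rho> * cos \<alpha>) (\<rho>\<^sup>2) 1)"
      unfolding zonal_part_amplitude by (simp only: mult_ac)
  qed
  finally show "(LBINT y:{0..}. T m y) = sqrt (pi * t) * exp t * sub_kernel_term n t m (\<rho> * cos \<alpha>) (\<rho>\<^sup>2)"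
    unfolding sub_kernel_term_def sum_distrib_left .
qed

text \<open>Termwise integration by \<open>heat_term_integral\<close>; the work lies in the
  summability of the integrals of the absolute values.\<close>

lemma sub_kernel_integral:
  assumes n: "n > 0" and t: "t > 0" and \<alpha>: "0 < \<alpha>" "\<alpha> < pi" and \<rho>: "0 \<le> \<rho>" "\<rho> \<le> 1"
  defines "F \<equiv> \<lambda>y. sinh y * sin (\<alpha> * y / (2 * t)) / sin \<alpha> * exp (- (y\<^sup>2 - \<alpha>\<^sup>2) / (4 * t))
     * riemannian_heat_kernel n t (\<rho> * cosh y)"
  shows "set_integrable lborel {0..} F"
    and "(LBINT y:{0..}. F y) = sqrt (pi * t) * exp t * sub_kernel n t (\<rho> * cos \<alpha>) (\<rho>\<^sup>2)"
proof -
  define w where "w y = sinh y * sin (\<alpha> * y / (2 * t)) / sin \<alpha> * exp (- (y\<^sup>2 - \<alpha>\<^sup>2) / (4 * t))" for y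
  define f where "f m y = indicator {0..} y *\<^sub>R (w y * heat_term n t m (\<rho> * cosh y))" for m y
  have x: "-1 \<le> \<rho> * cosh y" "\<rho> * cosh y \<le> cosh y" for y :: real
  proof -
    have "0 \<le> \<rho> * cosh y" using \<rho> by simp
    then show "-1 \<le> \<rho> * cosh y" by simp
    show "\<rho> * cosh y \<le> cosh y" using \<rho> by (intro mult_left_le_one_le) auto
  qed
  note sums = riemannian_heat_kernel_sums[OF n t x]
  have int: "integrable lborel (f m)" for m
    using heat_term_integral(1)[OF n t \<alpha>, of m \<rho>] unfolding f_def w_def set_integrable_def .
  have fF: "indicator {0..} y *\<^sub>R F y = (\<Sum>m. f m y)" for y
  proof (cases "y \<ge> 0")
    case True
    have "F y = w y * (\<Sum>m. heat_term n t m (\<rho> * cosh y))" unfolding F_def w_def sums(2)[OF True] ..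
    also have "\<dots> = (\<Sum>m. w y * heat_term n t m (\<rho> * cosh y))"
      by (rule suminf_mult[symmetric]) (rule summable_rabs_cancel[OF sums(1)[OF True]])
    finally show ?thesis using True by (simp add: f_def)
  qed (simp add: f_def)
  have sumf: "summable (\<lambda>m. norm (f m y))" for y
  proof (cases "y \<ge> 0")
    case True
    then show ?thesis using summable_mult[OF sums(1)[OF True], of "\<bar>w y\<bar>"] by (simp add: f_def abs_mult)
  qed (simp add: f_def)
  have s: "sin \<alpha> > 0" by (rule sin_gt_zero[OF \<alpha>])
  define D where "D = exp (\<alpha>\<^sup>2 / (4 * t)) / sin \<alpha>"
  have D: "D > 0" using s by (simp add: D_def)
  have w: "\<bar>w y\<bar> \<le> D * (exp y * exp (- y\<^sup>2 / (4 * t)))" if "y \<ge> 0" for y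
  proof -
    have e: "exp (- (y\<^sup>2 - \<alpha>\<^sup>2) / (4 * t)) = exp (\<alpha>\<^sup>2 / (4 * t)) * exp (- y\<^sup>2 / (4 * t))"
      unfolding exp_add[symmetric] by (simp add: diff_divide_distrib)
    have "sinh y \<ge> 0" using that by simp
    moreover have "sinh y \<le> exp y" using sinh_plus_cosh[of y] cosh_real_nonneg[of y] by linarith
    ultimately have "\<bar>sinh y\<bar> \<le> exp y" by simp
    then have "\<bar>sinh y\<bar> * \<bar>sin (\<alpha> * y / (2 * t))\<bar> \<le> exp y * 1"
      by (intro mult_mono) auto
    then have "\<bar>sinh y\<bar> * \<bar>sin (\<alpha> * y / (2 * t))\<bar> * (D * exp (- y\<^sup>2 / (4 * t))) \<le> exp y * 1 * (D * exp (- y\<^sup>2 / (4 * t)))"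
      using D by (intro mult_right_mono) auto
    moreover have "\<bar>w y\<bar> = \<bar>sinh y\<bar> * \<bar>sin (\<alpha> * y / (2 * t))\<bar> * (D * exp (- y\<^sup>2 / (4 * t)))"
      unfolding w_def D_def e using s by (simp add: abs_mult)
    ultimately show ?thesis by (simp add: mult_ac)
  qed
  let ?E = "\<lambda>\<kappa> y. exp (\<kappa> * y) * (1 * exp (- y\<^sup>2 / (4 * t)))"
  have iE: "integrable lborel (?E \<kappa>)" for \<kappa>
    by (rule integral_exp_gaussian_shift(1)[OF t, of "\<lambda>_. 1"]) auto
  have E: "(LINT y|lborel. ?E \<kappa> y) = exp (t * \<kappa>\<^sup>2) * sqrt (4 * pi * t)" for \<kappa>
    using integral_exp_gaussian_shift(2)[OF t, of "\<lambda>_. 1" \<kappa>] gaussian_integral(2)[OF t] by simp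
  have sumI: "summable (\<lambda>m. LINT y|lborel. norm (f m y))"
  proof (rule summable_comparison_test')
    let ?K = "\<lambda>m. D * (sphere_coeff n m * exp (- real (m * (m + 4 * n + 2)) * t) * real (m + 1) ^ (4 * n + 2))"
    let ?C = "fact (2 * n) / (2 * pi ^ (2 * n + 2)) * real (2 * n + 1) * (exp t * (D * sqrt (4 * pi * t)))"
    show "summable (\<lambda>m. ?C * (real (m + 1) ^ (4 * n + 3) * exp (- (4 * real n * t * real m))))"
      using n t by (intro summable_mult summable_polynomial_exp) auto
    fix m
    have bound: "norm (f m y) \<le> ?K m * ?E (real (m + 1)) y" for y
    proof (cases "y \<ge> 0")
      case True
      have "norm (f m y) = \<bar>w y\<bar> * \<bar>heat_term n t m (\<rho> * cosh y)\<bar>" using True by (simp add: f_def abs_mult)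
      also have "\<dots> \<le> (D * (exp y * exp (- y\<^sup>2 / (4 * t)))) *
         (sphere_coeff n m * exp (- real (m * (m + 4 * n + 2)) * t) * (real (m + 1) ^ (4 * n + 2) * exp (real m * y)))"
        using D by (intro mult_mono w heat_term_bound x True) auto
      also have "\<dots> = ?K m * (exp y * exp (real m * y) * exp (- y\<^sup>2 / (4 * t)))" by (simp only: mult_ac)
      also have "exp y * exp (real m * y) = exp (real (m + 1) * y)"
        by (simp add: exp_add[symmetric] algebra_simps)
      finally show ?thesis by simp
    next
      case False
      then show ?thesis using D sphere_coeff_pos[of n m] by (simp add: f_def)
    qed
    have "(LINT y|lborel. norm (f m y)) \<le> (LINT y|lborel. ?K m * ?E (real (m + 1)) y)"
      by (intro integral_mono integrable_norm int integrable_mult_right iE bound)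
    also have "\<dots> = ?K m * (exp (t * (real (m + 1))\<^sup>2) * sqrt (4 * pi * t))"
      unfolding Bochner_Integration.integral_mult_right_zero E ..
    also have "\<dots> = sphere_coeff n m * (real (m + 1) ^ (4 * n + 2) *
        ((exp (- real (m * (m + 4 * n + 2)) * t) * exp (t * (real (m + 1))\<^sup>2)) * (D * sqrt (4 * pi * t))))"
      by (simp only: mult_ac)
    \<comment> \<open>The integral over \<open>y\<close> grows like
      \<open>exp (t (m + 1)^2)\<close>, which cancels the quadratic part of the heat factor exactly;
      only the linear decay \<open>4 n m t\<close> is left.\<close>
    also have "exp (- real (m * (m + 4 * n + 2)) * t) * exp (t * (real (m + 1))\<^sup>2) = exp t * exp (- (4 * real n * t * real m))"
      unfolding exp_add[symmetric] by (simp add: algebra_simps power2_eq_square)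
    also have "sphere_coeff n m * (real (m + 1) ^ (4 * n + 2) * (exp t * exp (- (4 * real n * t * real m)) * (D * sqrt (4 * pi * t))))
       \<le> ?C * (real (m + 1) ^ (4 * n + 3) * exp (- (4 * real n * t * real m)))"
      using D t by (intro heat_weight_bound) (simp_all add: mult_ac)
    finally show "norm (LINT y|lborel. norm (f m y)) \<le> ?C * (real (m + 1) ^ (4 * n + 3) * exp (- (4 * real n * t * real m)))"
      by simp
  qed
  show "set_integrable lborel {0..} F"
    unfolding set_integrable_def fF using sumf by (intro integrable_suminf int sumI) auto
  have "(LBINT y:{0..}. F y) = (LINT y|lborel. (\<Sum>m. f m y))"
    unfolding set_lebesgue_integral_def fF ..
  also have "\<dots> = (\<Sum>m. LINT y|lborel. f m y)"
    using sumf by (intro integral_suminf int sumI) auto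
  also have "\<dots> = (\<Sum>m. sqrt (pi * t) * exp t * sub_kernel_term n t m (\<rho> * cos \<alpha>) (\<rho>\<^sup>2))"
    using heat_term_integral(2)[OF n t \<alpha>, of _ \<rho>] unfolding f_def w_def set_lebesgue_integral_def by simp
  also have "\<dots> = sqrt (pi * t) * exp t * sub_kernel n t (\<rho> * cos \<alpha>) (\<rho>\<^sup>2)"
    unfolding sub_kernel_def
  proof (rule suminf_mult)
    show "summable (\<lambda>m. sub_kernel_term n t m (\<rho> * cos \<alpha>) (\<rho>\<^sup>2))"
      by (rule summable_comparison_test'[OF summable_sub_kernel_bound[OF n t], of 0])
        (use sub_kernel_term_bound[OF t \<rho>] in auto)
  qed
  finally show "(LBINT y:{0..}. F y) = sqrt (pi * t) * exp t * sub_kernel n t (\<rho> * cos \<alpha>) (\<rho>\<^sup>2)" .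
qed

theorem proposition2p7:
  fixes P :: "real \<Rightarrow> (quat^'n::finite option \<Rightarrow> real) \<Rightarrow> quat^'n option \<Rightarrow> real"
    and p :: "real \<Rightarrow> quat^'n option \<Rightarrow> real"
    and q :: "quat^'n option"
    and t r \<eta> :: real
  assumes "subelliptic_semigroup P"
    and "kernel_from north P p"
    and "t > 0" and "0 \<le> r" and "r < pi / 2" and "0 \<le> \<eta>" and "\<eta> \<le> pi"
    and "q \<in> sphere 0 1"
    and "norm (q $ None) = cos r"
    and "q $ None $ 1 = cos r * cos \<eta>"
  shows
    "let integrand = (\<lambda>\<alpha> y. sinh y * sin (\<alpha> * y / (2 * t)) / sin \<alpha>
           * exp (- (y\<^sup>2 - \<alpha>\<^sup>2) / (4 * t))
           * riemannian_heat_kernel CARD('n) t (cos r * cosh y));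
         rhs = (\<lambda>\<alpha>. exp (- t) / sqrt (pi * t) * (LBINT y:{0..}. integrand \<alpha> y))
     in (0 < \<eta> \<and> \<eta> < pi \<longrightarrow>
           set_integrable lborel {0..} (integrand \<eta>) \<and> p t q = rhs \<eta>) \<and>
        (\<eta> = 0 \<or> \<eta> = pi \<longrightarrow> (rhs \<longlongrightarrow> p t q) (at \<eta> within {0<..<pi}))"
proof -
  define integrand where "integrand = (\<lambda>\<alpha> y. sinh y * sin (\<alpha> * y / (2 * t)) / sin \<alpha>
           * exp (- (y\<^sup>2 - \<alpha>\<^sup>2) / (4 * t)) * riemannian_heat_kernel CARD('n) t (cos r * cosh y))"
  define rhs where "rhs = (\<lambda>\<alpha>. exp (- t) / sqrt (pi * t) * (LBINT y:{0..}. integrand \<alpha> y))"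
  let ?k = "\<lambda>\<alpha>. sub_kernel CARD('n) t (cos r * cos \<alpha>) ((cos r)\<^sup>2)"
  have r: "0 \<le> cos r" "cos r \<le> 1" using assms(4,5) by (auto intro: cos_ge_zero)
  have "p t q = pole_kernel t q"
    by (rule subelliptic_kernel_series[OF assms(1-3)]) (use assms(8) in simp)
  then have p: "p t q = ?k \<eta>" unfolding pole_kernel_def assms(9,10) .
  have int: "set_integrable lborel {0..} (integrand \<alpha>)" "rhs \<alpha> = ?k \<alpha>" if "0 < \<alpha>" "\<alpha> < pi" for \<alpha>
  proof -
    note I = sub_kernel_integral[OF zero_less_card_finite[where 'a='n] assms(3) that r]
    show "set_integrable lborel {0..} (integrand \<alpha>)" unfolding integrand_def by (rule I(1))
    have "rhs \<alpha> = exp (- t) / sqrt (pi * t) * (sqrt (pi * t) * exp t * ?k \<alpha>)"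
      unfolding rhs_def integrand_def I(2) ..
    also have "\<dots> = (exp (- t) * exp t) * ?k \<alpha>" using assms(3) by simp
    finally show "rhs \<alpha> = ?k \<alpha>" by (simp add: exp_add[symmetric])
  qed
  \<comment> \<open>The series is continuous in the angle on the whole line, and the integral
    formula agrees with it on the open interval; so the limits at 0 and \<open>pi\<close> are read
    off from the series.\<close>
  have "continuous_on UNIV ?k"
    by (rule continuous_on_sub_kernel[OF zero_less_card_finite assms(3)]) (use r in \<open>auto intro!: continuous_intros\<close>)
  then have "(?k \<longlongrightarrow> ?k \<eta>) (at \<eta>)" by (simp add: continuous_on_def)
  then have "(?k \<longlongrightarrow> p t q) (at \<eta> within {0<..<pi})" unfolding p by (rule tendsto_within_subset) simp
  then have lim: "(rhs \<longlongrightarrow> p t q) (at \<eta> within {0<..<pi})"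
  proof (rule Lim_transform_eventually)
    show "\<forall>\<^sub>F \<alpha> in at \<eta> within {0<..<pi}. ?k \<alpha> = rhs \<alpha>"
      unfolding eventually_at_filter by (rule always_eventually) (simp add: int)
  qed
  have "(0 < \<eta> \<and> \<eta> < pi \<longrightarrow> set_integrable lborel {0..} (integrand \<eta>) \<and> p t q = rhs \<eta>) \<and>
        (\<eta> = 0 \<or> \<eta> = pi \<longrightarrow> (rhs \<longlongrightarrow> p t q) (at \<eta> within {0<..<pi}))"
    using int p lim by auto
  then show ?thesis unfolding rhs_def integrand_def Let_def .
qed

end
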